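(* Let $\mathbf{k}$ be a field, $A$ a unital $\mathbf{k}$-algebra, and let $(P,\mu_P)$ be any shifted projective bimodule resolution of $A$ equipped with a weakly counital $A_\infty$-coalgebra structure $\delta$ with $\delta_1=d_P$ and weak counit $\mu_P$. For any chain map $f:P\to A$ of degree $n$, there exists an $A_\infty$-coderivation $\alpha_f$ on $P$ of degree $n$ with $(\alpha_f)_0=f$.
   Context: Conventions. $A^e=A\otimes_{\mathbf{k}}A^{op}$; $A$-bimodules are identified with $A^e$-modules, and $A$ is regarded as a complex concentrated in degree $0$ (so a chain map $f:P\to A$ of degree $n$ is a homogeneous bimodule map of degree $n$ with $f d_P=0$). Complexes have differentials of degree $1$. All maps between graded bimodules are $A^e$-linear. The Koszul sign rule is used: $(f\otimes_A g)(x\otimes_A y)=(-1)^{|g||x|}f(x)\otimes_A g(y)$. $1$ denotes identity maps and $C^{\otimes_A 0}=A$. An $A_\infty$-coalgebra is a graded $A$-bimodule $C$ with maps $\delta_n:C\to C^{\otimes_A n}$, $n\ge 1$, of degree $1$ (put $\delta_0=0$) such that $\sum_{r+s+t=N}(1^{\otimes_A r}\otimes_A\delta_s\otimes_A 1^{\otimes_A t})\delta_{N-s+1}=0$ for all $N\ge 0$. It is weakly counital, with weak counit $\mu$, if $\mu:C\to A$ is a bimodule map of degree $-1$ with $(\mu\otimes_A\mu)\delta_2=\mu$ and $\mu^{\otimes_A n}\delta_n=0$ for all $n>2$. If $P'$ is a projective $A$-bimodule resolution of $A$ (in degrees $\le 0$), the associated shifted projective bimodule resolution is the complex $P$ with $P_{i}=P'_{i-1}$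 and differential $d_P$, together with the bimodule chain map $\mu_P:P\to A$ of degree $-1$ given by the augmentation, which is a quasi-isomorphism up to the shift. An $A_\infty$-coderivation of degree $l$ on $C$ is a sequence $\alpha=(\alpha_n)_{n\ge0}$ of maps $\alpha_n:C\to C^{\otimes_A n}$ of degree $l$ such that for all $N\ge0$ \[ \sum_{r+s+t=N}(1^{\otimes_A r}\otimes_A\delta_s\otimes_A1^{\otimes_A t})\alpha_{N-s+1}=(-1)^l\sum_{r+s+t=N}(1^{\otimes_A r}\otimes_A\alpha_s\otimes_A1^{\otimes_A t})\delta_{N-s+1}. \] *)

theory Defs
  imports
    "HOL.Vector_Spaces"
    "HOL-Library.Poly_Mapping"
    "HOL-Library.Set_Algebras"
    "HOL-Computational_Algebra.Group_Closure"
begin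

section \<open>Algebras and bimodules\<close>

text \<open>
  The sort \<open>{ring, monoid_mult}\<close> is that of unital rings in which \<open>0 = 1\<close> is not excluded.
\<close>

definition unital_algebra :: "('k::field \<Rightarrow> 'a::{ring,monoid_mult} \<Rightarrow> 'a) \<Rightarrow> bool" where
  "unital_algebra s \<longleftrightarrow> vector_space s \<and>
     (\<forall>c x y. s c (x * y) = s c x * y \<and> s c (x * y) = x * s c y)"

text \<open>
  Addition is always the \<open>+\<close> of the element type. For a quotient, the elements are
  cosets and \<open>+\<close> is the elementwise sum of sets from \<open>Set_Algebras\<close>; on cosets of a subgroup
  \<open>N\<close> this is the addition of the quotient group, with zero element \<open>N\<close>.
\<close>

record ('a, 'm) bimod =
  carrier :: "'m set"
  lact :: "'a \<Rightarrow> 'm \<Rightarrow> 'm"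
  ract :: "'m \<Rightarrow> 'a \<Rightarrow> 'm"

record ('a, 'm) gbimod = "('a, 'm) bimod" +
  hcomp :: "int \<Rightarrow> 'm set"

definition bimod_hom ::
  "('a, 'm::plus, 'y) bimod_scheme \<Rightarrow> ('a, 'n::plus, 'z) bimod_scheme \<Rightarrow> ('m \<Rightarrow> 'n) \<Rightarrow> bool" where
  "bimod_hom M N f \<longleftrightarrow>
     (\<forall>x\<in>carrier M. f x \<in> carrier N) \<and>
     (\<forall>x\<in>carrier M. \<forall>y\<in>carrier M. f (x + y) = f x + f y) \<and>
     (\<forall>a. \<forall>x\<in>carrier M. f (lact M a x) = lact N a (f x) \<and> f (ract M x a) = ract N (f x) a)"

definition graded_hom ::
  "('a, 'm::plus) gbimod \<Rightarrow> ('a, 'n::plus) gbimod \<Rightarrow> int \<Rightarrow> ('m \<Rightarrow> 'n) \<Rightarrow> bool" where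
  "graded_hom M N l f \<longleftrightarrow> bimod_hom M N f \<and> (\<forall>i. \<forall>x\<in>hcomp M i. f x \<in> hcomp N (i + l))"

text \<open>
  Graded \<open>A\<close>-bimodules, i.e. \<open>A\<^sup>e\<close>-modules (the ground field acts in the same way from
  both sides) that are the direct sum of submodules \<open>hcomp C i\<close>. The underlying set is a whole type.
\<close>

definition bimodule ::
  "('k \<Rightarrow> 'a::{ring,monoid_mult} \<Rightarrow> 'a) \<Rightarrow> ('a, 'c::ab_group_add, 'z) bimod_scheme \<Rightarrow> bool" where
  "bimodule s C \<longleftrightarrow> carrier C = UNIV \<and>
     (\<forall>a x y. lact C a (x + y) = lact C a x + lact C a y) \<and>
     (\<forall>a b x. lact C (a + b) x = lact C a x + lact C b x) \<and>
     (\<forall>a b x. lact C (a * b) x = lact C a (lact C b x)) \<and>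
     (\<forall>x. lact C 1 x = x) \<and>
     (\<forall>a x y. ract C (x + y) a = ract C x a + ract C y a) \<and>
     (\<forall>a b x. ract C x (a + b) = ract C x a + ract C x b) \<and>
     (\<forall>a b x. ract C x (a * b) = ract C (ract C x a) b) \<and>
     (\<forall>x. ract C x 1 = x) \<and>
     (\<forall>a b x. ract C (lact C a x) b = lact C a (ract C x b)) \<and>
     (\<forall>c x. lact C (s c 1) x = ract C x (s c 1))"

definition graded_bimodule ::
  "('k \<Rightarrow> 'a::{ring,monoid_mult} \<Rightarrow> 'a) \<Rightarrow> ('a, 'c::ab_group_add) gbimod \<Rightarrow> bool" where
  "graded_bimodule s C \<longleftrightarrow> bimodule s C \<and>
     (\<forall>i. 0 \<in> hcomp C i \<and>
        (\<forall>x\<in>hcomp C i. \<forall>y\<in>hcomp C i. x - y \<in> hcomp C i) \<and>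
        (\<forall>a. \<forall>x\<in>hcomp C i. lact C a x \<in> hcomp C i \<and> ract C x a \<in> hcomp C i)) \<and>
     (\<forall>x. \<exists>!u. (\<forall>i. u i \<in> hcomp C i) \<and> finite {i. u i \<noteq> 0} \<and> x = (\<Sum>i | u i \<noteq> 0. u i))"

definition alg_bimod :: "('a::{ring,monoid_mult}, 'a) gbimod" where
  "alg_bimod = \<lparr>carrier = UNIV, lact = (*), ract = (*), hcomp = (\<lambda>i. if i = 0 then UNIV else {0})\<rparr>"


section \<open>Projective bimodules\<close>

text \<open>
  The free \<open>A\<^sup>e\<close>-module on a set \<open>B\<close>, namely the direct sum of copies of
  \<open>A \<otimes>\<^sub>k A\<close> indexed by \<open>B\<close>: it is the free abelian group on the symbols \<open>(a, b, a')\<close>,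
  standing for \<open>a \<otimes> a'\<close> in the copy with index \<open>b\<close>, modulo the relations of the tensor product.
\<close>

inductive_set free_rel ::
  "('k \<Rightarrow> 'a::{ring,monoid_mult} \<Rightarrow> 'a) \<Rightarrow> (('a \<times> 'b \<times> 'a) \<Rightarrow>\<^sub>0 int) set"
  for s :: "'k \<Rightarrow> 'a \<Rightarrow> 'a" where
  "frag_of (a + a', b, c) - frag_of (a, b, c) - frag_of (a', b, c) \<in> free_rel s"
| "frag_of (a, b, c + c') - frag_of (a, b, c) - frag_of (a, b, c') \<in> free_rel s"
| "frag_of (s k a, b, c) - frag_of (a, b, s k c) \<in> free_rel s"

definition free_bimod ::
  "('k \<Rightarrow> 'a::{ring,monoid_mult} \<Rightarrow> 'a) \<Rightarrow> 'b set \<Rightarrow> ('a, (('a \<times> 'b \<times> 'a) \<Rightarrow>\<^sub>0 int) set) bimod" where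
  "free_bimod s B =
    (let N = group_closure (free_rel s) in
     \<lparr>carrier = {u +o N | u. Poly_Mapping.keys u \<subseteq> UNIV \<times> B \<times> UNIV},
      lact = (\<lambda>x X. \<Union>u\<in>X. frag_extend (\<lambda>(a, b, c). frag_of (x * a, b, c)) u +o N),
      ract = (\<lambda>X x. \<Union>u\<in>X. frag_extend (\<lambda>(a, b, c). frag_of (a, b, c * x)) u +o N)\<rparr>)"

text \<open>
  Projective: a direct summand of a free \<open>A\<^sup>e\<close>-module. Indexing the basis by elements of the type
  of \<open>M\<close> is no restriction, since \<open>M\<close> is a quotient of the free module on its own carrier.
\<close>

definition projective_bimod ::
  "('k \<Rightarrow> 'a::{ring,monoid_mult} \<Rightarrow> 'a) \<Rightarrow> ('a, 'm::plus, 'z) bimod_scheme \<Rightarrow> bool" where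
  "projective_bimod s M \<longleftrightarrow>
     (\<exists>(B :: 'm set) i q. bimod_hom M (free_bimod s B) i \<and> bimod_hom (free_bimod s B) M q \<and>
        (\<forall>x\<in>carrier M. q (i x) = x))"


section \<open>Tensor powers over \<open>A\<close>\<close>

text \<open>
  The symbol \<open>(a, [x\<^sub>1, \<dots>, x\<^sub>n])\<close> stands for \<open>a x\<^sub>1 \<otimes> \<dots> \<otimes> x\<^sub>n\<close>; so the \<open>n\<close>-th tensor power
  appears as \<open>A \<otimes>\<^sub>A C \<otimes>\<^sub>A \<dots> \<otimes>\<^sub>A C\<close>, which makes the power with \<open>n = 0\<close> equal to \<open>A\<close>.
  All powers are quotients by the same subgroup \<open>tens_null C\<close>, which is thus the zero element of each;
  its defining relations are homogeneous with respect to the length of the list.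
\<close>

inductive_set tens_rel ::
  "('a::{ring,monoid_mult}, 'c::ab_group_add) gbimod \<Rightarrow> (('a \<times> 'c list) \<Rightarrow>\<^sub>0 int) set"
  for C :: "('a, 'c) gbimod" where
  "frag_of (a + b, xs) - frag_of (a, xs) - frag_of (b, xs) \<in> tens_rel C"
| "frag_of (a, xs @ (x + y) # ys) - frag_of (a, xs @ x # ys) - frag_of (a, xs @ y # ys) \<in> tens_rel C"
| "frag_of (a * b, x # xs) - frag_of (a, lact C b x # xs) \<in> tens_rel C"
| "frag_of (a, xs @ ract C x b # y # ys) - frag_of (a, xs @ x # lact C b y # ys) \<in> tens_rel C"

definition tens_null ::
  "('a::{ring,monoid_mult}, 'c::ab_group_add) gbimod \<Rightarrow> (('a \<times> 'c list) \<Rightarrow>\<^sub>0 int) set" where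
  "tens_null C = group_closure (tens_rel C)"

type_synonym ('a, 'c) tens = "(('a \<times> 'c list) \<Rightarrow>\<^sub>0 int) set"

definition pure ::
  "('a::{ring,monoid_mult}, 'c::ab_group_add) gbimod \<Rightarrow> 'a \<Rightarrow> 'c list \<Rightarrow> ('a, 'c) tens" where
  "pure C a xs = frag_of (a, xs) +o tens_null C"

text \<open>The identifications of \<open>A\<close> and \<open>C\<close> with the tensor powers for \<open>n = 0\<close> and \<open>n = 1\<close>.\<close>

definition emb0 ::
  "('a::{ring,monoid_mult}, 'c::ab_group_add) gbimod \<Rightarrow> 'a \<Rightarrow> ('a, 'c) tens" where
  "emb0 C a = pure C a []"

definition emb1 ::
  "('a::{ring,monoid_mult}, 'c::ab_group_add) gbimod \<Rightarrow> 'c \<Rightarrow> ('a, 'c) tens" where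
  "emb1 C x = pure C 1 [x]"

fun word_mult ::
  "('a::{ring,monoid_mult}, 'c::ab_group_add) gbimod \<Rightarrow> 'a \<times> 'c list \<Rightarrow> 'a \<times> 'c list \<Rightarrow> 'a \<times> 'c list" where
  "word_mult C (a, xs) (b, ys) =
     (if xs = [] then (a * b, ys) else (a, butlast xs @ ract C (last xs) b # ys))"

text \<open>
  The product \<open>x \<otimes>\<^sub>A y\<close> of elements of the tensor powers with exponents \<open>m\<close> and \<open>n\<close>, in the
  one with exponent \<open>m + n\<close>; with a factor from \<open>A\<close> it is the bimodule action.
\<close>

definition tens_mult ::
  "('a::{ring,monoid_mult}, 'c::ab_group_add) gbimod \<Rightarrow> ('a, 'c) tens \<Rightarrow> ('a, 'c) tens \<Rightarrow> ('a, 'c) tens" where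
  "tens_mult C X Y =
     (\<Union>u\<in>X. \<Union>v\<in>Y.
        frag_extend (\<lambda>w. frag_extend (\<lambda>w'. frag_of (word_mult C w w')) v) u +o tens_null C)"

definition tens_power ::
  "('a::{ring,monoid_mult}, 'c::ab_group_add) gbimod \<Rightarrow> nat \<Rightarrow> ('a, ('a, 'c) tens) gbimod" where
  "tens_power C n =
    \<lparr>carrier = {u +o tens_null C | u. \<forall>(a, xs)\<in>Poly_Mapping.keys u. length xs = n},
     lact = (\<lambda>a X. tens_mult C (emb0 C a) X),
     ract = (\<lambda>X a. tens_mult C X (emb0 C a)),
     hcomp = (\<lambda>i. {u +o tens_null C | u. \<forall>(a, xs)\<in>Poly_Mapping.keys u. length xs = n \<and>
        (\<exists>ds. list_all2 (\<lambda>x d. x \<in> hcomp C d) xs ds \<and> sum_list ds = i)})\<rparr>"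

definition sgn_tens :: "int \<Rightarrow> ('a, 'c) tens \<Rightarrow> ('a, 'c) tens" where
  "sgn_tens l X = (if even l then X else uminus ` X)"

text \<open>
  \<open>tens_map C m n q f g\<close> is \<open>f \<otimes>\<^sub>A g\<close> on the tensor power with exponent \<open>m + n\<close>, where
  \<open>f\<close> and \<open>g\<close> are bimodule maps on the powers with exponents \<open>m\<close> and \<open>n\<close>, and \<open>g\<close> has degree \<open>q\<close>.
  It is the additive map determined by the Koszul sign rule; choice only affects
  its values outside the carrier.
\<close>

definition tens_map ::
  "('a::{ring,monoid_mult}, 'c::ab_group_add) gbimod \<Rightarrow> nat \<Rightarrow> nat \<Rightarrow> int \<Rightarrow>
   (('a, 'c) tens \<Rightarrow> ('a, 'c) tens) \<Rightarrow> (('a, 'c) tens \<Rightarrow> ('a, 'c) tens) \<Rightarrow>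
   ('a, 'c) tens \<Rightarrow> ('a, 'c) tens" where
  "tens_map C m n q f g = (SOME h.
     (\<forall>X\<in>carrier (tens_power C (m + n)). \<forall>Y\<in>carrier (tens_power C (m + n)). h (X + Y) = h X + h Y) \<and>
     (\<forall>i. \<forall>x\<in>hcomp (tens_power C m) i. \<forall>y\<in>carrier (tens_power C n).
        h (tens_mult C x y) = sgn_tens (q * i) (tens_mult C (f x) (g y))))"

text \<open>The map \<open>1 \<otimes> g \<otimes> 1\<close> with \<open>r\<close> identity factors on the left and \<open>t\<close> on the right, for \<open>g\<close> of degree
  \<open>q\<close> defined on \<open>C\<close>.\<close>

definition insert_map ::
  "('a::{ring,monoid_mult}, 'c::ab_group_add) gbimod \<Rightarrow> nat \<Rightarrow> nat \<Rightarrow> int \<Rightarrow>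
   ('c \<Rightarrow> ('a, 'c) tens) \<Rightarrow> ('a, 'c) tens \<Rightarrow> ('a, 'c) tens" where
  "insert_map C r t q g =
     tens_map C r (1 + t) q id (tens_map C 1 t 0 (g \<circ> inv (emb1 C)) id)"

text \<open>The \<open>n\<close>-fold tensor power of a map \<open>\<mu>\<close> of degree \<open>q\<close> from \<open>C\<close> to \<open>A\<close>.\<close>

primrec map_power ::
  "('a::{ring,monoid_mult}, 'c::ab_group_add) gbimod \<Rightarrow> int \<Rightarrow> ('c \<Rightarrow> 'a) \<Rightarrow> nat \<Rightarrow>
   ('a, 'c) tens \<Rightarrow> ('a, 'c) tens" where
  "map_power C q \<mu> 0 = id"
| "map_power C q \<mu> (Suc n) =
     tens_map C 1 n (int n * q) (emb0 C \<circ> \<mu> \<circ> inv (emb1 C)) (map_power C q \<mu> n)"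


section \<open>\<open>A\<^sub>\<infinity>\<close>-coalgebras and coderivations\<close>

definition ainf_coalgebra ::
  "('k \<Rightarrow> 'a::{ring,monoid_mult} \<Rightarrow> 'a) \<Rightarrow> ('a, 'c::ab_group_add) gbimod \<Rightarrow>
   (nat \<Rightarrow> 'c \<Rightarrow> ('a, 'c) tens) \<Rightarrow> bool" where
  "ainf_coalgebra s C \<delta> \<longleftrightarrow> graded_bimodule s C \<and>
     (\<forall>x. \<delta> 0 x = tens_null C) \<and>
     (\<forall>n\<ge>1. graded_hom C (tens_power C n) 1 (\<delta> n)) \<and>
     (\<forall>N x. (\<Sum>(r, s, t) \<in> {(r, s, t). r + s + t = N}.
        insert_map C r t 1 (\<delta> s) (\<delta> (N - s + 1) x)) = tens_null C)"

definition weakly_counital ::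
  "('a::{ring,monoid_mult}, 'c::ab_group_add) gbimod \<Rightarrow>
   (nat \<Rightarrow> 'c \<Rightarrow> ('a, 'c) tens) \<Rightarrow> ('c \<Rightarrow> 'a) \<Rightarrow> bool" where
  "weakly_counital C \<delta> \<mu> \<longleftrightarrow> graded_hom C alg_bimod (-1) \<mu> \<and>
     (\<forall>x. map_power C (-1) \<mu> 2 (\<delta> 2 x) = emb0 C (\<mu> x)) \<and>
     (\<forall>n>2. \<forall>x. map_power C (-1) \<mu> n (\<delta> n x) = tens_null C)"

definition ainf_coderivation ::
  "('a::{ring,monoid_mult}, 'c::ab_group_add) gbimod \<Rightarrow> (nat \<Rightarrow> 'c \<Rightarrow> ('a, 'c) tens) \<Rightarrow>
   int \<Rightarrow> (nat \<Rightarrow> 'c \<Rightarrow> ('a, 'c) tens) \<Rightarrow> bool" where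
  "ainf_coderivation C \<delta> l \<alpha> \<longleftrightarrow>
     (\<forall>n. graded_hom C (tens_power C n) l (\<alpha> n)) \<and>
     (\<forall>N x. (\<Sum>(r, s, t) \<in> {(r, s, t). r + s + t = N}.
               insert_map C r t 1 (\<delta> s) (\<alpha> (N - s + 1) x)) =
            sgn_tens l (\<Sum>(r, s, t) \<in> {(r, s, t). r + s + t = N}.
               insert_map C r t l (\<alpha> s) (\<delta> (N - s + 1) x)))"


section \<open>Resolutions\<close>

definition projective_resolution ::
  "('k \<Rightarrow> 'a::{ring,monoid_mult} \<Rightarrow> 'a) \<Rightarrow> ('a, 'c::ab_group_add) gbimod \<Rightarrow>
   ('c \<Rightarrow> 'c) \<Rightarrow> ('c \<Rightarrow> 'a) \<Rightarrow> bool" where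
  "projective_resolution s Q d \<epsilon> \<longleftrightarrow> graded_bimodule s Q \<and>
     (\<forall>i. projective_bimod s (Q\<lparr>carrier := hcomp Q i\<rparr>)) \<and>
     (\<forall>i>0. hcomp Q i = {0}) \<and>
     graded_hom Q Q 1 d \<and> (\<forall>x. d (d x) = 0) \<and>
     graded_hom Q alg_bimod 0 \<epsilon> \<and> (\<forall>x. \<epsilon> (d x) = 0) \<and>
     (\<forall>i<0. \<forall>x\<in>hcomp Q i. d x = 0 \<longrightarrow> x \<in> d ` hcomp Q (i - 1)) \<and>
     (\<forall>x\<in>hcomp Q 0. \<epsilon> x = 0 \<longrightarrow> x \<in> d ` hcomp Q (-1)) \<and>
     \<epsilon> ` hcomp Q 0 = UNIV"

text \<open>\<open>P\<close> with components \<open>P\<^sub>i = P'\<^sub>i\<^sub>-\<^sub>1\<close> for a projective resolution \<open>P'\<close>.\<close>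

definition shifted_resolution ::
  "('k \<Rightarrow> 'a::{ring,monoid_mult} \<Rightarrow> 'a) \<Rightarrow> ('a, 'c::ab_group_add) gbimod \<Rightarrow>
   ('c \<Rightarrow> 'c) \<Rightarrow> ('c \<Rightarrow> 'a) \<Rightarrow> bool" where
  "shifted_resolution s P d \<mu> \<longleftrightarrow>
     projective_resolution s (P\<lparr>hcomp := (\<lambda>i. hcomp P (i + 1))\<rparr>) d \<mu>"

end

theory Submission
  imports Defs
begin

text \<open>
  Families \<open>\<alpha>\<close> of maps \<open>P \<rightarrow> P\<^sup>\<otimes>\<^sup>n\<close> are derivations of the completed tensor algebra of \<open>P\<close> over \<open>A\<close>, on
  which the commutator with \<open>\<delta>\<close> is a differential; coderivations are its cocycles. Filter by the
  tensor exponent. Since \<open>P\<close> has a right linear contraction onto \<open>A\<close>, the map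
  \<open>\<mu>\<^sup>\<otimes>\<^sup>n : P\<^sup>\<otimes>\<^sup>n \<rightarrow> A\<close> is a quasi-isomorphism for \<open>n \<ge> 1\<close>, so by projectivity column \<open>n\<close> has the cohomology of
  \<open>Hom(P, A)\<close>. The weak counit makes the next differential from column \<open>n\<close> to column \<open>n + 1\<close> zero for even
  \<open>n\<close> and the identity for odd \<open>n\<close>: the columns \<open>n \<ge> 1\<close> cancel in pairs. Concretely, when the
  components below an odd \<open>n\<close> are given, the obstruction to the component \<open>n\<close> vanishes, because its image in
  column \<open>n + 1\<close> is a coboundary; the obstruction to the component \<open>n + 1\<close> is then removed by adding a
  chain map to the component \<open>n\<close>.
\<close>

text \<open>Why the differential from column n to column n + 1 depends on the parity of n: apply
  \<mu> to every factor of the commutator of \<gamma> with \<open>\<delta>\<^sub>2\<close>. There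
  are n inner terms, with \<open>\<delta>\<^sub>2\<close> inserted at a factor of \<gamma>, and two
  outer terms, with \<gamma> applied at a factor of \<open>\<delta>\<^sub>2\<close>. Up to a
  coboundary each is the image of \<gamma> with a sign, and the signs alternate from left to right;
  the n + 2 terms cancel for even n and leave one for odd n. The inner terms follow from the counit
  equation itself. The outer ones need that \<open>\<delta>\<^sub>2\<close> with one side contracted
  by \<mu> is homotopic to the identity up to signs, which holds by uniqueness of lifts along the
  resolution. The columns pair up as (1, 2), (3, 4), and so on. Hence an odd component cannot be
  frozen before the obstruction to its successor is known, and the construction advances by two
  exponents at a time. The ground field is used twice: to realise the quotients inside a vector
  space, and to split surjections linearly, which makes projective bimodules projective as right
  modules and so yields the right linear contraction.\<close>

section \<open>Additive maps out of free abelian groups\<close>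

definition zmul :: "int \<Rightarrow> 'g::ab_group_add \<Rightarrow> 'g" where
  "zmul k x = (\<Sum>i<nat k. x) - (\<Sum>i<nat (- k). x)"

lemma zmul_0 [simp]: "zmul 0 x = 0" by (simp add: zmul_def)
lemma zmul_1 [simp]: "zmul 1 x = x" by (simp add: zmul_def)

lemma zmul_Suc: "zmul (k + 1) x = zmul k x + x"
proof (cases "k \<ge> 0")
  case True
  then have "nat (k + 1) = Suc (nat k)" by simp
  with True show ?thesis by (simp add: zmul_def add.commute)
next
  case False
  then have "nat (- k) = Suc (nat (- (k + 1)))" by simp
  with False show ?thesis by (simp add: zmul_def)
qed

lemma zmul_add: "zmul (k + l) x = zmul k x + zmul l x"
proof (induction l rule: int_induct [where k = 0])
  case (step1 i)
  have "zmul (k + (i + 1)) x = zmul (k + i) x + x"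
    by (metis zmul_Suc add.assoc)
  with step1 show ?case by (simp add: zmul_Suc add.assoc)
next
  case (step2 i)
  have "zmul (k + i) x = zmul (k + (i - 1)) x + x" "zmul i x = zmul (i - 1) x + x"
    by (metis zmul_Suc add.assoc diff_add_cancel) (metis zmul_Suc diff_add_cancel)
  with step2 show ?case by (simp add: algebra_simps)
qed simp

text \<open>The universal property of the free abelian group, with an arbitrary abelian group as
  target; \<open>frag_extend\<close> covers the free targets.\<close>

definition frag_sum :: "('w \<Rightarrow> 'g::ab_group_add) \<Rightarrow> ('w \<Rightarrow>\<^sub>0 int) \<Rightarrow> 'g" where
  "frag_sum F u = (\<Sum>w\<in>Poly_Mapping.keys u. zmul (Poly_Mapping.lookup u w) (F w))"

lemma frag_sum_superset:
  assumes "finite K" "Poly_Mapping.keys u \<subseteq> K"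
  shows "frag_sum F u = (\<Sum>w\<in>K. zmul (Poly_Mapping.lookup u w) (F w))"
  unfolding frag_sum_def
  by (rule sum.mono_neutral_left) (use assms in \<open>auto simp: in_keys_iff\<close>)

interpretation frag_sum: additive "frag_sum F" for F :: "'w \<Rightarrow> 'g::ab_group_add"
proof
  fix u v :: "'w \<Rightarrow>\<^sub>0 int"
  let ?K = "Poly_Mapping.keys u \<union> Poly_Mapping.keys v"
  have "frag_sum F (u + v) = (\<Sum>w\<in>?K. zmul (Poly_Mapping.lookup (u + v) w) (F w))"
    by (rule frag_sum_superset) (auto dest: Poly_Mapping.keys_add [THEN subsetD])
  then show "frag_sum F (u + v) = frag_sum F u + frag_sum F v"
    by (simp add: lookup_add zmul_add sum.distrib frag_sum_superset [of ?K])
qed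

lemma frag_sum_of [simp]: "frag_sum F (frag_of w) = F w"
  by (simp add: frag_sum_def)

lemma frag_sum_unique:
  assumes "additive f" "\<And>w. w \<in> Poly_Mapping.keys u \<Longrightarrow> f (frag_of w) = F w"
  shows "f u = frag_sum F u"
proof -
  interpret additive f by fact
  have "Poly_Mapping.keys u \<subseteq> Poly_Mapping.keys u" by simp
  then show ?thesis
    by (induction u rule: frag_induction)
       (auto simp: assms(2) zero frag_sum.zero diff frag_sum.diff)
qed

lemma additiveI: "(\<And>x y. f (x + y) = f x + f y) \<Longrightarrow> additive f"
  by (rule additive.intro)

lemma group_closure_additive:
  assumes "additive f" "\<And>r. r \<in> S \<Longrightarrow> f r \<in> group_closure S'" "u \<in> group_closure S"
  shows "f u \<in> group_closure S'"
  using assms(3)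
proof induction
  case (base s)
  then show ?case using assms(2) additive.zero [OF assms(1)] by auto
next
  case (diff s t)
  then show ?case using additive.diff [OF assms(1)] group_closure.diff by metis
qed

lemma group_closure_additive_zero:
  assumes "additive f" "\<And>r. r \<in> S \<Longrightarrow> f r = 0" "u \<in> group_closure S"
  shows "f u = 0"
  using group_closure_additive [of f S "{}" u] assms by simp

lemma additive_frag_extend: "additive (frag_extend f)"
  by (rule additiveI) (rule frag_extend_add)

subsection \<open>Tensor powers inside a vector space\<close>

text \<open>
  Sets of cosets carry no group type class, so the quotient by \<open>tens_null P\<close> is moved into a type with
  genuine addition: since the ground ring is a field, a linear projection embeds it into the vector
  space on the words, by \<open>vec\<close>; \<open>lower\<close> picks representatives.
\<close>

type_synonym ('k, 'a, 'p) tv = "('a \<times> 'p list) \<Rightarrow>\<^sub>0 'k"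

locale tensor_powers =
  fixes s :: "'k::field \<Rightarrow> 'a::{ring,monoid_mult} \<Rightarrow> 'a"
    and P :: "('a, 'p::ab_group_add) gbimod"
  assumes algebra: "unital_algebra s" and graded: "graded_bimodule s P"
begin

lemma bimod: "bimodule s P" using graded by (simp add: graded_bimodule_def)

lemma s_add: "s c (x + y) = s c x + s c y" "s (c + e) x = s c x + s e x"
  and s_one: "s 1 x = x" and s_mult: "s (c * e) x = s c (s e x)"
  and s_left: "s c (x * y) = s c x * y" and s_right: "s c (x * y) = x * s c y"
proof -
  have "vector_space s" and m: "s c (x * y) = s c x * y \<and> s c (x * y) = x * s c y" for c x y
    using algebra unfolding unital_algebra_def by blast+
  interpret vector_space s by fact
  show "s c (x + y) = s c x + s c y" "s (c + e) x = s c x + s e x" "s 1 x = x"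
    "s (c * e) x = s c (s e x)" by (simp_all add: scale_right_distrib scale_left_distrib)
  show "s c (x * y) = s c x * y" "s c (x * y) = x * s c y" using m by blast+
qed

abbreviation la where "la \<equiv> lact P"
abbreviation ra where "ra \<equiv> ract P"

lemma carrier_P [simp]: "carrier P = UNIV"
  using bimod by (simp add: bimodule_def)

lemma act:
  "la a (x + y) = la a x + la a y" "la (a + b) x = la a x + la b x"
  "la (a * b) x = la a (la b x)" "la 1 x = x"
  "ra (x + y) a = ra x a + ra y a" "ra x (a + b) = ra x a + ra x b"
  "ra x (a * b) = ra (ra x a) b" "ra x 1 = x"
  "ra (la a x) b = la a (ra x b)"
proof -
  note * = bimod [unfolded bimodule_def]
  show "la a (x + y) = la a x + la a y" using * by simp
  show "la (a + b) x = la a x + la b x" using * by simp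
  show "la (a * b) x = la a (la b x)" using * by simp
  show "la 1 x = x" using * by simp
  show "ra (x + y) a = ra x a + ra y a" using * by simp
  show "ra x (a + b) = ra x a + ra x b" using * by simp
  show "ra x (a * b) = ra (ra x a) b" using * by simp
  show "ra x 1 = x" using * by simp
  show "ra (la a x) b = la a (ra x b)" using * by simp
qed

lemma central: "la (s c 1) x = ra x (s c 1)"
  using bimod unfolding bimodule_def by blast

abbreviation NN where "NN \<equiv> tens_null P"

definition cong (infix "\<approx>" 50) where "u \<approx> v \<longleftrightarrow> u - v \<in> NN"

lemma NN_0: "0 \<in> NN" and NN_add: "u \<in> NN \<Longrightarrow> v \<in> NN \<Longrightarrow> u + v \<in> NN"
  and NN_diff: "u \<in> NN \<Longrightarrow> v \<in> NN \<Longrightarrow> u - v \<in> NN" and NN_minus: "- u \<in> NN \<longleftrightarrow> u \<in> NN"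
  and NN_rel: "u \<in> tens_rel P \<Longrightarrow> u \<in> NN"
  by (auto simp: tens_null_def intro: group_closure_add group_closure.diff group_closure.base)

lemma cong_refl: "u \<approx> u" by (simp add: cong_def NN_0)
lemma cong_sym: "u \<approx> v \<Longrightarrow> v \<approx> u"
  unfolding cong_def using NN_minus [of "u - v"] by simp
lemma cong_trans [trans]: "u \<approx> v \<Longrightarrow> v \<approx> w \<Longrightarrow> u \<approx> w"
  unfolding cong_def using NN_add [of "u - v" "v - w"] by simp
lemma cong_add: "u \<approx> v \<Longrightarrow> u' \<approx> v' \<Longrightarrow> u + u' \<approx> v + v'"
  unfolding cong_def using NN_add [of "u - v" "u' - v'"] by (simp add: algebra_simps)
lemma cong_diff: "u \<approx> v \<Longrightarrow> u' \<approx> v' \<Longrightarrow> u - u' \<approx> v - v'"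
  unfolding cong_def using NN_diff [of "u - v" "u' - v'"] by (simp add: algebra_simps)
lemma cong_0: "u \<approx> 0 \<longleftrightarrow> u \<in> NN" by (simp add: cong_def)
lemma cong_sum: "(\<And>i. i \<in> I \<Longrightarrow> f i \<approx> g i) \<Longrightarrow> sum f I \<approx> sum g I"
  by (induction I rule: infinite_finite_induct) (auto intro: cong_add cong_refl)

lemma frag_add_cong: "frag_of (a + b, xs) \<approx> frag_of (a, xs) + frag_of (b, xs)"
  unfolding cong_def using NN_rel [OF tens_rel.intros(1)] by (simp add: diff_diff_eq)

lemma frag_0_cong: "frag_of (0, xs) \<approx> 0"
  using frag_add_cong [of 0 0 xs] by (simp add: cong_def NN_minus)

text \<open>One clause for each relation in \<open>tens_rel\<close>: these are the functions on
  words that factor through the tensor powers (\<open>balanced_null\<close>).\<close>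

definition balanced :: "('a \<Rightarrow> 'p list \<Rightarrow> 'g::ab_group_add) \<Rightarrow> bool" where
  "balanced F \<longleftrightarrow>
     (\<forall>a b xs. F (a + b) xs = F a xs + F b xs) \<and>
     (\<forall>a xs x y ys. F a (xs @ (x + y) # ys) = F a (xs @ x # ys) + F a (xs @ y # ys)) \<and>
     (\<forall>a b x xs. F (a * b) (x # xs) = F a (la b x # xs)) \<and>
     (\<forall>a xs x b y ys. F a (xs @ ra x b # y # ys) = F a (xs @ x # la b y # ys))"

lemma balanced_null:
  assumes "balanced F" "u \<in> NN" shows "frag_sum (case_prod F) u = 0"
proof (rule group_closure_additive_zero [OF frag_sum.additive_axioms])
  show "u \<in> group_closure (tens_rel P)" using assms by (simp add: tens_null_def)
  show "frag_sum (case_prod F) r = 0" if "r \<in> tens_rel P" for r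
    using that assms(1) unfolding balanced_def
    by (cases rule: tens_rel.cases) (simp_all add: frag_sum.diff)
qed

definition scaleV :: "'k \<Rightarrow> ('k, 'a, 'p) tv \<Rightarrow> ('k, 'a, 'p) tv" where
  "scaleV c v = Poly_Mapping.map ((*) c) v"

lemma lookup_scaleV [simp]: "Poly_Mapping.lookup (scaleV c v) w = c * Poly_Mapping.lookup v w"
  by (simp add: scaleV_def Poly_Mapping.map.rep_eq when_def)

sublocale V: vector_space scaleV
  by standard (auto intro!: poly_mapping_eqI simp: lookup_add algebra_simps)

sublocale VV: vector_space_pair scaleV scaleV ..

text \<open>A coefficient from the field is absorbed by the leading factor in \<open>A\<close>, so
  that a vector yields an integral combination of words.\<close>

definition lower :: "('k, 'a, 'p) tv \<Rightarrow> ('a \<times> 'p list) \<Rightarrow>\<^sub>0 int" where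
  "lower v = (\<Sum>w\<in>Poly_Mapping.keys v. frag_of (s (Poly_Mapping.lookup v w) (fst w), snd w))"

text \<open>Only a congruence: a word with coefficient 0 contributes the symbol with head 0, which
  is null but is not the zero formal sum.\<close>

lemma lower_superset:
  assumes "finite K" "Poly_Mapping.keys v \<subseteq> K"
  shows "lower v \<approx> (\<Sum>w\<in>K. frag_of (s (Poly_Mapping.lookup v w) (fst w), snd w))"
proof -
  have z: "s 0 a = 0" for a using s_add(2) [of 0 0 a] by simp
  have "(\<Sum>w\<in>K. frag_of (s (Poly_Mapping.lookup v w) (fst w), snd w)) =
     lower v + (\<Sum>w\<in>K - Poly_Mapping.keys v. frag_of (s (Poly_Mapping.lookup v w) (fst w), snd w))"
    unfolding lower_def sum.subset_diff [OF assms(2,1)] by (rule add.commute)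
  also have "\<dots> \<approx> lower v + (\<Sum>w\<in>K - Poly_Mapping.keys v. 0)"
    by (intro cong_add cong_refl cong_sum) (auto simp: in_keys_iff z frag_0_cong)
  finally show ?thesis using cong_sym by simp
qed

lemma lower_add: "lower (u + v) \<approx> lower u + lower v"
proof -
  let ?K = "Poly_Mapping.keys u \<union> Poly_Mapping.keys v"
  let ?g = "\<lambda>v w. frag_of (s (Poly_Mapping.lookup v w) (fst w), snd w)"
  have "lower (u + v) \<approx> sum (?g (u + v)) ?K"
    by (rule lower_superset) (auto dest: Poly_Mapping.keys_add [THEN subsetD])
  also have "\<dots> \<approx> (\<Sum>w\<in>?K. ?g u w + ?g v w)"
    by (rule cong_sum) (simp add: lookup_add s_add(2) frag_add_cong)
  also have "\<dots> = sum (?g u) ?K + sum (?g v) ?K" by (rule sum.distrib)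
  also have "\<dots> \<approx> lower u + lower v"
    by (intro cong_add; rule cong_sym, rule lower_superset) auto
  finally show ?thesis .
qed

lemma lower_0: "lower 0 = 0" by (simp add: lower_def)

lemma lower_diff: "lower (u - v) \<approx> lower u - lower v"
  using lower_add [of "u - v" v] unfolding cong_def
  by (metis (no_types, opaque_lifting) NN_minus add.commute diff_add_cancel diff_diff_eq minus_diff_eq)

lemma lower_scale: "lower (scaleV c v) \<approx> frag_extend (\<lambda>(a, xs). frag_of (s c a, xs)) (lower v)"
proof -
  let ?K = "Poly_Mapping.keys v"
  have "lower (scaleV c v) \<approx> (\<Sum>w\<in>?K. frag_of (s (c * Poly_Mapping.lookup v w) (fst w), snd w))"
    using lower_superset [of ?K "scaleV c v"] by (simp add: in_keys_iff subset_iff)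
  then show ?thesis
    by (simp add: lower_def frag_extend_sum s_mult)
qed

lemma scale_null:
  assumes "u \<in> NN" shows "frag_extend (\<lambda>(a, xs). frag_of (s c a, xs)) u \<in> NN"
  using assms unfolding tens_null_def
proof (rule group_closure_additive [OF additive_frag_extend, rotated])
  fix r assume "r \<in> tens_rel P"
  then show "frag_extend (\<lambda>(a, xs). frag_of (s c a, xs)) r \<in> group_closure (tens_rel P)"
    by (cases rule: tens_rel.cases)
       (auto simp: frag_extend_diff s_add s_left intro!: group_closure.base tens_rel.intros)
qed

text \<open>The vectors that represent zero. By \<open>lower_lift0\<close> every class is
  represented, so the vector space modulo \<open>SS\<close> is the sum of all tensor powers.\<close>

definition SS where "SS = {v. lower v \<in> NN}"

lemma subspace_SS: "V.subspace SS"
proof (rule V.subspaceI)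
  show "0 \<in> SS" by (simp add: SS_def lower_0 NN_0)
  show "u + v \<in> SS" if "u \<in> SS" "v \<in> SS" for u v
    using cong_trans [OF lower_add [of u v], of 0] that NN_add by (simp add: SS_def cong_0)
  show "scaleV c v \<in> SS" if "v \<in> SS" for c v
    using cong_trans [OF lower_scale [of c v], of 0] that scale_null by (simp add: SS_def cong_0)
qed

definition lift0 :: "(('a \<times> 'p list) \<Rightarrow>\<^sub>0 int) \<Rightarrow> ('k, 'a, 'p) tv" where
  "lift0 = frag_sum (\<lambda>w. Poly_Mapping.single w 1)"

lemma lower_lift0: "lower (lift0 u) \<approx> u"
proof -
  have "Poly_Mapping.keys u \<subseteq> UNIV" by simp
  then show ?thesis
  proof (induction u rule: frag_induction)
    case zero
    show ?case by (simp add: lift0_def frag_sum.zero lower_0 cong_refl)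
  next
    case (one w)
    show ?case by (simp add: lift0_def lower_def s_one cong_refl)
  next
    case (diff a b)
    have "lower (lift0 (a - b)) \<approx> lower (lift0 a) - lower (lift0 b)"
      using lower_diff by (simp add: lift0_def frag_sum.diff)
    also have "\<dots> \<approx> a - b" by (rule cong_diff) fact+
    finally show ?case .
  qed
qed

definition proj where
  "proj = (SOME p. (\<forall>v. p v \<in> SS) \<and> additive p \<and> (\<forall>v\<in>SS. p v = v))"

lemma proj: "proj v \<in> SS" "additive proj" "v \<in> SS \<Longrightarrow> proj v = v"
proof -
  obtain g where "g ` UNIV \<subseteq> SS" and g: "Vector_Spaces.linear scaleV scaleV g" and "\<forall>v\<in>SS. g (id v) = v"
    using VV.linear_exists_left_inverse_on [OF V.linear_id subspace_SS] by auto
  then have "(\<forall>v. g v \<in> SS) \<and> additive g \<and> (\<forall>v\<in>SS. g v = v)"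
    using VV.linear_add [OF g] by (auto intro: additiveI)
  then have "\<exists>p. (\<forall>v. p v \<in> SS) \<and> additive p \<and> (\<forall>v\<in>SS. p v = v)" by blast
  from someI_ex [OF this] show "proj v \<in> SS" "additive proj" "v \<in> SS \<Longrightarrow> proj v = v"
    unfolding proj_def by blast+
qed

text \<open>Subtracting the part in \<open>SS\<close> selects one vector per class, in a complement
  of \<open>SS\<close>; thus congruence becomes equality (\<open>vec_eq_iff\<close>).\<close>

definition vec :: "(('a \<times> 'p list) \<Rightarrow>\<^sub>0 int) \<Rightarrow> ('k, 'a, 'p) tv" where
  "vec u = lift0 u - proj (lift0 u)"

sublocale vec: additive vec
  by standard (simp add: vec_def lift0_def frag_sum.add additive.add [OF proj(2)])

lemma lower_vec: "lower (vec u) \<approx> u"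
proof -
  have "lower (vec u) \<approx> lower (lift0 u) - lower (proj (lift0 u))"
    unfolding vec_def by (rule lower_diff)
  also have "\<dots> \<approx> u - 0"
    using proj(1) [of "lift0 u"] by (intro cong_diff lower_lift0) (simp add: cong_0 SS_def)
  finally show ?thesis by simp
qed

lemma vec_eq_0_iff: "vec u = 0 \<longleftrightarrow> u \<in> NN"
proof
  assume "vec u = 0"
  then have "0 \<approx> u" using lower_vec [of u] by (simp add: lower_0)
  then show "u \<in> NN" using cong_sym cong_0 by blast
next
  assume "u \<in> NN"
  then have "lower (lift0 u) \<approx> 0" using lower_lift0 cong_trans cong_0 by blast
  then have "lift0 u \<in> SS" by (simp add: cong_0 SS_def)
  then show "vec u = 0" by (simp add: vec_def proj(3))
qed

lemma vec_eq_iff: "vec u = vec v \<longleftrightarrow> u \<approx> v"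
  unfolding cong_def using vec_eq_0_iff [of "u - v"] by (simp add: vec.diff)

text \<open>The map induced on the quotient. Going through \<open>lower\<close> makes it total on
  vectors; it respects congruence when \<open>F\<close> is balanced.\<close>

definition ext :: "('a \<Rightarrow> 'p list \<Rightarrow> 'g::ab_group_add) \<Rightarrow> ('k, 'a, 'p) tv \<Rightarrow> 'g" where
  "ext F v = frag_sum (case_prod F) (lower v)"

definition wd :: "'a \<Rightarrow> 'p list \<Rightarrow> ('k, 'a, 'p) tv" where
  "wd a xs = vec (frag_of (a, xs))"

lemma ext_cong: "balanced F \<Longrightarrow> u \<approx> v \<Longrightarrow> frag_sum (case_prod F) u = frag_sum (case_prod F) v"
  using balanced_null [of F "u - v"] by (simp add: cong_def frag_sum.diff)

lemma ext_vec: "balanced F \<Longrightarrow> ext F (vec u) = frag_sum (case_prod F) u"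
  unfolding ext_def by (erule ext_cong) (rule lower_vec)

lemma ext_wd: "balanced F \<Longrightarrow> ext F (wd a xs) = F a xs"
  by (simp add: wd_def ext_vec)

lemma additive_ext: "balanced F \<Longrightarrow> additive (ext F)"
  using ext_cong [OF _ lower_add] by (auto simp: ext_def frag_sum.add intro!: additiveI)

lemma balanced_wd: "balanced wd"
proof -
  have "frag_of (a, xs @ (x + y) # ys) \<approx> frag_of (a, xs @ x # ys) + frag_of (a, xs @ y # ys)" for a xs x y ys
    unfolding cong_def using NN_rel [OF tens_rel.intros(2)] by (simp add: diff_diff_eq)
  moreover have "frag_of (a * b, x # xs) \<approx> frag_of (a, la b x # xs)" for a b x xs
    unfolding cong_def using NN_rel [OF tens_rel.intros(3)] .
  moreover have "frag_of (a, xs @ ra x b # y # ys) \<approx> frag_of (a, xs @ x # la b y # ys)" for a b x xs y ys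
    unfolding cong_def using NN_rel [OF tens_rel.intros(4)] .
  ultimately show ?thesis
    using frag_add_cong unfolding balanced_def wd_def vec.add [symmetric] vec_eq_iff by blast
qed

end

section \<open>Subgroups and signs\<close>

definition subgrp :: "'g::ab_group_add set \<Rightarrow> bool" where
  "subgrp H \<longleftrightarrow> 0 \<in> H \<and> (\<forall>x\<in>H. \<forall>y\<in>H. x - y \<in> H)"

lemma subgrp_0: "subgrp H \<Longrightarrow> 0 \<in> H"
  and subgrp_diff: "subgrp H \<Longrightarrow> x \<in> H \<Longrightarrow> y \<in> H \<Longrightarrow> x - y \<in> H"
  by (auto simp: subgrp_def)

lemma subgrp_minus: "subgrp H \<Longrightarrow> x \<in> H \<Longrightarrow> - x \<in> H"
  using subgrp_diff [of H 0 x] by (simp add: subgrp_0)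

lemma subgrp_add: "subgrp H \<Longrightarrow> x \<in> H \<Longrightarrow> y \<in> H \<Longrightarrow> x + y \<in> H"
  using subgrp_diff [of H x "- y"] by (simp add: subgrp_minus)

lemma subgrp_sum: "subgrp H \<Longrightarrow> (\<And>i. i \<in> I \<Longrightarrow> f i \<in> H) \<Longrightarrow> sum f I \<in> H"
  by (induction I rule: infinite_finite_induct) (auto intro: subgrp_add subgrp_0)

lemma subgrp_zmul: "subgrp H \<Longrightarrow> x \<in> H \<Longrightarrow> zmul k x \<in> H"
  unfolding zmul_def by (intro subgrp_diff subgrp_sum)

lemma frag_sum_mem:
  "subgrp H \<Longrightarrow> (\<And>w. w \<in> Poly_Mapping.keys u \<Longrightarrow> F w \<in> H) \<Longrightarrow> frag_sum F u \<in> H"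
  unfolding frag_sum_def by (intro subgrp_sum subgrp_zmul)

lemma subgrp_singleton [simp]: "subgrp {0}" and subgrp_UNIV [simp]: "subgrp UNIV"
  by (auto simp: subgrp_def)

lemma zmul_distrib: "zmul k (x + y) = zmul k x + zmul k y"
  by (simp add: zmul_def sum.distrib algebra_simps)

lemma frag_sum_fun_add: "frag_sum (\<lambda>w. F w + G w) u = frag_sum F u + frag_sum G u"
  by (simp add: frag_sum_def zmul_distrib sum.distrib)

definition sg :: "int \<Rightarrow> 'g::ab_group_add \<Rightarrow> 'g" where
  "sg l x = (if even l then x else - x)"

lemma sg_simps [simp]: "sg l 0 = 0" "sg 0 x = x" "sg 1 x = - x" "sg l (sg l x) = x"
  "sg l (- x) = - sg l x" "sg (- l) x = sg l x" "sg (-1) x = - x"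
  by (auto simp: sg_def)
lemma sg_add: "sg l (x + y) = sg l x + sg l y" and sg_diff: "sg l (x - y) = sg l x - sg l y"
  by (auto simp: sg_def)
lemma sg_sg: "sg l (sg k x) = sg (l + k) x" by (auto simp: sg_def)
lemma sg_sum: "sg l (sum f I) = (\<Sum>i\<in>I. sg l (f i))" by (auto simp: sg_def sum_negf)
lemma sg_mem: "subgrp H \<Longrightarrow> x \<in> H \<Longrightarrow> sg l x \<in> H" by (auto simp: sg_def subgrp_minus)
lemma additive_sg: "additive (sg l)" by (rule additiveI) (rule sg_add)
lemma sg_additive: "additive f \<Longrightarrow> f (sg l x) = sg l (f x)" by (simp add: sg_def additive.minus)

section \<open>Normal forms and additive spans of words\<close>

context tensor_powers
begin

lemma balancedD:
  assumes "balanced F"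
  shows "F (a + b) xs = F a xs + F b xs"
    "F a (xs @ (x + y) # ys) = F a (xs @ x # ys) + F a (xs @ y # ys)"
    "F (a * b) (x # xs) = F a (la b x # xs)"
    "F a (xs @ ra x b # y # ys) = F a (xs @ x # la b y # ys)"
  using assms unfolding balanced_def by blast+

lemma balanced_hd:
  assumes "balanced F"
  shows "F a ((x + y) # ys) = F a (x # ys) + F a (y # ys)"
    "F a (ra x b # y # ys) = F a (x # la b y # ys)"
  using balancedD(2) [OF assms, of a "[]"] balancedD(4) [OF assms, of a "[]"] by auto

lemmas wd_rel = balancedD [OF balanced_wd] balanced_hd [OF balanced_wd]

lemma ext_plus: "ext (\<lambda>a xs. F a xs + G a xs) v = ext F v + ext G v"
proof -
  have "(\<lambda>(a, xs). F a xs + G a xs) = (\<lambda>w. case_prod F w + case_prod G w)" by auto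
  then show ?thesis by (simp only: ext_def frag_sum_fun_add)
qed

lemma ext_mem: "subgrp H \<Longrightarrow> (\<And>a xs. F a xs \<in> H) \<Longrightarrow> ext F v \<in> H"
  unfolding ext_def by (rule frag_sum_mem) auto

text \<open>Normal form: a retraction of all vectors onto the image of \<open>vec\<close>. It
  carries identities proved on that image over to arbitrary arguments.\<close>

definition rho where "rho v = vec (lower v)"

lemma ext_rho: "balanced F \<Longrightarrow> ext F (rho v) = ext F v"
  unfolding rho_def by (simp add: ext_vec) (simp add: ext_def)

lemma vec_eq_frag_sum: "vec u = frag_sum (case_prod wd) u"
  by (rule frag_sum_unique) (auto simp: wd_def vec.additive_axioms)

definition spn :: "('a \<times> 'p list) set \<Rightarrow> ('k, 'a, 'p) tv set" where
  "spn W = vec ` {u. Poly_Mapping.keys u \<subseteq> W}"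

lemma subgrp_spn: "subgrp (spn W)"
  unfolding subgrp_def
proof (intro conjI ballI)
  show "0 \<in> spn W" unfolding spn_def by (rule image_eqI [of _ _ 0]) (auto simp: vec.zero)
  fix x y assume "x \<in> spn W" "y \<in> spn W"
  then obtain u v where "x = vec u" "y = vec v" "Poly_Mapping.keys u \<subseteq> W" "Poly_Mapping.keys v \<subseteq> W"
    unfolding spn_def by auto
  then show "x - y \<in> spn W"
    unfolding spn_def by (intro image_eqI [of _ _ "u - v"]) (auto simp: vec.diff dest: keys_diff [THEN subsetD])
qed

lemma wd_spn: "(a, xs) \<in> W \<Longrightarrow> wd a xs \<in> spn W"
  unfolding spn_def wd_def by (rule imageI) simp

lemma spn_mono: "W \<subseteq> W' \<Longrightarrow> spn W \<subseteq> spn W'"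
  unfolding spn_def by blast

lemma additive_spn_mem:
  assumes "additive f" "subgrp H" "\<And>a xs. (a, xs) \<in> W \<Longrightarrow> f (wd a xs) \<in> H" "v \<in> spn W"
  shows "f v \<in> H"
proof -
  obtain u where u: "v = vec u" "Poly_Mapping.keys u \<subseteq> W" using assms(4) unfolding spn_def by auto
  have "additive (\<lambda>u. f (vec u))"
    using assms(1) by (auto intro!: additiveI simp: vec.add additive.add)
  then have "f (vec u) = frag_sum (\<lambda>w. f (vec (frag_of w))) u" by (rule frag_sum_unique) simp
  also have "\<dots> \<in> H" using u assms(3) by (intro frag_sum_mem assms(2)) (force simp: wd_def)
  finally show ?thesis using u by simp
qed

lemma additive_spn_eq:
  assumes "additive f" "additive g" "\<And>a xs. (a, xs) \<in> W \<Longrightarrow> f (wd a xs) = g (wd a xs)" "v \<in> spn W"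
  shows "f v = g v"
proof -
  have "f v - g v \<in> {0}"
    by (rule additive_spn_mem [of "\<lambda>v. f v - g v" _ W])
       (use assms in \<open>auto intro!: additiveI simp: additive.add\<close>)
  then show ?thesis by simp
qed

abbreviation "TT \<equiv> spn UNIV"

lemma rho_TT [simp]: "rho v \<in> TT" by (auto simp: rho_def spn_def)
lemma rho_id: "v \<in> TT \<Longrightarrow> rho v = v"
  unfolding spn_def rho_def using lower_vec vec_eq_iff by auto
lemma spn_TT: "v \<in> spn W \<Longrightarrow> v \<in> TT" using spn_mono by blast
lemma additive_rho: "additive rho"
  unfolding rho_def by (rule additiveI) (metis lower_add vec.add vec_eq_iff)
lemma wd_TT [simp]: "wd a xs \<in> TT" by (rule wd_spn) simp

subsection \<open>The product\<close>

definition mw :: "'a \<Rightarrow> 'p list \<Rightarrow> 'a \<Rightarrow> 'p list \<Rightarrow> ('k, 'a, 'p) tv" where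
  "mw a xs b ys = (if xs = [] then wd (a * b) ys else wd a (butlast xs @ ra (last xs) b # ys))"

lemma balanced_mw: "balanced (mw a xs)"
proof -
  have 1: "wd a (butlast xs @ z # pre @ (x + y) # post) =
      wd a (butlast xs @ z # pre @ x # post) + wd a (butlast xs @ z # pre @ y # post)" for z pre x y post
    using wd_rel(2) [of a "butlast xs @ z # pre"] by simp
  have 2: "wd a (butlast xs @ z # pre @ ra x b # y # post) =
      wd a (butlast xs @ z # pre @ x # la b y # post)" for z pre x y post b
    using wd_rel(4) [of a "butlast xs @ z # pre"] by simp
  show ?thesis
    unfolding balanced_def mw_def
    by (auto simp: wd_rel act distrib_left mult.assoc [symmetric] 1 2)
qed

lemma mw_add_left: "mw (a + a') xs b ys = mw a xs b ys + mw a' xs b ys"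
  by (simp add: mw_def distrib_right wd_rel)

lemma mw_mid: "mw a (xs @ (x + y) # zs) b ys = mw a (xs @ x # zs) b ys + mw a (xs @ y # zs) b ys"
proof (cases "zs = []")
  case True
  then show ?thesis by (simp add: mw_def act wd_rel butlast_append)
next
  case False
  then show ?thesis using wd_rel(2) by (simp add: mw_def butlast_append)
qed

lemma mw_hd: "mw (a * c) (x # xs) b ys = mw a (la c x # xs) b ys"
  by (simp add: mw_def wd_rel act)

lemma mw_bal: "mw a (xs @ ra x c # y # zs) b ys = mw a (xs @ x # la c y # zs) b ys"
  using wd_rel(4) by (cases "zs = []") (auto simp: mw_def act wd_rel butlast_append)

definition tm :: "('k, 'a, 'p) tv \<Rightarrow> ('k, 'a, 'p) tv \<Rightarrow> ('k, 'a, 'p) tv" (infixl "\<odot>" 70) where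
  "X \<odot> Y = ext (\<lambda>a xs. ext (mw a xs) Y) X"

lemma balanced_ext_mw: "balanced (\<lambda>a xs. ext (mw a xs) Y)"
proof -
  have "mw (a + a') xs = (\<lambda>b ys. mw a xs b ys + mw a' xs b ys)" for a a' xs
    by (intro ext) (rule mw_add_left)
  moreover have "mw a (xs @ (x + y) # zs) = (\<lambda>b ys. mw a (xs @ x # zs) b ys + mw a (xs @ y # zs) b ys)"
    for a xs x y zs
    by (intro ext) (rule mw_mid)
  moreover have "mw (a * c) (x # xs) = mw a (la c x # xs)" for a c x xs
    by (intro ext) (rule mw_hd)
  moreover have "mw a (xs @ ra x c # y # zs) = mw a (xs @ x # la c y # zs)" for a c x y xs zs
    by (intro ext) (rule mw_bal)
  ultimately show ?thesis unfolding balanced_def by (simp add: ext_plus)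
qed

lemma tm_wd: "wd a xs \<odot> wd b ys = mw a xs b ys"
  unfolding tm_def by (subst ext_wd [OF balanced_ext_mw]) (rule ext_wd [OF balanced_mw])

lemma additive_tm_left: "additive (\<lambda>X. X \<odot> Y)"
  unfolding tm_def by (rule additive_ext) (rule balanced_ext_mw)

lemma additive_tm_right: "additive (\<lambda>Y. X \<odot> Y)"
proof (rule additiveI)
  fix Y Z
  have *: "ext (mw a xs) (Y + Z) = ext (mw a xs) Y + ext (mw a xs) Z" for a xs
    by (rule additive.add) (rule additive_ext [OF balanced_mw])
  show "X \<odot> (Y + Z) = X \<odot> Y + X \<odot> Z"
    unfolding tm_def * by (rule ext_plus)
qed

lemmas tm_add = additive.add [OF additive_tm_left] additive.add [OF additive_tm_right]
  and tm_diff = additive.diff [OF additive_tm_left] additive.diff [OF additive_tm_right]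
  and tm_minus [simp] = additive.minus [OF additive_tm_left] additive.minus [OF additive_tm_right]
  and tm_zero [simp] = additive.zero [OF additive_tm_left] additive.zero [OF additive_tm_right]
  and tm_sg = sg_additive [OF additive_tm_left] sg_additive [OF additive_tm_right]

lemma rho_tm: "rho X \<odot> Y = X \<odot> Y" "X \<odot> rho Y = X \<odot> Y"
  unfolding tm_def by (rule ext_rho [OF balanced_ext_mw]) (simp add: ext_rho [OF balanced_mw])

lemma mw_TT [simp]: "mw a xs b ys \<in> TT" by (simp add: mw_def)

lemma tm_TT [simp]: "X \<odot> Y \<in> TT"
  unfolding tm_def by (intro ext_mem subgrp_spn mw_TT)

lemma mw_Nil [simp]: "mw a [] b ys = wd (a * b) ys" by (simp add: mw_def)

text \<open>Checked on words and extended one argument at a time. Passing through \<open>rho\<close>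
  after each extension removes the membership condition, so the result rewrites without side
  conditions.\<close>

lemma tm_assoc: "(X \<odot> Y) \<odot> Z = X \<odot> (Y \<odot> Z)"
proof -
  have 1: "(wd a xs \<odot> wd b ys) \<odot> wd c zs = wd a xs \<odot> (wd b ys \<odot> wd c zs)" for a xs b ys c zs
    by (cases "xs = []"; cases "ys = []")
       (simp_all add: tm_wd mw_def mult.assoc act(7) butlast_append)
  have "(wd a xs \<odot> wd b ys) \<odot> Z = wd a xs \<odot> (wd b ys \<odot> Z)" if "Z \<in> TT" for a xs b ys Z
    by (rule additive_spn_eq [OF _ _ _ that])
       (auto intro: additiveI simp: tm_add 1)
  from this [OF rho_TT] have 2: "(wd a xs \<odot> wd b ys) \<odot> Z = wd a xs \<odot> (wd b ys \<odot> Z)" for a xs b ys Z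
    by (simp add: rho_tm)
  have "(wd a xs \<odot> Y) \<odot> Z = wd a xs \<odot> (Y \<odot> Z)" if "Y \<in> TT" for a xs Y Z
    by (rule additive_spn_eq [OF _ _ _ that])
       (auto intro: additiveI simp: tm_add 2)
  from this [OF rho_TT] have 3: "(wd a xs \<odot> Y) \<odot> Z = wd a xs \<odot> (Y \<odot> Z)" for a xs Y Z
    by (simp add: rho_tm)
  have "(X \<odot> Y) \<odot> Z = X \<odot> (Y \<odot> Z)" if "X \<in> TT" for X Y Z
    by (rule additive_spn_eq [OF _ _ _ that])
       (auto intro: additiveI simp: tm_add 3)
  from this [OF rho_TT] show ?thesis by (simp add: rho_tm)
qed

abbreviation emA where "emA a \<equiv> wd a []"
abbreviation emP where "emP x \<equiv> wd 1 [x]"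

lemma emA_wd: "emA a \<odot> wd b xs = wd (a * b) xs" by (simp add: tm_wd)

lemma emA_one [simp]: "X \<in> TT \<Longrightarrow> emA 1 \<odot> X = X"
  by (rule additive_spn_eq [OF additive_tm_right]) (auto intro: additiveI simp: emA_wd)

lemma wd_emA: "xs \<noteq> [] \<Longrightarrow> wd a xs \<odot> emA b = wd a (butlast xs @ [ra (last xs) b])"
  by (simp add: tm_wd mw_def)

lemma one_emA [simp]: "X \<in> TT \<Longrightarrow> X \<odot> emA 1 = X"
  by (rule additive_spn_eq [OF additive_tm_left]) (auto intro: additiveI simp: tm_wd mw_def act)

lemma wd_Cons: "wd a (x # xs) = emA a \<odot> (emP x \<odot> wd 1 xs)"
  by (simp add: tm_wd mw_def act)

lemma emP_act: "emP (la a x) = emA a \<odot> emP x" "emP (ra x a) = emP x \<odot> emA a"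
  using wd_rel(3) [of 1 a x "[]"] by (simp_all add: tm_wd mw_def)

lemma emA_mult: "emA (a * b) = emA a \<odot> emA b" by (simp add: emA_wd)

lemma additive_emA: "additive emA" and additive_emP: "additive emP"
  by (auto intro!: additiveI simp: wd_rel)

lemma wd_induct:
  assumes "\<And>a. Q (emA a)" "\<And>a x Y. Y \<in> TT \<Longrightarrow> Q Y \<Longrightarrow> Q (emA a \<odot> (emP x \<odot> Y))"
  shows "Q (wd a xs)"
proof (induction xs arbitrary: a)
  case (Cons x xs)
  show ?case by (subst wd_Cons) (intro assms(2) wd_TT Cons.IH)
qed (rule assms(1))

lemma TT_additive_eq:
  assumes f: "additive f" and g: "additive g" and A: "\<And>a. f (emA a) = g (emA a)"
    and C: "\<And>a x Y. Y \<in> TT \<Longrightarrow> f Y = g Y \<Longrightarrow> f (emA a \<odot> (emP x \<odot> Y)) = g (emA a \<odot> (emP x \<odot> Y))"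
    and v: "v \<in> TT"
  shows "f v = g v"
proof (rule additive_spn_eq [OF f g _ v])
  fix a xs show "f (wd a xs) = g (wd a xs)" by (rule wd_induct) (use A C in auto)
qed

subsection \<open>Homogeneous components\<close>

abbreviation Pc where "Pc \<equiv> hcomp P"

lemma Pc_subgrp: "subgrp (Pc i)"
  and Pc_la: "x \<in> Pc i \<Longrightarrow> la a x \<in> Pc i" and Pc_ra: "x \<in> Pc i \<Longrightarrow> ra x a \<in> Pc i"
  using graded unfolding graded_bimodule_def subgrp_def by blast+

definition is_dec :: "'p \<Rightarrow> (int \<Rightarrow> 'p) \<Rightarrow> bool" where
  "is_dec x u \<longleftrightarrow> (\<forall>i. u i \<in> Pc i) \<and> finite {i. u i \<noteq> 0} \<and> x = (\<Sum>i | u i \<noteq> 0. u i)"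

definition dec :: "'p \<Rightarrow> int \<Rightarrow> 'p" where "dec x = (THE u. is_dec x u)"

lemma ex1_dec: "\<exists>!u. is_dec x u"
  using graded unfolding graded_bimodule_def is_dec_def by blast

lemma is_dec_dec: "is_dec x (dec x)"
  using theI' [OF ex1_dec] unfolding dec_def .

lemma is_decI:
  assumes "\<And>i. u i \<in> Pc i" "finite K" "{i. u i \<noteq> 0} \<subseteq> K" "x = sum u K"
  shows "is_dec x u"
proof -
  have "sum u K = (\<Sum>i | u i \<noteq> 0. u i)"
    by (rule sum.mono_neutral_right) (use assms in auto)
  then show ?thesis using assms finite_subset unfolding is_dec_def by auto
qed

lemma dec_eqI: "is_dec x u \<Longrightarrow> dec x = u"
  using ex1_dec is_dec_dec by blast

lemma dec_mem: "dec x i \<in> Pc i" and dec_finite: "finite {i. dec x i \<noteq> 0}"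
  using is_dec_dec unfolding is_dec_def by blast+

lemma dec_sum: "finite K \<Longrightarrow> {i. dec x i \<noteq> 0} \<subseteq> K \<Longrightarrow> x = (\<Sum>i\<in>K. dec x i)"
proof -
  assume K: "finite K" "{i. dec x i \<noteq> 0} \<subseteq> K"
  have "(\<Sum>i\<in>K. dec x i) = (\<Sum>i | dec x i \<noteq> 0. dec x i)"
    by (rule sum.mono_neutral_right) (use K in auto)
  then show ?thesis using is_dec_dec [of x] unfolding is_dec_def by simp
qed

lemma dec_add: "dec (x + y) = (\<lambda>i. dec x i + dec y i)"
proof (rule dec_eqI, rule is_decI)
  let ?K = "{i. dec x i \<noteq> 0} \<union> {i. dec y i \<noteq> 0}"
  show "dec x i + dec y i \<in> Pc i" for i by (intro subgrp_add [OF Pc_subgrp] dec_mem)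
  show "finite ?K" using dec_finite by simp
  show "x + y = (\<Sum>i\<in>?K. dec x i + dec y i)"
    using dec_sum [of ?K x] dec_sum [of ?K y] dec_finite by (simp add: sum.distrib)
qed auto

lemma dec_hom: "x \<in> Pc i \<Longrightarrow> dec x = (\<lambda>j. if j = i then x else 0)"
  by (rule dec_eqI, rule is_decI [where K = "{i}"]) (use subgrp_0 [OF Pc_subgrp] in auto)

lemma P_induct [case_names hom zero add]:
  assumes "\<And>i x. x \<in> Pc i \<Longrightarrow> Q x" "Q 0" "\<And>x y. Q x \<Longrightarrow> Q y \<Longrightarrow> Q (x + y)"
  shows "Q x"
proof -
  have "Q (sum (dec x) K)" if "finite K" for K
    using that by (induction K) (auto intro!: assms(2,3) assms(1) [OF dec_mem])
  then show ?thesis using dec_sum [OF dec_finite subset_refl] dec_finite by metis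
qed

lemma P_additive_eq:
  assumes f: "additive f" and g: "additive g" and "\<And>i x. x \<in> Pc i \<Longrightarrow> f x = g x"
  shows "f x = g x"
  by (induction x rule: P_induct)
     (use assms(3) additive.zero [OF f] additive.zero [OF g] additive.add [OF f] additive.add [OF g] in auto)

text \<open>Assembles maps that are given degree by degree: the sign automorphism \<open>tau\<close>
  and the null homotopies.\<close>

definition glue :: "(int \<Rightarrow> 'p \<Rightarrow> 'g::ab_group_add) \<Rightarrow> 'p \<Rightarrow> 'g" where
  "glue g x = (\<Sum>i | dec x i \<noteq> 0. g i (dec x i))"

definition Padd :: "int \<Rightarrow> ('p \<Rightarrow> 'g::ab_group_add) \<Rightarrow> bool" where
  "Padd i g \<longleftrightarrow> (\<forall>x\<in>Pc i. \<forall>y\<in>Pc i. g (x + y) = g x + g y)"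

lemma Padd_0: "Padd i g \<Longrightarrow> g 0 = 0"
  unfolding Padd_def using subgrp_0 [OF Pc_subgrp, of i] by (metis add_cancel_right_right)

lemma glue_sum:
  assumes "\<And>i. Padd i (g i)" "finite K" "{i. dec x i \<noteq> 0} \<subseteq> K"
  shows "glue g x = (\<Sum>i\<in>K. g i (dec x i))"
  unfolding glue_def by (rule sum.mono_neutral_left) (use assms Padd_0 [OF assms(1)] in auto)

lemma additive_glue:
  assumes g: "\<And>i. Padd i (g i)"
  shows "additive (glue g)"
proof (rule additiveI)
  fix x y
  let ?K = "{i. dec x i \<noteq> 0} \<union> {i. dec y i \<noteq> 0}"
  have "glue g (x + y) = (\<Sum>i\<in>?K. g i (dec (x + y) i))"
    by (rule glue_sum [OF g]) (auto simp: dec_finite dec_add)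
  also have "\<dots> = (\<Sum>i\<in>?K. g i (dec x i)) + (\<Sum>i\<in>?K. g i (dec y i))"
    using g dec_mem unfolding Padd_def by (simp add: dec_add sum.distrib)
  also have "\<dots> = glue g x + glue g y"
    using glue_sum [OF g, of ?K x] glue_sum [OF g, of ?K y] dec_finite by simp
  finally show "glue g (x + y) = glue g x + glue g y" .
qed

lemma glue_hom:
  assumes g: "\<And>i. Padd i (g i)" and x: "x \<in> Pc i"
  shows "glue g x = g i x"
proof -
  have "{j. dec x j \<noteq> 0} \<subseteq> {i}" by (auto simp: dec_hom [OF x])
  from glue_sum [OF g _ this] show ?thesis by (simp add: dec_hom [OF x])
qed

lemma glue_equivariant:
  assumes g: "\<And>i. Padd i (g i)" and A: "additive A" and B: "additive B"
    and AP: "\<And>i x. x \<in> Pc i \<Longrightarrow> A x \<in> Pc i" and AB: "\<And>i x. x \<in> Pc i \<Longrightarrow> g i (A x) = B (g i x)"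
  shows "glue g (A x) = B (glue g x)"
  by (rule P_additive_eq [where x = x])
     (auto intro!: additiveI simp: additive.add [OF A] additive.add [OF B] additive.add [OF additive_glue [OF g]]
       glue_hom [OF g] glue_hom [OF g AP] AB)

lemma additive_la: "additive (la a)" and additive_ra: "additive (\<lambda>x. ra x a)"
  by (auto intro: additiveI simp: act)

text \<open>The Koszul sign for moving a map of degree \<open>l\<close> past an element, as a
  bimodule automorphism. It also makes sense on inhomogeneous elements, so sign rules need no
  splitting into degrees.\<close>

definition tau :: "int \<Rightarrow> 'p \<Rightarrow> 'p" where "tau l = glue (\<lambda>i. sg (l * i))"

lemma Padd_sg: "Padd i (sg l)" by (simp add: Padd_def sg_add)

lemma additive_tau: "additive (tau l)" unfolding tau_def by (rule additive_glue) (rule Padd_sg)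
lemma tau_hom: "x \<in> Pc i \<Longrightarrow> tau l x = sg (l * i) x"
  unfolding tau_def by (rule glue_hom) (rule Padd_sg)
lemma tau_la: "tau l (la a x) = la a (tau l x)"
  unfolding tau_def
  by (rule glue_equivariant) (auto intro: Padd_sg additive_la Pc_la sg_additive [symmetric])
lemma tau_ra: "tau l (ra x a) = ra (tau l x) a"
  unfolding tau_def
  by (rule glue_equivariant [of _ "\<lambda>x. ra x a" "\<lambda>x. ra x a"])
     (auto intro: Padd_sg additive_ra Pc_ra sg_additive [OF additive_ra, symmetric])
lemma tau_mem: "x \<in> Pc i \<Longrightarrow> tau l x \<in> Pc i"
  by (simp add: tau_hom sg_mem Pc_subgrp)
lemma tau_tau: "tau l (tau k x) = tau (l + k) x"
  by (rule P_additive_eq [where x = x])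
     (auto intro!: additiveI simp: additive.add [OF additive_tau] sg_additive [OF additive_tau] tau_hom sg_sg algebra_simps)

subsection \<open>The grading of the tensor powers\<close>

definition hl :: "'p list \<Rightarrow> int \<Rightarrow> bool" where
  "hl xs i \<longleftrightarrow> (\<exists>ds. list_all2 (\<lambda>x d. x \<in> Pc d) xs ds \<and> sum_list ds = i)"

lemma hl_Nil [simp]: "hl [] i \<longleftrightarrow> i = 0" by (auto simp: hl_def)

lemma hl_Cons: "hl (x # xs) i \<longleftrightarrow> (\<exists>d. x \<in> Pc d \<and> hl xs (i - d))"
  unfolding hl_def by (force simp: list_all2_Cons1)

lemma hl_append: "hl (xs @ ys) i \<longleftrightarrow> (\<exists>d. hl xs d \<and> hl ys (i - d))"
proof (induction xs arbitrary: i)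
  case (Cons x xs)
  have "hl ((x # xs) @ ys) i \<longleftrightarrow> (\<exists>d e. x \<in> Pc d \<and> hl xs e \<and> hl ys (i - d - e))"
    by (auto simp: hl_Cons Cons)
  also have "\<dots> \<longleftrightarrow> (\<exists>d. hl (x # xs) d \<and> hl ys (i - d))"
  proof
    assume "\<exists>d e. x \<in> Pc d \<and> hl xs e \<and> hl ys (i - d - e)"
    then obtain d e where "x \<in> Pc d" "hl xs e" "hl ys (i - d - e)" by blast
    then show "\<exists>d. hl (x # xs) d \<and> hl ys (i - d)"
      by (intro exI [of _ "d + e"]) (auto simp: hl_Cons diff_diff_eq intro: exI [of _ d])
  next
    assume "\<exists>d. hl (x # xs) d \<and> hl ys (i - d)"
    then obtain c d where "x \<in> Pc d" "hl xs (c - d)" "hl ys (i - c)" unfolding hl_Cons by blast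
    then show "\<exists>d e. x \<in> Pc d \<and> hl xs e \<and> hl ys (i - d - e)"
      by (intro exI [of _ d] exI [of _ "c - d"]) simp
  qed
  finally show ?case .
qed simp

definition TN where "TN n = spn {(a, xs). length xs = n}"
definition TH where "TH n i = spn {(a, xs). length xs = n \<and> hl xs i}"

lemma subgrp_TH: "subgrp (TH n i)" and subgrp_TN: "subgrp (TN n)"
  by (auto simp: TH_def TN_def subgrp_spn)

lemmas TH_add = subgrp_add [OF subgrp_TH] and TH_diff = subgrp_diff [OF subgrp_TH]
  and TH_0 = subgrp_0 [OF subgrp_TH]
  and TH_sg = sg_mem [OF subgrp_TH] and TH_sum = subgrp_sum [OF subgrp_TH]

lemma TH_TN: "v \<in> TH n i \<Longrightarrow> v \<in> TN n"
  unfolding TH_def TN_def using spn_mono [of "{(a, xs). length xs = n \<and> hl xs i}" "{(a, xs). length xs = n}"] by auto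
lemma TN_TT: "v \<in> TN n \<Longrightarrow> v \<in> TT" unfolding TN_def by (rule spn_TT)
lemma TH_TT: "v \<in> TH n i \<Longrightarrow> v \<in> TT" unfolding TH_def by (rule spn_TT)

lemma wd_TN: "length xs = n \<Longrightarrow> wd a xs \<in> TN n" unfolding TN_def by (rule wd_spn) simp
lemma wd_TH: "length xs = n \<Longrightarrow> hl xs i \<Longrightarrow> wd a xs \<in> TH n i" unfolding TH_def by (rule wd_spn) simp

lemma additive_TH_mem:
  assumes "additive f" "subgrp H" "\<And>a xs. length xs = n \<Longrightarrow> hl xs i \<Longrightarrow> f (wd a xs) \<in> H" "v \<in> TH n i"
  shows "f v \<in> H"
  using assms additive_spn_mem [of f H "{(a, xs). length xs = n \<and> hl xs i}" v] by (auto simp: TH_def)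

lemma additive_TN_mem:
  assumes "additive f" "subgrp H" "\<And>a xs. length xs = n \<Longrightarrow> f (wd a xs) \<in> H" "v \<in> TN n"
  shows "f v \<in> H"
  using assms additive_spn_mem [of f H "{(a, xs). length xs = n}" v] by (auto simp: TN_def)

lemma additive_TH_eq:
  assumes "additive f" "additive g" "\<And>a xs. length xs = n \<Longrightarrow> hl xs i \<Longrightarrow> f (wd a xs) = g (wd a xs)" "v \<in> TH n i"
  shows "f v = g v"
  using assms additive_spn_eq [of f g "{(a, xs). length xs = n \<and> hl xs i}" v] by (auto simp: TH_def)

lemma additive_TN_eq:
  assumes "additive f" "additive g" "\<And>a xs. length xs = n \<Longrightarrow> f (wd a xs) = g (wd a xs)" "v \<in> TN n"
  shows "f v = g v"
  using assms additive_spn_eq [of f g "{(a, xs). length xs = n}" v] by (auto simp: TN_def)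

text \<open>
  Closure under sums suffices, as the coefficient of a word absorbs signs. Closure under negation is not
  available for \<open>tens_map\<close>: its values are arbitrary sets a priori, where addition is not cancellative.
\<close>

lemma TN_hom_induct:
  assumes hom: "\<And>a xs i. length xs = n \<Longrightarrow> hl xs i \<Longrightarrow> Q (wd a xs)"
    and zero: "Q 0" and add: "\<And>v w. v \<in> TN n \<Longrightarrow> w \<in> TN n \<Longrightarrow> Q v \<Longrightarrow> Q w \<Longrightarrow> Q (v + w)"
    and v: "v \<in> TN n"
  shows "Q v"
proof -
  have "hl xs i \<Longrightarrow> length xs + length ys = n \<Longrightarrow> Q (wd a (xs @ ys))" for a xs ys i
  proof (induction ys arbitrary: xs i)
    case Nil
    then show ?case using hom by simp
  next
    case (Cons y ys)
    show ?case
    proof (induction y rule: P_induct)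
      case (hom j y)
      have "hl (xs @ [y]) (i + j)"
        unfolding hl_append hl_Cons using hom Cons.prems(1) by (intro exI [of _ i]) simp
      then show ?case
        using Cons.IH [of "xs @ [y]" "i + j"] Cons.prems(2) by simp
    next
      case zero
      have "wd a (xs @ 0 # ys) = 0" using wd_rel(2) [of a xs 0 0 ys] by simp
      then show ?case using assms(2) by simp
    next
      case (add x y)
      then show ?case using assms(3) wd_TN Cons.prems(2) by (simp add: wd_rel)
    qed
  qed
  from this [of "[]" 0] have wd: "length xs = n \<Longrightarrow> Q (wd a xs)" for a xs by simp
  obtain u where u: "v = vec u" "Poly_Mapping.keys u \<subseteq> {(a, xs). length xs = n}"
    using v unfolding TN_def spn_def by auto
  have zmul: "zmul k (wd a xs) = wd (zmul k a) xs" for k a xs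
  proof -
    have a: "additive (\<lambda>a. wd a xs)" by (rule additiveI) (rule wd_rel)
    show ?thesis by (simp add: zmul_def additive.diff [OF a] additive.sum [OF a])
  qed
  have v: "v = (\<Sum>w\<in>Poly_Mapping.keys u. wd (zmul (Poly_Mapping.lookup u w) (fst w)) (snd w))"
    unfolding u(1) vec_eq_frag_sum frag_sum_def by (rule sum.cong) (auto simp: zmul)
  have "(\<Sum>w\<in>K. wd (c w) (snd w)) \<in> TN n \<and> Q (\<Sum>w\<in>K. wd (c w) (snd w))"
    if "finite K" "K \<subseteq> {(a, xs). length xs = n}" for K and c :: "'a \<times> 'p list \<Rightarrow> 'a"
    using that
  proof (induction K)
    case (insert w K)
    then show ?case
      using add [OF wd_TN _ wd] wd_TN subgrp_add [OF subgrp_TN] by (cases w) auto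
  qed (auto simp: zero subgrp_0 [OF subgrp_TN])
  from this [OF finite_keys u(2)] show ?thesis unfolding v by (rule conjunct2)
qed

lemma hl_ra_last: "xs \<noteq> [] \<Longrightarrow> hl xs i \<Longrightarrow> hl (butlast xs @ [ra (last xs) b]) i"
proof -
  assume "xs \<noteq> []" "hl xs i"
  then have "hl (butlast xs @ [last xs]) i" by simp
  then show ?thesis unfolding hl_append hl_Cons using Pc_ra by blast
qed

lemma mw_TH:
  assumes "hl xs i" "hl ys j" shows "mw a xs b ys \<in> TH (length xs + length ys) (i + j)"
proof (cases "xs = []")
  case True
  then show ?thesis using assms by (auto intro: wd_TH)
next
  case False
  then have "hl ((butlast xs @ [ra (last xs) b]) @ ys) (i + j)"
    unfolding hl_append [of "butlast xs @ [ra (last xs) b]"] using hl_ra_last [OF False assms(1)] assms(2) by force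
  with False show ?thesis by (auto simp: mw_def intro!: wd_TH)
qed

lemma tm_TH:
  assumes "X \<in> TH m i" "Y \<in> TH n j" shows "X \<odot> Y \<in> TH (m + n) (i + j)"
proof (rule additive_TH_mem [OF additive_tm_left subgrp_TH _ assms(1)])
  fix a xs assume "length xs = m" "hl xs i"
  then show "wd a xs \<odot> Y \<in> TH (m + n) (i + j)"
    by (intro additive_TH_mem [OF additive_tm_right subgrp_TH _ assms(2)]) (auto simp: tm_wd mw_TH)
qed

lemma emA_TH: "emA a \<in> TH 0 0" by (rule wd_TH) simp_all
lemma emP_TH: "x \<in> Pc i \<Longrightarrow> emP x \<in> TH 1 i" by (rule wd_TH) (simp_all add: hl_Cons)

lemma emA_tm_TH: "Y \<in> TH n j \<Longrightarrow> emA a \<odot> Y \<in> TH n j"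
  using tm_TH [OF emA_TH] by simp
lemma tm_emA_TH: "Y \<in> TH n j \<Longrightarrow> Y \<odot> emA a \<in> TH n j"
  using tm_TH [OF _ emA_TH] by simp
lemma emP_tm_TH: "x \<in> Pc i \<Longrightarrow> Y \<in> TH n j \<Longrightarrow> emP x \<odot> Y \<in> TH (Suc n) (i + j)"
  using tm_TH [OF emP_TH] by simp

subsection \<open>The sign automorphisms\<close>

lemma balanced_tt: "balanced (\<lambda>a xs. wd a (map (tau l) xs))"
  unfolding balanced_def
  by (simp add: wd_rel additive.add [OF additive_tau] tau_la tau_ra)

definition tt where "tt l = ext (\<lambda>a xs. wd a (map (tau l) xs))"

lemma tt_wd: "tt l (wd a xs) = wd a (map (tau l) xs)"
  unfolding tt_def by (rule ext_wd [OF balanced_tt])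
lemma additive_tt: "additive (tt l)" unfolding tt_def by (rule additive_ext [OF balanced_tt])
lemma tt_TT [simp]: "tt l v \<in> TT" unfolding tt_def by (rule ext_mem) (simp_all add: subgrp_spn)

lemma tt_tm: assumes "X \<in> TT" "Y \<in> TT" shows "tt l (X \<odot> Y) = tt l X \<odot> tt l Y"
proof (rule additive_spn_eq [OF _ _ _ assms(1)])
  fix a xs
  show "tt l (wd a xs \<odot> Y) = tt l (wd a xs) \<odot> tt l Y"
  proof (rule additive_spn_eq [OF _ _ _ assms(2)])
    fix b ys
    show "tt l (wd a xs \<odot> wd b ys) = tt l (wd a xs) \<odot> tt l (wd b ys)"
      by (simp add: tm_wd mw_def tt_wd map_butlast tau_ra last_map)
  qed (auto intro!: additiveI simp: tm_add additive.add [OF additive_tt])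
qed (auto intro!: additiveI simp: tm_add additive.add [OF additive_tt])

lemma tt_hom: assumes "X \<in> TH n i" shows "tt l X = sg (l * i) X"
proof (rule additive_TH_eq [OF additive_tt additive_sg _ assms])
  fix a xs assume "length xs = n" "hl xs i"
  have "wd a (map (tau l) xs) = sg (l * i) (wd a xs)" if "hl xs i" for a
    using that
  proof (induction xs arbitrary: a i)
    case (Cons x xs)
    then obtain d where x: "x \<in> Pc d" and xs: "hl xs (i - d)" by (auto simp: hl_Cons)
    have "wd a (map (tau l) (x # xs)) = emA a \<odot> (emP (sg (l * d) x) \<odot> wd 1 (map (tau l) xs))"
      by (simp add: tau_hom [OF x]) (rule wd_Cons)
    also have "\<dots> = sg (l * d + l * (i - d)) (emA a \<odot> (emP x \<odot> wd 1 xs))"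
      by (simp add: Cons.IH [OF xs] sg_additive [OF additive_emP] tm_sg sg_sg add.commute)
    also have "l * d + l * (i - d) = l * i" by (simp add: right_diff_distrib)
    finally show ?case by (simp only: wd_Cons [of a x xs])
  qed simp
  then show "tt l (wd a xs) = sg (l * i) (wd a xs)" using \<open>hl xs i\<close> by (simp add: tt_wd)
qed

lemma tt_emA [simp]: "tt l (emA a) = emA a" and tt_emP: "tt l (emP x) = emP (tau l x)"
  by (simp_all add: tt_wd)

lemma tt_tt: assumes "v \<in> TT" shows "tt l (tt k v) = tt (l + k) v"
proof (rule additive_spn_eq [where f = "\<lambda>v. tt l (tt k v)", OF _ additive_tt _ assms])
  show "tt l (tt k (wd a xs)) = tt (l + k) (wd a xs)" for a xs
    by (simp add: tt_wd comp_def tau_tau)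
qed (auto intro!: additiveI simp: additive.add [OF additive_tt])

subsection \<open>Derivations\<close>

text \<open>The vector side counterpart of \<open>graded_hom P (tens_power P n) l\<close>; the
  translation is in \<open>graded_hom_cls\<close> and \<open>graded_hom_rep\<close>.\<close>

definition GH :: "nat \<Rightarrow> int \<Rightarrow> ('p \<Rightarrow> ('k, 'a, 'p) tv) \<Rightarrow> bool" where
  "GH n l g \<longleftrightarrow> additive g \<and> (\<forall>a x. g (la a x) = emA a \<odot> g x \<and> g (ra x a) = g x \<odot> emA a) \<and>
     (\<forall>i. \<forall>x\<in>Pc i. g x \<in> TH n (i + l))"

lemma GHD:
  assumes "GH n l g"
  shows "additive g" "g (la a x) = emA a \<odot> g x" "g (ra x a) = g x \<odot> emA a"
    "x \<in> Pc i \<Longrightarrow> g x \<in> TH n (i + l)"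
  using assms unfolding GH_def by blast+

lemma additive_mem: "additive f \<Longrightarrow> subgrp H \<Longrightarrow> (\<And>i x. x \<in> Pc i \<Longrightarrow> f x \<in> H) \<Longrightarrow> f x \<in> H"
  by (induction x rule: P_induct) (auto simp: additive.zero additive.add intro: subgrp_0 subgrp_add)

lemma GH_TN: "GH n l g \<Longrightarrow> g x \<in> TN n"
  by (rule additive_mem) (auto dest: GHD intro: TH_TN subgrp_TN)

lemma GH_TT: "GH n l g \<Longrightarrow> g x \<in> TT" using GH_TN TN_TT by blast

lemma GH_0: "GH n l (\<lambda>x. 0)"
  by (auto simp: GH_def TH_0 intro: additiveI)

lemma GH_plus: "GH n l g \<Longrightarrow> GH n l h \<Longrightarrow> GH n l (\<lambda>x. g x + h x)"
  unfolding GH_def by (auto simp: additive.add tm_add intro!: additiveI intro: TH_add)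

lemma GH_sg: "GH n l g \<Longrightarrow> GH n l (\<lambda>x. sg k (g x))"
  unfolding GH_def by (auto simp: additive.add sg_add tm_sg intro!: additiveI intro: TH_sg)

text \<open>This is \<open>1 \<otimes> g \<otimes> 1\<close> with \<open>r\<close> identities on the
  left; the Koszul sign is carried by \<open>tau\<close> on each letter passed. Words that are too
  short go to 0, which is consistent because the tensor relations preserve length.\<close>

primrec ins :: "nat \<Rightarrow> int \<Rightarrow> ('p \<Rightarrow> ('k, 'a, 'p) tv) \<Rightarrow> 'a \<Rightarrow> 'p list \<Rightarrow> ('k, 'a, 'p) tv" where
  "ins 0 l g a xs = (case xs of [] \<Rightarrow> 0 | x # ys \<Rightarrow> emA a \<odot> (g x \<odot> wd 1 ys))"
| "ins (Suc r) l g a xs = (case xs of [] \<Rightarrow> 0 | x # ys \<Rightarrow> emA a \<odot> (emP (tau l x) \<odot> ins r l g 1 ys))"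

lemma ins_emA: "ins r l g (a * b) xs = emA a \<odot> ins r l g b xs"
  by (cases r) (auto split: list.split simp: emA_mult tm_assoc)

lemma ins_TT [simp]: "ins r l g a xs \<in> TT"
  by (cases r) (auto split: list.split simp: subgrp_0 [OF subgrp_spn])

lemma balanced_ins:
  assumes g: "additive g" "\<And>a x. g (la a x) = emA a \<odot> g x" "\<And>a x. g (ra x a) = g x \<odot> emA a"
  shows "balanced (ins r l g)"
proof (induction r)
  case 0
  have 1: "ins 0 l g a (xs @ (x + y) # ys) = ins 0 l g a (xs @ x # ys) + ins 0 l g a (xs @ y # ys)" for a xs x y ys
    by (cases xs) (simp_all add: additive.add [OF g(1)] tm_add wd_rel)
  have 2: "wd 1 (la b y # ys) = emA b \<odot> wd 1 (y # ys)" for b y ys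
    using wd_rel(3) [of 1 b y ys] by (simp add: emA_wd)
  have 3: "ins 0 l g a (xs @ ra x b # y # ys) = ins 0 l g a (xs @ x # la b y # ys)" for a xs x b y ys
  proof (cases xs)
    case Nil
    then show ?thesis by (simp only: append_Nil ins.simps list.case g(3) 2 tm_assoc)
  qed (simp add: wd_rel)
  show ?case unfolding balanced_def using 1 3
    by (auto simp: emA_mult tm_assoc g(2) additive.add [OF additive_emA] tm_add split: list.split)
next
  case (Suc r)
  note IH = balancedD [OF Suc] balanced_hd [OF Suc]
  have 1: "ins (Suc r) l g a (xs @ (x + y) # ys) = ins (Suc r) l g a (xs @ x # ys) + ins (Suc r) l g a (xs @ y # ys)" for a xs x y ys
    by (cases xs) (simp_all add: additive.add [OF additive_tau] additive.add [OF additive_emP] tm_add IH)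
  have 2: "ins r l g 1 (la b y # ys) = emA b \<odot> ins r l g 1 (y # ys)" for b y ys
    using IH(3) [of 1 b y ys] ins_emA [of r l g b 1] by simp
  have 3: "ins (Suc r) l g a (xs @ ra x b # y # ys) = ins (Suc r) l g a (xs @ x # la b y # ys)" for a xs x b y ys
  proof (cases xs)
    case Nil
    then show ?thesis by (simp only: append_Nil ins.simps list.case tau_ra emP_act 2 tm_assoc)
  qed (simp add: IH del: ins.simps(1))
  show ?case unfolding balanced_def using 1 3
    by (auto simp: emA_mult tm_assoc tau_la emP_act additive.add [OF additive_emA] tm_add split: list.split)
qed

definition insV where "insV r l g = ext (ins r l g)"
text \<open>The derivation of the tensor algebra that vanishes on \<open>A\<close> and restricts to
  \<open>g\<close> on \<open>P\<close>.\<close>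

definition der where "der l g = ext (\<lambda>a xs. \<Sum>r<length xs. ins r l g a xs)"

text \<open>The last clause expresses the degree of \<open>K\<close> through the sign automorphisms;
  it is what makes the signs in a commutator match.\<close>

definition is_der :: "int \<Rightarrow> (('k, 'a, 'p) tv \<Rightarrow> ('k, 'a, 'p) tv) \<Rightarrow> bool" where
  "is_der l K \<longleftrightarrow> additive K \<and> (\<forall>v. K v \<in> TT) \<and> (\<forall>a. K (emA a) = 0) \<and>
     (\<forall>X\<in>TT. \<forall>Y\<in>TT. K (X \<odot> Y) = K X \<odot> Y + tt l X \<odot> K Y) \<and>
     (\<forall>k. \<forall>X\<in>TT. K (tt k X) = sg (k * l) (tt k (K X)))"

lemma is_derD:
  assumes "is_der l K"
  shows "additive K" "K v \<in> TT" "K (emA a) = 0"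
    "X \<in> TT \<Longrightarrow> Y \<in> TT \<Longrightarrow> K (X \<odot> Y) = K X \<odot> Y + tt l X \<odot> K Y"
    "X \<in> TT \<Longrightarrow> K (tt k X) = sg (k * l) (tt k (K X))"
  using assms unfolding is_der_def by blast+

lemma is_der_emA:
  assumes "is_der l K"
  shows "Y \<in> TT \<Longrightarrow> K (emA a \<odot> Y) = emA a \<odot> K Y" "Y \<in> TT \<Longrightarrow> K (Y \<odot> emA a) = K Y \<odot> emA a"
  by (simp_all add: is_derD [OF assms])

lemma is_der_emA_emP:
  assumes "is_der l K" "Y \<in> TT"
  shows "K (emA a \<odot> (emP x \<odot> Y)) = emA a \<odot> (K (emP x) \<odot> Y + emP (tau l x) \<odot> K Y)"
  using assms(2) by (simp add: is_derD [OF assms(1)] tt_emP)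

text \<open>The tensor algebra is generated by \<open>A\<close>, where derivations vanish, and by
  \<open>P\<close>. Identities between derivations are thereby reduced to \<open>P\<close>.\<close>

lemma is_der_eq:
  assumes K: "is_der l K" and L: "is_der l L" and eq: "\<And>x. K (emP x) = L (emP x)" and v: "v \<in> TT"
  shows "K v = L v"
  by (rule TT_additive_eq [OF _ _ _ _ v])
     (simp_all add: is_derD(1,3) [OF K] is_derD(1,3) [OF L] is_der_emA_emP [OF K] is_der_emA_emP [OF L] eq)

lemma is_der_0: "is_der l (\<lambda>v. 0)"
  by (auto simp: is_der_def subgrp_0 [OF subgrp_spn] additive.zero [OF additive_tt] intro: additiveI)

lemma is_der_eq_0:
  assumes "is_der l K" "\<And>x. K (emP x) = 0" "v \<in> TT" shows "K v = 0"
  using is_der_eq [OF assms(1) is_der_0] assms(2,3) by simp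

lemma is_der_plus: "is_der l K \<Longrightarrow> is_der l L \<Longrightarrow> is_der l (\<lambda>v. K v + L v)"
  unfolding is_der_def
  by (auto simp: additive.add additive.add [OF additive_tt] sg_add tm_add subgrp_add [OF subgrp_spn] intro!: additiveI)

lemma is_der_sum: "finite I \<Longrightarrow> (\<And>i. i \<in> I \<Longrightarrow> is_der l (K i)) \<Longrightarrow> is_der l (\<lambda>v. \<Sum>i\<in>I. K i v)"
  by (induction I rule: finite_induct) (simp_all add: is_der_0 is_der_plus)

text \<open>The mixed terms, with one derivation on each factor, occur in both compositions and
  agree after the sign \<open>sg (l * k)\<close>, so they cancel.\<close>

lemma is_der_commutator:
  assumes K: "is_der l K" and L: "is_der k L"
  shows "is_der (l + k) (\<lambda>v. K (L v) - sg (l * k) (L (K v)))"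
  unfolding is_der_def
proof (intro conjI allI ballI)
  note [simp] = is_derD(2,3) [OF K] is_derD(2,3) [OF L] additive.zero [OF is_derD(1) [OF K]] additive.zero [OF is_derD(1) [OF L]]
  note add = additive.add [OF is_derD(1) [OF K]] additive.add [OF is_derD(1) [OF L]]
  note sga = sg_additive [OF is_derD(1) [OF K]] sg_additive [OF is_derD(1) [OF L]] sg_additive [OF additive_tt]
  show "additive (\<lambda>v. K (L v) - sg (l * k) (L (K v)))"
    by (auto intro!: additiveI simp: add sg_add)
  show "K (L v) - sg (l * k) (L (K v)) \<in> TT" for v
    by (simp add: subgrp_diff [OF subgrp_spn] sg_mem [OF subgrp_spn])
  show "K (L (emA a)) - sg (l * k) (L (K (emA a))) = 0" for a by simp
  fix X assume X: "X \<in> TT"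
  show "K (L (tt j X)) - sg (l * k) (L (K (tt j X))) =
      sg (j * (l + k)) (tt j (K (L X) - sg (l * k) (L (K X))))" for j
    by (simp add: X is_derD(5) [OF K] is_derD(5) [OF L] sga additive.diff [OF additive_tt] sg_diff sg_sg algebra_simps)
  fix Y assume Y: "Y \<in> TT"
  have 1: "K (L (X \<odot> Y)) = K (L X) \<odot> Y + sg (l * k) (L (tt l X) \<odot> K Y) + sg (l * k) (tt k (K X) \<odot> L Y) + tt (l + k) X \<odot> K (L Y)"
    by (simp add: X Y is_derD(4,5) [OF K] is_derD(4,5) [OF L] add tt_tt tm_sg ac_simps)
  have 2: "L (K (X \<odot> Y)) = L (K X) \<odot> Y + L (tt l X) \<odot> K Y + tt k (K X) \<odot> L Y + tt (l + k) X \<odot> L (K Y)"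
    by (simp add: X Y is_derD(4) [OF K] is_derD(4) [OF L] add tt_tt ac_simps)
  show "K (L (X \<odot> Y)) - sg (l * k) (L (K (X \<odot> Y))) =
      (K (L X) - sg (l * k) (L (K X))) \<odot> Y + tt (l + k) X \<odot> (K (L Y) - sg (l * k) (L (K Y)))"
    unfolding 1 2 by (simp add: sg_add sg_diff tm_diff tm_sg)
qed

end

locale graded_map = tensor_powers s P
  for s :: "'k::field \<Rightarrow> 'a::{ring,monoid_mult} \<Rightarrow> 'a" and P :: "('a, 'p::ab_group_add) gbimod" +
  fixes n :: nat and l :: int and g :: "'p \<Rightarrow> ('k, 'a, 'p) tv"
  assumes GH: "GH n l g"
begin

lemma balanced_der: "balanced (\<lambda>a xs. \<Sum>r<length xs. ins r l g a xs)"
proof -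
  note b = balancedD [OF balanced_ins [OF GHD(1-3) [OF GH]]]
  show ?thesis unfolding balanced_def
    by (intro conjI allI) (simp_all add: b sum.distrib del: ins.simps)
qed

lemma insV_wd: "insV r l g (wd a xs) = ins r l g a xs"
  and additive_insV: "additive (insV r l g)"
  unfolding insV_def using balanced_ins [OF GHD(1-3) [OF GH]] by (rule ext_wd, rule additive_ext)

lemma der_wd: "der l g (wd a xs) = (\<Sum>r<length xs. ins r l g a xs)"
  unfolding der_def by (rule ext_wd [OF balanced_der])

lemma additive_der: "additive (der l g)"
  unfolding der_def by (rule additive_ext [OF balanced_der])

lemma der_insV: "v \<in> TN m \<Longrightarrow> der l g v = (\<Sum>r<m. insV r l g v)"
proof (rule additive_TN_eq [OF additive_der])
  show "additive (\<lambda>v. \<Sum>r<m. insV r l g v)"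
    by (auto intro!: additiveI simp: additive.add [OF additive_insV] sum.distrib)
qed (simp_all add: der_wd insV_wd)

lemma der_TT [simp]: "der l g v \<in> TT"
  unfolding der_def by (intro ext_mem subgrp_spn subgrp_sum ins_TT)

lemma der_emA: "der l g (emA a) = 0" by (simp add: der_wd)

lemma der_emP: "der l g (emP x) = g x"
  using GH_TT [OF GH] by (simp add: der_wd)

lemma der_emA_tm: assumes "Y \<in> TT" shows "der l g (emA a \<odot> Y) = emA a \<odot> der l g Y"
proof (rule additive_spn_eq [OF _ _ _ assms])
  show "der l g (emA a \<odot> wd b xs) = emA a \<odot> der l g (wd b xs)" for b xs
    by (simp add: emA_wd der_wd ins_emA additive.sum [OF additive_tm_right])
qed (auto intro!: additiveI simp: tm_add additive.add [OF additive_der])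

lemma der_emP_tm: assumes "Y \<in> TT" shows "der l g (emP x \<odot> Y) = g x \<odot> Y + emP (tau l x) \<odot> der l g Y"
proof (rule additive_spn_eq [OF _ _ _ assms])
  show "der l g (emP x \<odot> wd b xs) = g x \<odot> wd b xs + emP (tau l x) \<odot> der l g (wd b xs)" for b xs
  proof -
    have 1: "emP x \<odot> wd b xs = wd 1 (ra x b # xs)" by (simp add: tm_wd mw_def)
    have "der l g (wd 1 (ra x b # xs)) = emA 1 \<odot> (g (ra x b) \<odot> wd 1 xs) +
       (\<Sum>r<length xs. emA 1 \<odot> (emP (tau l (ra x b)) \<odot> ins r l g 1 xs))"
      unfolding der_wd by (simp only: list.size add_0_right add_Suc_right sum.lessThan_Suc_shift ins.simps list.case)
    also have "\<dots> = g x \<odot> (emA b \<odot> wd 1 xs) + emP (tau l x) \<odot> (emA b \<odot> (\<Sum>r<length xs. ins r l g 1 xs))"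
      by (simp add: GHD(3) [OF GH] tau_ra emP_act tm_assoc additive.sum [OF additive_tm_right])
    also have "emA b \<odot> (\<Sum>r<length xs. ins r l g 1 xs) = der l g (wd b xs)"
      using der_emA_tm [of "wd 1 xs" b] by (simp add: der_wd emA_wd)
    finally show ?thesis by (simp add: 1 emA_wd)
  qed
qed (auto intro!: additiveI simp: tm_add additive.add [OF additive_der])

lemma is_der_der: "is_der l (der l g)"
  unfolding is_der_def
proof (intro conjI allI ballI additive_der der_TT der_emA)
  fix X assume X: "X \<in> TT"
  note add = additive.add [OF additive_der]
  show "der l g (X \<odot> Y) = der l g X \<odot> Y + tt l X \<odot> der l g Y" if Y: "Y \<in> TT" for Y
  proof (rule TT_additive_eq [OF _ _ _ _ X])
    show "der l g (emA a \<odot> Y) = der l g (emA a) \<odot> Y + tt l (emA a) \<odot> der l g Y" for a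
      by (simp add: der_emA_tm [OF Y] der_emA)
    fix a x Z
    assume Z: "Z \<in> TT" and IH: "der l g (Z \<odot> Y) = der l g Z \<odot> Y + tt l Z \<odot> der l g Y"
    show "der l g (emA a \<odot> (emP x \<odot> Z) \<odot> Y) = der l g (emA a \<odot> (emP x \<odot> Z)) \<odot> Y + tt l (emA a \<odot> (emP x \<odot> Z)) \<odot> der l g Y"
      by (simp add: tm_assoc der_emA_tm der_emP_tm Z IH tt_tm tt_emP tm_add add.assoc)
  qed (auto intro!: additiveI simp: tm_add add additive.add [OF additive_tt] algebra_simps)
  show "der l g (tt k X) = sg (k * l) (tt k (der l g X))" for k
  proof (rule TT_additive_eq [OF _ _ _ _ X])
    show "der l g (tt k (emA a)) = sg (k * l) (tt k (der l g (emA a)))" for a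
      by (simp add: der_emA additive.zero [OF additive_tt])
    fix a x Z
    assume Z: "Z \<in> TT" and IH: "der l g (tt k Z) = sg (k * l) (tt k (der l g Z))"
    have gt: "g (tau k x) = sg (k * l) (tt k (g x))"
    proof (rule P_additive_eq [where x = x])
      fix i x assume x: "x \<in> Pc i"
      show "g (tau k x) = sg (k * l) (tt k (g x))"
        using tt_hom [OF GHD(4) [OF GH x]]
        by (simp add: tau_hom [OF x] sg_additive [OF GHD(1) [OF GH]] sg_sg distrib_left)
           (simp add: sg_def)
    qed (auto intro!: additiveI simp: additive.add [OF additive_tau] additive.add [OF GHD(1) [OF GH]] additive.add [OF additive_tt] sg_add)
    show "der l g (tt k (emA a \<odot> (emP x \<odot> Z))) = sg (k * l) (tt k (der l g (emA a \<odot> (emP x \<odot> Z))))"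
      by (simp add: der_emA_tm der_emP_tm Z IH tt_tm tt_emP tm_add tm_sg gt sg_add additive.add [OF additive_tt] GH_TT [OF GH] tau_tau add.commute)
  qed (auto intro!: additiveI simp: tm_add add additive.add [OF additive_tt] sg_add)
qed

text \<open>One factor is replaced by \<open>n\<close> factors. The new exponent
  \<open>m + n - 1\<close> is written with \<open>Suc\<close> to avoid truncated subtraction; this
  excludes only \<open>m = n = 0\<close>.\<close>

lemma der_TH:
  assumes "v \<in> TH m i" "m + n = Suc k" shows "der l g v \<in> TH k (i + l)"
proof (rule additive_TH_mem [OF additive_der subgrp_TH _ assms(1)])
  fix a xs assume "length xs = m" "hl xs i"
  then show "der l g (wd a xs) \<in> TH k (i + l)"
    using assms(2)
  proof (induction xs arbitrary: a m i k)
    case Nil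
    then show ?case by (simp add: der_emA TH_0)
  next
    case (Cons x xs)
    then obtain d where d: "x \<in> Pc d" "hl xs (i - d)" by (auto simp: hl_Cons)
    have k: "k = n + length xs" using Cons.prems by simp
    have 1: "g x \<odot> wd 1 xs \<in> TH k (i + l)"
      using tm_TH [OF GHD(4) [OF GH d(1)] wd_TH [OF refl d(2)], of 1] by (simp add: k algebra_simps)
    have "emP (tau l x) \<odot> der l g (wd 1 xs) \<in> TH k (i + l)"
    proof (cases "k = 0")
      case True
      then show ?thesis using k by (simp add: der_emA TH_0)
    next
      case False
      then obtain k' where "k = Suc k'" by (cases k) auto
      then show ?thesis
        using emP_tm_TH [OF tau_mem [OF d(1)] Cons.IH [OF refl d(2), of k' 1]] k by (simp add: algebra_simps)
    qed
    then have "emA a \<odot> (g x \<odot> wd 1 xs + emP (tau l x) \<odot> der l g (wd 1 xs)) \<in> TH k (i + l)"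
      by (intro emA_tm_TH TH_add 1)
    then show ?case by (subst wd_Cons) (simp add: der_emA_tm der_emP_tm)
  qed
qed

end

context tensor_powers begin

lemma is_der_der: "GH n l g \<Longrightarrow> is_der l (der l g)"
  and der_emP: "GH n l g \<Longrightarrow> der l g (emP x) = g x"
  and der_TH: "GH n l g \<Longrightarrow> v \<in> TH m i \<Longrightarrow> m + n = Suc k \<Longrightarrow> der l g v \<in> TH k (i + l)"
  and der_insV: "GH n l g \<Longrightarrow> v \<in> TN m \<Longrightarrow> der l g v = (\<Sum>r<m. insV r l g v)"
  and der_emP_tm: "GH n l g \<Longrightarrow> v \<in> TT \<Longrightarrow> der l g (emP x \<odot> v) = g x \<odot> v + emP (tau l x) \<odot> der l g v"
  and insV_wd: "GH n l g \<Longrightarrow> insV r l g (wd a xs) = ins r l g a xs"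
  and additive_insV: "GH n l g \<Longrightarrow> additive (insV r l g)"
  by (auto intro!: graded_map.is_der_der graded_map.der_emP graded_map.der_TH graded_map.der_insV
      graded_map.der_emP_tm graded_map.insV_wd graded_map.additive_insV
      simp: graded_map_def graded_map_axioms_def tensor_powers_axioms)

end

section \<open>Sums over triples of indices with a fixed total\<close>

definition tri :: "nat \<Rightarrow> (nat \<Rightarrow> nat \<Rightarrow> nat \<Rightarrow> 'g::ab_group_add) \<Rightarrow> 'g" where
  "tri M f = (\<Sum>i\<le>M. \<Sum>j\<le>M - i. f i j (M - i - j))"

lemma tri_swap12:
  fixes f :: "nat \<Rightarrow> nat \<Rightarrow> nat \<Rightarrow> 'g::ab_group_add"
  shows "tri M f = tri M (\<lambda>i j k. f j i k)"
proof -
  have "tri M f = (\<Sum>(i, j)\<in>Sigma {..M} (\<lambda>i. {..M - i}). f i j (M - i - j))" for f :: "nat \<Rightarrow> nat \<Rightarrow> nat \<Rightarrow> 'g"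
    unfolding tri_def by (rule sum.Sigma) auto
  moreover have "(\<Sum>(i, j)\<in>Sigma {..M} (\<lambda>i. {..M - i}). f i j (M - i - j)) =
      (\<Sum>(i, j)\<in>Sigma {..M} (\<lambda>i. {..M - i}). f j i (M - i - j))"
    by (rule sum.reindex_bij_witness [where i = prod.swap and j = prod.swap]) (auto simp: diff_commute add.commute)
  ultimately show ?thesis by metis
qed

lemma sum_reverse: "(\<Sum>j\<le>n. f j (n - j)) = (\<Sum>j\<le>(n::nat). f (n - j) j)"
  by (rule sum.reindex_bij_witness [where i = "\<lambda>j. n - j" and j = "\<lambda>j. n - j"]) auto

lemma tri_swap23: "tri M f = tri M (\<lambda>i j k. f i k j)"
  unfolding tri_def by (rule sum.cong [OF refl]) (rule sum_reverse)

lemma tri_rotate: "tri M f = tri M (\<lambda>i j k. f j k i)"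
  by (subst tri_swap23, subst tri_swap12) (rule refl)

section \<open>The codifferential as a square-zero derivation, and the error of a
  coderivation\<close>

context tensor_powers
begin

lemma der_plus:
  assumes g: "GH n l g" and h: "GH n l h" and v: "v \<in> TT"
  shows "der l (\<lambda>x. g x + h x) v = der l g v + der l h v"
  by (rule is_der_eq [OF is_der_der [OF GH_plus [OF g h]] is_der_plus [OF is_der_der [OF g] is_der_der [OF h]] _ v])
     (simp add: der_emP [OF g] der_emP [OF h] der_emP [OF GH_plus [OF g h]])

lemma der_0: "v \<in> TT \<Longrightarrow> der l (\<lambda>x. 0) v = 0"
  by (rule is_der_eq_0 [OF is_der_der [OF GH_0]]) (simp_all add: der_emP [OF GH_0])

end

text \<open>\<open>D n\<close> encodes \<open>\<delta>\<^sub>n\<close>. The relations are indexed by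
  the sum of the two arities, one more than the tensor exponent: \<open>M = N + 1\<close> is the
  relation for \<open>N\<close> in \<open>ainf_coalgebra\<close>.\<close>

locale codifferential = tensor_powers s P
  for s :: "'k::field \<Rightarrow> 'a::{ring,monoid_mult} \<Rightarrow> 'a" and P :: "('a, 'p::ab_group_add) gbimod" +
  fixes D :: "nat \<Rightarrow> 'p \<Rightarrow> ('k, 'a, 'p) tv"
  assumes D: "GH n 1 (D n)" and D_0: "D 0 x = 0"
    and D_D: "(\<Sum>i\<le>M. der 1 (D i) (D (M - i) x)) = 0"
begin

abbreviation dD where "dD i \<equiv> der 1 (D i)"

lemmas is_der_dD = is_der_der [OF D]
lemmas dD_simps [simp] = is_derD(2,3) [OF is_der_dD] additive.zero [OF is_derD(1) [OF is_der_dD]]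
lemmas dD_add = additive.add [OF is_derD(1) [OF is_der_dD]]
lemmas dD_diff = additive.diff [OF is_derD(1) [OF is_der_dD]]
lemmas dD_sum = additive.sum [OF is_derD(1) [OF is_der_dD]]
lemmas dD_sg = sg_additive [OF is_derD(1) [OF is_der_dD]]
lemmas dD_emP = der_emP [OF D]

lemma dD_0: "v \<in> TT \<Longrightarrow> dD 0 v = 0"
  by (rule is_der_eq_0 [OF is_der_dD]) (simp_all add: dD_emP D_0)

text \<open>The square of an odd derivation is a derivation, so it is enough that it vanishes on
  \<open>P\<close>. For components the mixed terms cancel only after summation, by exchanging the
  two indices.\<close>

lemma dD_dD:
  assumes "v \<in> TT" shows "(\<Sum>i\<le>M. dD i (dD (M - i) v)) = 0"
proof (rule is_der_eq_0 [of 2 "\<lambda>v. \<Sum>i\<le>M. dD i (dD (M - i) v)", OF _ _ assms])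
  show "(\<Sum>i\<le>M. dD i (dD (M - i) (emP x))) = 0" for x by (simp add: dD_emP D_D)
  show "is_der 2 (\<lambda>v. \<Sum>i\<le>M. dD i (dD (M - i) v))"
    unfolding is_der_def
  proof (intro conjI allI ballI)
    show "additive (\<lambda>v. \<Sum>i\<le>M. dD i (dD (M - i) v))"
      by (auto intro!: additiveI simp: dD_add sum.distrib)
    show "(\<Sum>i\<le>M. dD i (dD (M - i) v)) \<in> TT" for v by (simp add: subgrp_sum [OF subgrp_spn])
    show "(\<Sum>i\<le>M. dD i (dD (M - i) (emA a))) = 0" for a by simp
    fix X assume X: "X \<in> TT"
    show "(\<Sum>i\<le>M. dD i (dD (M - i) (tt k X))) = sg (k * 2) (tt k (\<Sum>i\<le>M. dD i (dD (M - i) X)))" for k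
      by (simp add: X is_derD(5) [OF is_der_dD] dD_sg sg_sg sg_sum additive.sum [OF additive_tt])
         (simp add: sg_def)
    fix Y assume Y: "Y \<in> TT"
    have 1: "dD i (dD (M - i) (X \<odot> Y)) = dD i (dD (M - i) X) \<odot> Y + tt 2 X \<odot> dD i (dD (M - i) Y)
        + (tt 1 (dD (M - i) X) \<odot> dD i Y - tt 1 (dD i X) \<odot> dD (M - i) Y)" for i
      by (simp add: X Y is_derD(4,5) [OF is_der_dD] dD_add tt_tt algebra_simps)
    have "(\<Sum>i\<le>M. tt 1 (dD (M - i) X) \<odot> dD i Y) = (\<Sum>i\<le>M. tt 1 (dD i X) \<odot> dD (M - i) Y)"
      by (rule sum_reverse [symmetric, of "\<lambda>i j. tt 1 (dD i X) \<odot> dD j Y"])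
    then show "(\<Sum>i\<le>M. dD i (dD (M - i) (X \<odot> Y))) =
        (\<Sum>i\<le>M. dD i (dD (M - i) X)) \<odot> Y + tt 2 X \<odot> (\<Sum>i\<le>M. dD i (dD (M - i) Y))"
      unfolding 1 by (simp add: sum.distrib sum_subtractf additive.sum [OF additive_tm_left] additive.sum [OF additive_tm_right])
  qed
qed

text \<open>
  The defect of the coderivation equation in tensor power \<open>N\<close> is \<open>Err l \<alpha> (N + 1)\<close>; \<open>Ecal\<close> is the
  derivation extending it.
\<close>

definition Ecal :: "int \<Rightarrow> (nat \<Rightarrow> 'p \<Rightarrow> ('k, 'a, 'p) tv) \<Rightarrow> nat \<Rightarrow> ('k, 'a, 'p) tv \<Rightarrow> ('k, 'a, 'p) tv" where
  "Ecal l \<alpha> M v = (\<Sum>i\<le>M. dD i (der l (\<alpha> (M - i)) v) - sg l (der l (\<alpha> (M - i)) (dD i v)))"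

definition Err :: "int \<Rightarrow> (nat \<Rightarrow> 'p \<Rightarrow> ('k, 'a, 'p) tv) \<Rightarrow> nat \<Rightarrow> 'p \<Rightarrow> ('k, 'a, 'p) tv" where
  "Err l \<alpha> M x = (\<Sum>i\<le>M. dD i (\<alpha> (M - i) x) - sg l (der l (\<alpha> (M - i)) (D i x)))"

lemma is_der_Ecal:
  assumes "\<And>n. GH n l (\<alpha> n)" shows "is_der (1 + l) (Ecal l \<alpha> M)"
proof -
  have "is_der (1 + l) (\<lambda>v. \<Sum>i\<in>{..M}. dD i (der l (\<alpha> (M - i)) v) - sg (1 * l) (der l (\<alpha> (M - i)) (dD i v)))"
    by (rule is_der_sum) (simp_all only: finite_atMost is_der_commutator [OF is_der_dD is_der_der [OF assms]])
  then show ?thesis by (simp add: Ecal_def [abs_def])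
qed

lemma Ecal_emP:
  assumes \<alpha>: "\<And>n. GH n l (\<alpha> n)" shows "Ecal l \<alpha> M (emP x) = Err l \<alpha> M x"
  by (simp add: Ecal_def Err_def der_emP [OF \<alpha>] dD_emP)

lemma GH_Err:
  assumes \<alpha>: "\<And>n. GH n l (\<alpha> n)" shows "GH n (1 + l) (Err l \<alpha> (Suc n))"
  unfolding GH_def
proof (intro conjI allI ballI)
  let ?K = "Ecal l \<alpha> (Suc n)"
  note K = is_der_Ecal [OF \<alpha>, of "Suc n"]
  note e = Ecal_emP [OF \<alpha>, symmetric]
  show "additive (Err l \<alpha> (Suc n))"
    by (auto intro!: additiveI simp: e additive.add [OF additive_emP] additive.add [OF is_derD(1) [OF K]])
  show "Err l \<alpha> (Suc n) (la a x) = emA a \<odot> Err l \<alpha> (Suc n) x"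
     "Err l \<alpha> (Suc n) (ra x a) = Err l \<alpha> (Suc n) x \<odot> emA a" for a x
    by (simp_all add: e emP_act is_der_emA [OF K])
  fix i x assume x: "x \<in> Pc i"
  show "Err l \<alpha> (Suc n) x \<in> TH n (i + (1 + l))"
    unfolding Err_def
  proof (intro TH_sum TH_diff TH_sg)
    fix j assume "j \<in> {..Suc n}"
    then show "dD j (\<alpha> (Suc n - j) x) \<in> TH n (i + (1 + l))" "der l (\<alpha> (Suc n - j)) (D j x) \<in> TH n (i + (1 + l))"
      using der_TH [OF D GHD(4) [OF \<alpha> x], of "Suc n - j" j n] der_TH [OF \<alpha> GHD(4) [OF D x], of j "Suc n - j" n]
      by (auto simp: algebra_simps)
  qed
qed

lemma Ecal_eq_der:
  assumes \<alpha>: "\<And>n. GH n l (\<alpha> n)" and v: "v \<in> TT"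
  shows "Ecal l \<alpha> (Suc n) v = der (1 + l) (Err l \<alpha> (Suc n)) v"
  by (rule is_der_eq [OF is_der_Ecal [OF \<alpha>] is_der_der [OF GH_Err [OF \<alpha>]] _ v])
     (simp add: Ecal_emP [OF \<alpha>] der_emP [OF GH_Err [OF \<alpha>]])

lemma Ecal_0:
  assumes \<alpha>: "\<And>n. GH n l (\<alpha> n)" and z: "\<And>x. Err l \<alpha> M x = 0" and v: "v \<in> TT"
  shows "Ecal l \<alpha> M v = 0"
  by (rule is_der_eq_0 [OF is_der_Ecal [OF \<alpha>] _ v]) (simp add: Ecal_emP [OF \<alpha>] z)

text \<open>The graded commutator with the square-zero derivation \<open>dD\<close> squares to zero.\<close>

lemma bianchi:
  assumes \<alpha>: "\<And>n. GH n l (\<alpha> n)" and v: "v \<in> TT"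
  shows "(\<Sum>i\<le>M. dD i (Ecal l \<alpha> (M - i) v) + sg l (Ecal l \<alpha> (M - i) (dD i v))) = 0"
proof -
  define A where "A i = der l (\<alpha> i)" for i
  note A = is_der_der [OF \<alpha>, folded A_def]
  have sum: "A u (sum f I) = (\<Sum>i\<in>I. A u (f i))" for u f and I :: "nat set"
    by (rule additive.sum [OF is_derD(1) [OF A]])
  have 0: "A u 0 = 0" for u by (rule additive.zero [OF is_derD(1) [OF A]])
  have "(\<Sum>i\<le>M. dD i (Ecal l \<alpha> (M - i) v) + sg l (Ecal l \<alpha> (M - i) (dD i v))) =
    tri M (\<lambda>i j k. dD i (dD j (A k v))) - sg l (tri M (\<lambda>i j k. dD i (A k (dD j v))))
    + sg l (tri M (\<lambda>i j k. dD j (A k (dD i v)))) - tri M (\<lambda>i j k. A k (dD j (dD i v)))"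
    unfolding tri_def Ecal_def A_def [symmetric]
    by (simp add: dD_sum dD_diff dD_sg sg_sum sg_diff sum.distrib sum_subtractf)
  \<comment> \<open>The two sums with \<open>A\<close> between the codifferentials cancel by
    symmetry; in the other two the codifferentials are adjacent and \<open>dD_dD\<close> applies
    after rotating the indices.\<close>
  also have "tri M (\<lambda>i j k. dD i (A k (dD j v))) = tri M (\<lambda>i j k. dD j (A k (dD i v)))"
    by (rule tri_swap12)
  also have "tri M (\<lambda>i j k. dD i (dD j (A k v))) = 0"
    by (subst tri_rotate) (simp add: tri_def dD_dD is_derD(2) [OF A] del: diff_diff_left)
  also have "tri M (\<lambda>i j k. A k (dD j (dD i v))) = tri M (\<lambda>i j k. A k (dD i (dD j v)))"
    by (rule tri_swap12)
  also have "\<dots> = tri M (\<lambda>i j k. A i (dD j (dD k v)))"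
    by (rule tri_rotate)
  also have "\<dots> = 0"
    by (simp add: tri_def sum [symmetric] dD_dD [OF v] 0 del: diff_diff_left)
  finally show ?thesis by simp
qed

lemma Err_plus:
  assumes \<alpha>: "\<And>n. GH n l (\<alpha> n)" and \<beta>: "\<And>n. GH n l (\<beta> n)"
  shows "Err l (\<lambda>j x. \<alpha> j x + \<beta> j x) M x = Err l \<alpha> M x + Err l \<beta> M x"
  unfolding Err_def
  by (simp add: der_plus [OF \<alpha> \<beta> GH_TT [OF D]] dD_add sg_add sum.distrib sum_subtractf algebra_simps)

lemma Err_single:
  assumes "GH n l \<gamma>"
  shows "Err l (\<lambda>j x. if j = n then \<gamma> x else 0) M x =
    (if n \<le> M then dD (M - n) (\<gamma> x) - sg l (der l \<gamma> (D (M - n) x)) else 0)"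
proof -
  have "Err l (\<lambda>j x. if j = n then \<gamma> x else 0) M x =
    (\<Sum>i\<le>M. if M - i = n then dD (M - n) (\<gamma> x) - sg l (der l \<gamma> (D (M - n) x)) else 0)"
    unfolding Err_def
    by (rule sum.cong [OF refl]) (auto simp: der_0 [OF GH_TT [OF D]])
  also have "\<dots> = (\<Sum>i\<in>{i. i \<le> M \<and> M - i = n}. dD (M - n) (\<gamma> x) - sg l (der l \<gamma> (D (M - n) x)))"
    by (rule sum.mono_neutral_cong_right) auto
  also have "{i. i \<le> M \<and> M - i = n} = (if n \<le> M then {M - n} else {})" by auto
  finally show ?thesis by simp
qed

lemma GH_single: "GH n l \<gamma> \<Longrightarrow> GH j l (\<lambda>x. if j = n then \<gamma> x else 0)"
  by (cases "j = n") (auto simp: GH_0)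

lemma Err_cong: "(\<And>j. j \<le> M \<Longrightarrow> \<alpha> j = \<beta> j) \<Longrightarrow> Err l \<alpha> M x = Err l \<beta> M x"
  by (simp add: Err_def)

end

section \<open>Cosets of subgroups\<close>

lemma subgrp_group_closure: "subgrp (group_closure S)"
  by (simp add: subgrp_def group_closure.diff)

lemma coset_eq_iff:
  assumes "subgrp H" shows "u +o H = v +o H \<longleftrightarrow> u - v \<in> H"
proof
  assume *: "u +o H = v +o H"
  have "u + 0 \<in> u +o H" using subgrp_0 [OF assms] by (rule set_plus_intro2)
  then show "u - v \<in> H" using * set_plus_imp_minus by auto
next
  assume *: "u - v \<in> H"
  show "u +o H = v +o H"
  proof (intro set_eqI iffI)
    fix x assume "x \<in> u +o H"
    then have "(x - u) + (u - v) \<in> H" using * set_plus_imp_minus subgrp_add [OF assms] by blast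
    then show "x \<in> v +o H" by (intro set_minus_imp_plus) simp
  next
    fix x assume "x \<in> v +o H"
    then have "(x - v) - (u - v) \<in> H" using * set_plus_imp_minus subgrp_diff [OF assms] by blast
    then show "x \<in> u +o H" by (intro set_minus_imp_plus) simp
  qed
qed

lemma coset_mem: "subgrp H \<Longrightarrow> x \<in> u +o H \<longleftrightarrow> x - u \<in> H"
  using set_minus_plus by auto

lemma coset_add:
  assumes "subgrp H" shows "(u +o H) + (v +o H) = (u + v) +o H"
proof -
  have "H + H = H"
    using subgrp_add [OF assms] subgrp_0 [OF assms] unfolding set_plus_def by force
  then show ?thesis by (simp add: set_plus_rearrange)
qed

text \<open>For actions defined as unions over representatives, as in \<open>free_bimod\<close>:
  since \<open>f\<close> respects the subgroups, all members of the union are the same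
  coset.\<close>

lemma coset_Union:
  assumes H: "subgrp H" "subgrp H'" and f: "additive f" "\<And>x. x \<in> H \<Longrightarrow> f x \<in> H'"
  shows "(\<Union>x\<in>u +o H. f x +o H') = f u +o H'"
proof -
  have "f x +o H' = f u +o H'" if "x \<in> u +o H" for x
    using that f(2) [of "x - u"] by (simp add: coset_mem [OF H(1)] coset_eq_iff [OF H(2)] additive.diff [OF f(1)])
  moreover have "u \<in> u +o H" by (simp add: coset_mem [OF H(1)] subgrp_0 [OF H(1)])
  ultimately show ?thesis by blast
qed

context tensor_powers
begin

subsection \<open>Lifting along projective bimodules\<close>

abbreviation FF :: "(('a \<times> 'p \<times> 'a) \<Rightarrow>\<^sub>0 int) set" where "FF \<equiv> group_closure (free_rel s)"

definition fl :: "'a \<Rightarrow> (('a \<times> 'p \<times> 'a) \<Rightarrow>\<^sub>0 int) \<Rightarrow> (('a \<times> 'p \<times> 'a) \<Rightarrow>\<^sub>0 int)" where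
  "fl x = frag_extend (\<lambda>(a, b, c). frag_of (x * a, b, c))"
definition fr :: "'a \<Rightarrow> (('a \<times> 'p \<times> 'a) \<Rightarrow>\<^sub>0 int) \<Rightarrow> (('a \<times> 'p \<times> 'a) \<Rightarrow>\<^sub>0 int)" where
  "fr x = frag_extend (\<lambda>(a, b, c). frag_of (a, b, c * x))"

lemma fl_FF: assumes "u \<in> FF" shows "fl x u \<in> FF"
proof (rule group_closure_additive [OF _ _ assms])
  show "additive (fl x)" unfolding fl_def by (rule additive_frag_extend)
  fix r :: "('a \<times> 'p \<times> 'a) \<Rightarrow>\<^sub>0 int" assume "r \<in> free_rel s"
  then show "fl x r \<in> FF"
    by (cases rule: free_rel.cases)
       (auto simp: fl_def frag_extend_diff distrib_left s_right [symmetric] intro!: group_closure.base free_rel.intros)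
qed

lemma fr_FF: assumes "u \<in> FF" shows "fr x u \<in> FF"
proof (rule group_closure_additive [OF _ _ assms])
  show "additive (fr x)" unfolding fr_def by (rule additive_frag_extend)
  fix r :: "('a \<times> 'p \<times> 'a) \<Rightarrow>\<^sub>0 int" assume "r \<in> free_rel s"
  then show "fr x r \<in> FF"
    by (cases rule: free_rel.cases)
       (auto simp: fr_def frag_extend_diff distrib_right s_left [symmetric] intro!: group_closure.base free_rel.intros)
qed

lemma additive_fl: "additive (fl x)" and additive_fr: "additive (fr x)"
  unfolding fl_def fr_def by (rule additive_frag_extend)+

text \<open>The dual basis lemma in coordinates: \<open>p b\<close> is the image of the generator
  with index \<open>b\<close>, and \<open>J x\<close> is a formal sum representing the image of
  \<open>x\<close> in the free module. Representatives are chosen separately for each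
  \<open>x\<close>, hence \<open>J\<close> is linear only modulo the relations.\<close>

lemma dual_basis:
  assumes "projective_bimod s (P\<lparr>carrier := Pc i\<rparr>)"
  obtains p J where
    "\<And>b. p b \<in> Pc i"
    "\<And>x. x \<in> Pc i \<Longrightarrow> x = frag_sum (\<lambda>(a, b, c). la a (ra (p b) c)) (J x)"
    "\<And>x y. x \<in> Pc i \<Longrightarrow> y \<in> Pc i \<Longrightarrow> J (x + y) - (J x + J y) \<in> FF"
    "\<And>x a. x \<in> Pc i \<Longrightarrow> J (la a x) - fl a (J x) \<in> FF"
    "\<And>x a. x \<in> Pc i \<Longrightarrow> J (ra x a) - fr a (J x) \<in> FF"
proof -
  let ?M = "P\<lparr>carrier := Pc i\<rparr>"
  obtain B :: "'p set" and \<iota> \<pi> where \<iota>: "bimod_hom ?M (free_bimod s B) \<iota>" and \<pi>: "bimod_hom (free_bimod s B) ?M \<pi>"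
    and \<pi>\<iota>: "\<And>x. x \<in> Pc i \<Longrightarrow> \<pi> (\<iota> x) = x"
    using assms unfolding projective_bimod_def by auto
  note H = subgrp_group_closure [of "free_rel s :: (('a \<times> 'p \<times> 'a) \<Rightarrow>\<^sub>0 int) set"]
  let ?W = "UNIV \<times> B \<times> (UNIV :: 'a set)"
  have carr: "carrier (free_bimod s B) = {u +o FF | u. Poly_Mapping.keys u \<subseteq> ?W}"
    and lactF: "lact (free_bimod s B) x (u +o FF) = fl x u +o FF"
    and ractF: "ract (free_bimod s B) (u +o FF) x = fr x u +o FF" for x u
    using coset_Union [OF H H additive_fl fl_FF] coset_Union [OF H H additive_fr fr_FF]
    by (simp_all add: free_bimod_def Let_def fl_def fr_def)
  define J where "J x = (SOME u. \<iota> x = u +o FF \<and> Poly_Mapping.keys u \<subseteq> ?W)" for x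
  have "\<exists>u. \<iota> x = u +o FF \<and> Poly_Mapping.keys u \<subseteq> ?W" if "x \<in> Pc i" for x
    using \<iota> that unfolding bimod_hom_def carr by auto
  then have J: "\<iota> x = J x +o FF" "Poly_Mapping.keys (J x) \<subseteq> ?W" if "x \<in> Pc i" for x
    unfolding J_def using that by (metis (mono_tags, lifting) someI_ex)+
  have pi: "\<pi> (u +o FF) \<in> Pc i" if "Poly_Mapping.keys u \<subseteq> ?W" for u
    using \<pi> that unfolding bimod_hom_def carr by auto
  have pi_add: "\<pi> (u +o FF) + \<pi> (v +o FF) = \<pi> ((u + v) +o FF)"
    if "Poly_Mapping.keys u \<subseteq> ?W" "Poly_Mapping.keys v \<subseteq> ?W" for u v
  proof -
    have "u +o FF \<in> carrier (free_bimod s B)" "v +o FF \<in> carrier (free_bimod s B)"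
      using that unfolding carr by blast+
    then have "\<pi> (u +o FF + (v +o FF)) = \<pi> (u +o FF) + \<pi> (v +o FF)"
      using \<pi> unfolding bimod_hom_def by blast
    then show ?thesis by (simp only: coset_add [OF H])
  qed
  have pi_l: "\<pi> (fl a u +o FF) = la a (\<pi> (u +o FF))" and pi_r: "\<pi> (fr a u +o FF) = ra (\<pi> (u +o FF)) a"
    if "Poly_Mapping.keys u \<subseteq> ?W" for a u
  proof -
    have u: "u +o FF \<in> carrier (free_bimod s B)" using that unfolding carr by blast
    have "\<pi> (lact (free_bimod s B) a (u +o FF)) = lact ?M a (\<pi> (u +o FF))"
      "\<pi> (ract (free_bimod s B) (u +o FF) a) = ract ?M (\<pi> (u +o FF)) a"
      using \<pi> u unfolding bimod_hom_def by blast+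
    then show "\<pi> (fl a u +o FF) = la a (\<pi> (u +o FF))" "\<pi> (fr a u +o FF) = ra (\<pi> (u +o FF)) a"
      by (simp_all add: lactF ractF)
  qed
  \<comment> \<open>No formal sum considered here has a key with index outside \<open>B\<close>; the
    value 0 there keeps \<open>p b\<close> in \<open>Pc i\<close>.\<close>
  define p where "p b = (if b \<in> B then \<pi> (frag_of (1, b, 1) +o FF) else 0)" for b
  have p: "p b \<in> Pc i" for b
    using pi [of "frag_of (1, b, 1)"] subgrp_0 [OF Pc_subgrp] by (simp add: p_def)
  have pi_sum: "\<pi> (u +o FF) = frag_sum (\<lambda>(a, b, c). la a (ra (p b) c)) u" if "Poly_Mapping.keys u \<subseteq> ?W" for u
  proof -
    \<comment> \<open>The bound on the keys is carried through the induction because \<pi> is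
      additive only on the carrier.\<close>
    have "Poly_Mapping.keys u \<subseteq> ?W \<and> \<pi> (u +o FF) = frag_sum (\<lambda>(a, b, c). la a (ra (p b) c)) u"
      using that
    proof (induction u rule: frag_induction)
      case zero
      show ?case using pi_add [of 0 0] by (simp add: frag_sum.zero)
    next
      case (one w)
      obtain a b c where w: "w = (a, b, c)" by (cases w)
      have "\<pi> (frag_of (a, b, c) +o FF) = la a (\<pi> (frag_of (1, b, c) +o FF))"
        using pi_l [of "frag_of (1, b, c)" a] one by (simp add: w fl_def)
      also have "\<pi> (frag_of (1, b, c) +o FF) = ra (p b) c"
        using pi_r [of "frag_of (1, b, 1)" c] one by (simp add: w fr_def p_def)
      finally show ?case using one by (simp add: w)
    next
      case (diff u v)
      then have k: "Poly_Mapping.keys (u - v) \<subseteq> ?W"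
        by (intro order_trans [OF keys_diff] Un_least) auto
      have "\<pi> ((u - v) +o FF) + \<pi> (v +o FF) = \<pi> (u +o FF)"
        using pi_add [OF k, of v] diff by (simp only: diff_add_cancel)
      then have "\<pi> ((u - v) +o FF) = \<pi> (u +o FF) - \<pi> (v +o FF)" by (simp only: eq_diff_eq)
      with diff k show ?case by (simp only: frag_sum.diff)
    qed
    then show ?thesis ..
  qed
  show thesis
  proof (rule that [of p J])
    show "p b \<in> Pc i" for b by (rule p)
    fix x assume x: "x \<in> Pc i"
    show "x = frag_sum (\<lambda>(a, b, c). la a (ra (p b) c)) (J x)"
      using \<pi>\<iota> [OF x] pi_sum [OF J(2) [OF x]] J(1) [OF x] by simp
    have xM: "x \<in> carrier ?M" using x by simp
    have "\<iota> (lact ?M a x) = lact (free_bimod s B) a (\<iota> x)"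
      "\<iota> (ract ?M x a) = ract (free_bimod s B) (\<iota> x) a" for a
      using \<iota> xM unfolding bimod_hom_def by blast+
    then have "\<iota> (la a x) = fl a (J x) +o FF" "\<iota> (ra x a) = fr a (J x) +o FF" for a
      by (simp_all add: J(1) [OF x] lactF ractF)
    then show "J (la a x) - fl a (J x) \<in> FF" "J (ra x a) - fr a (J x) \<in> FF" for a
      using J(1) [OF Pc_la [OF x]] J(1) [OF Pc_ra [OF x]]
      unfolding coset_eq_iff [OF H, symmetric] by metis+
    fix y assume y: "y \<in> Pc i"
    have "\<iota> (x + y) = \<iota> x + \<iota> y"
      using \<iota> xM y unfolding bimod_hom_def by auto
    then show "J (x + y) - (J x + J y) \<in> FF"
      using J(1) [OF subgrp_add [OF Pc_subgrp x y]]
      unfolding coset_eq_iff [OF H, symmetric] J(1) [OF x] J(1) [OF y] coset_add [OF H] by simp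
  qed
qed

text \<open>With \<open>E = {}\<close> these are the right module maps, which the contraction of \<open>P\<close> requires.\<close>

definition lin :: "'a set \<Rightarrow> ('a \<Rightarrow> 'g \<Rightarrow> 'g) \<Rightarrow> ('a \<Rightarrow> 'g \<Rightarrow> 'g) \<Rightarrow> ('p \<Rightarrow> 'g::ab_group_add) \<Rightarrow> bool" where
  "lin E lg rg g \<longleftrightarrow> additive g \<and> (\<forall>x c. g (ra x c) = rg c (g x)) \<and> (\<forall>e\<in>E. \<forall>x. g (la e x) = lg e (g x))"

lemma dec_la: "dec (la a x) i = la a (dec x i)"
  by (rule P_additive_eq [where x = x])
     (auto intro!: additiveI simp: act dec_add dec_hom dec_hom [OF Pc_la] additive.zero [OF additive_la])
lemma dec_ra: "dec (ra x a) i = ra (dec x i) a"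
  by (rule P_additive_eq [where x = x])
     (auto intro!: additiveI simp: act dec_add dec_hom dec_hom [OF Pc_ra] additive.zero [OF additive_ra])

text \<open>On the free module the lift sends \<open>a \<otimes> c\<close> in the copy
  \<open>b\<close> to \<open>rg c (\<Lambda> b a)\<close>. The conditions on \<Lambda> say that this
  is additive, balanced over the ground field, and left linear for scalars in \<open>E\<close>. Such
  a \<Lambda> arises differently for bimodule maps and for right module maps, so it is a
  hypothesis.\<close>

lemma projective_lift:
  fixes G :: "'g::ab_group_add \<Rightarrow> 'h::ab_group_add"
  assumes proj: "projective_bimod s (P\<lparr>carrier := Pc i\<rparr>)"
    and phi: "additive \<phi>" "\<And>x c. \<phi> (ra x c) = rh c (\<phi> x)"
    and G: "additive G" "\<And>c y. y \<in> Y \<Longrightarrow> G (rg c y) = rh c (G y)"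
    and rg: "\<And>c. additive (rg c)" "\<And>b c y. rg (b + c) y = rg b y + rg c y" "\<And>b c y. rg (b * c) y = rg c (rg b y)"
    and Y: "subgrp Y" "\<And>c y. y \<in> Y \<Longrightarrow> rg c y \<in> Y"
    and lg: "\<And>e. additive (lg e)" "\<And>e c y. lg e (rg c y) = rg c (lg e y)"
    and Lam: "\<And>p :: 'p \<Rightarrow> 'p. (\<And>b. p b \<in> Pc i) \<Longrightarrow> \<exists>\<Lambda>. \<forall>b. (\<forall>a. \<Lambda> b a \<in> Y \<and> G (\<Lambda> b a) = \<phi> (la a (p b))) \<and>
       (\<forall>a a'. \<Lambda> b (a + a') = \<Lambda> b a + \<Lambda> b a') \<and> (\<forall>k a c. rg c (\<Lambda> b (s k a)) = rg (s k c) (\<Lambda> b a)) \<and>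
       (\<forall>e\<in>E. \<forall>a. \<Lambda> b (e * a) = lg e (\<Lambda> b a))"
  shows "\<exists>\<gamma>. lin E lg rg \<gamma> \<and> (\<forall>x. \<gamma> x \<in> Y) \<and> (\<forall>x\<in>Pc i. G (\<gamma> x) = \<phi> x) \<and> (\<forall>j x. j \<noteq> i \<longrightarrow> x \<in> Pc j \<longrightarrow> \<gamma> x = 0)"
proof -
  obtain p J where p: "\<And>b. p b \<in> Pc i"
    and J: "\<And>x. x \<in> Pc i \<Longrightarrow> x = frag_sum (\<lambda>(a, b, c). la a (ra (p b) c)) (J x)"
    and J_add: "\<And>x y. x \<in> Pc i \<Longrightarrow> y \<in> Pc i \<Longrightarrow> J (x + y) - (J x + J y) \<in> FF"
    and J_la: "\<And>x a. x \<in> Pc i \<Longrightarrow> J (la a x) - fl a (J x) \<in> FF"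
    and J_ra: "\<And>x a. x \<in> Pc i \<Longrightarrow> J (ra x a) - fr a (J x) \<in> FF"
    using dual_basis [OF proj] by metis
  from Lam [of p, OF p] obtain \<Lambda> where
    L: "\<And>b a. \<Lambda> b a \<in> Y" "\<And>b a. G (\<Lambda> b a) = \<phi> (la a (p b))" "\<And>b a a'. \<Lambda> b (a + a') = \<Lambda> b a + \<Lambda> b a'"
      "\<And>b k a c. rg c (\<Lambda> b (s k a)) = rg (s k c) (\<Lambda> b a)" "\<And>b e a. e \<in> E \<Longrightarrow> \<Lambda> b (e * a) = lg e (\<Lambda> b a)"
    by blast
  define T where "T = frag_sum (\<lambda>(a, b, c). rg c (\<Lambda> b a))"
  have T_add: "additive T" unfolding T_def by (rule frag_sum.additive_axioms)
  have T_FF: "T u = 0" if "u \<in> FF" for u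
    unfolding T_def
  proof (rule group_closure_additive_zero [OF frag_sum.additive_axioms _ that])
    fix r :: "('a \<times> 'p \<times> 'a) \<Rightarrow>\<^sub>0 int" assume "r \<in> free_rel s"
    then show "frag_sum (\<lambda>(a, b, c). rg c (\<Lambda> b a)) r = 0"
      by (cases rule: free_rel.cases) (simp_all add: frag_sum.diff L rg additive.add [OF rg(1)])
  qed
  have T_eq: "T u = T v" if "u - v \<in> FF" for u v
    using T_FF [OF that] by (simp add: additive.diff [OF T_add])
  have T_fr: "T (fr c u) = rg c (T u)" for c u
  proof -
    have "Poly_Mapping.keys u \<subseteq> UNIV" by simp
    then show ?thesis
      by (induction u rule: frag_induction)
         (auto simp: T_def fr_def frag_sum.zero frag_sum.diff frag_extend_diff
           additive.zero [OF rg(1)] additive.diff [OF rg(1)] rg(3))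
  qed
  have T_fl: "T (fl e u) = lg e (T u)" if "e \<in> E" for e u
  proof -
    have "Poly_Mapping.keys u \<subseteq> UNIV" by simp
    then show ?thesis
      by (induction u rule: frag_induction)
         (auto simp: T_def fl_def frag_sum.zero frag_sum.diff frag_extend_diff
           additive.zero [OF lg(1)] additive.diff [OF lg(1)] lg(2) L(5) that)
  qed
  have GT: "G (T u) = \<phi> (frag_sum (\<lambda>(a, b, c). la a (ra (p b) c)) u)" for u
  proof -
    have "Poly_Mapping.keys u \<subseteq> UNIV" by simp
    then show ?thesis
    proof (induction u rule: frag_induction)
      case zero
      show ?case by (simp add: T_def frag_sum.zero additive.zero [OF G(1)] additive.zero [OF phi(1)])
    next
      case (one w)
      then show ?case by (cases w) (simp add: T_def G(2) L phi(2) [symmetric] act)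
    next
      case (diff u v)
      then show ?case
        by (simp add: T_def frag_sum.diff additive.diff [OF G(1)] additive.diff [OF phi(1)])
    qed
  qed
  define \<gamma> where "\<gamma> x = T (J (dec x i))" for x
  show ?thesis
  proof (intro exI conjI allI ballI impI)
    show "lin E lg rg \<gamma>" unfolding lin_def
    proof (intro conjI ballI allI)
      show "additive \<gamma>"
        using T_eq [OF J_add [OF dec_mem dec_mem]] by (auto intro!: additiveI simp: \<gamma>_def dec_add additive.add [OF T_add])
      show "\<gamma> (ra x c) = rg c (\<gamma> x)" for x c
        using T_eq [OF J_ra [OF dec_mem]] by (simp add: \<gamma>_def dec_ra T_fr)
      show "\<gamma> (la e x) = lg e (\<gamma> x)" if "e \<in> E" for x e
        using T_eq [OF J_la [OF dec_mem]] that by (simp add: \<gamma>_def dec_la T_fl)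
    qed
    show "\<gamma> x \<in> Y" for x
      unfolding \<gamma>_def T_def by (rule frag_sum_mem [OF Y(1)]) (auto simp: L Y(2))
    show "G (\<gamma> x) = \<phi> x" if "x \<in> Pc i" for x
      using GT [of "J x"] J [OF that] by (simp add: \<gamma>_def dec_hom [OF that])
    have "T (J 0) = 0"
      using T_eq [OF J_add [of 0 0]] subgrp_0 [OF Pc_subgrp] by (simp add: additive.add [OF T_add])
    then show "\<gamma> x = 0" if "j \<noteq> i" "x \<in> Pc j" for j x
      using that by (simp add: \<gamma>_def dec_hom)
  qed
qed

lemma lin_diff:
  "lin E lg rg g \<Longrightarrow> lin E lg rg h \<Longrightarrow> (\<And>e. additive (lg e)) \<Longrightarrow> (\<And>c. additive (rg c)) \<Longrightarrow> lin E lg rg (\<lambda>x. g x - h x)"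
  unfolding lin_def by (auto simp: additive.add additive.diff intro!: additiveI)

lemma lin_sg:
  "lin E lg rg g \<Longrightarrow> (\<And>e. additive (lg e)) \<Longrightarrow> (\<And>c. additive (rg c)) \<Longrightarrow> lin E lg rg (\<lambda>x. sg k (g x))"
  unfolding lin_def by (auto simp: additive.add sg_add sg_additive intro!: additiveI)

lemma lin_glue:
  assumes "\<And>i. lin E lg rg (g i)" and lg: "\<And>e. additive (lg e)" and rg: "\<And>c. additive (rg c)"
  shows "lin E lg rg (glue g)"
proof -
  have g: "Padd i (g i)" for i using assms(1) [of i] unfolding lin_def Padd_def by (auto simp: additive.add)
  have "glue g (ra x c) = rg c (glue g x)" for x c
    by (rule glue_equivariant [of g "\<lambda>x. ra x c", OF g additive_ra rg Pc_ra])
       (use assms(1) in \<open>auto simp: lin_def\<close>)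
  moreover have "glue g (la e x) = lg e (glue g x)" if "e \<in> E" for x e
    by (rule glue_equivariant [OF g additive_la lg Pc_la])
       (use assms(1) that in \<open>auto simp: lin_def\<close>)
  ultimately show ?thesis unfolding lin_def using additive_glue [OF g] by blast
qed

text \<open>
  The null homotopy is built by descending induction on the degree, starting with the component
  \<open>\<gamma>0\<close> in degree \<open>i0\<close>.
\<close>

lemma homotopy:
  fixes X :: "int \<Rightarrow> 'g::ab_group_add set"
  assumes d: "additive d" "\<And>x i. x \<in> Pc i \<Longrightarrow> d x \<in> Pc (i + 1)" "\<And>x. d (d x) = 0"
      "\<And>a x. d (la a x) = la a (d x)" "\<And>a x. d (ra x a) = ra (d x) a"
    and lg: "\<And>e. additive (lg e)" and rg: "\<And>c. additive (rg c)"
    and X: "\<And>j. subgrp (X j)"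
    and Dg: "additive Dg" "\<And>j z. z \<in> X j \<Longrightarrow> Dg (Dg z) = 0"
    and phi: "lin E lg rg \<phi>" "\<And>i x. x \<in> Pc i \<Longrightarrow> \<phi> x \<in> X (i + m)" "\<And>x. Dg (\<phi> x) = sg m (\<phi> (d x))"
    and g0: "lin E lg rg \<gamma>0" "\<And>x. x \<in> Pc i0 \<Longrightarrow> \<gamma>0 x \<in> X (i0 + m - 1)" "\<And>i x. i \<noteq> i0 \<Longrightarrow> x \<in> Pc i \<Longrightarrow> \<gamma>0 x = 0"
    and start: "\<And>x. x \<in> Pc (i0 - 1) \<Longrightarrow> \<phi> x - sg m (\<gamma>0 (d x)) \<in> Dg ` X (i0 + m - 2)"
    and top: "\<And>i x. i \<ge> i0 \<Longrightarrow> x \<in> Pc i \<Longrightarrow> \<phi> x = Dg (\<gamma>0 x) + sg m (\<gamma>0 (d x))"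
    and exact: "\<And>j z. j \<le> i0 + m - 2 \<Longrightarrow> z \<in> X j \<Longrightarrow> Dg z = 0 \<Longrightarrow> z \<in> Dg ` X (j - 1)"
    and lift: "\<And>i j \<psi>. lin E lg rg \<psi> \<Longrightarrow> (\<And>x. x \<in> Pc i \<Longrightarrow> \<psi> x \<in> Dg ` X j) \<Longrightarrow>
      \<exists>\<gamma>. lin E lg rg \<gamma> \<and> (\<forall>x. \<gamma> x \<in> X j) \<and> (\<forall>x\<in>Pc i. Dg (\<gamma> x) = \<psi> x) \<and> (\<forall>j x. j \<noteq> i \<longrightarrow> x \<in> Pc j \<longrightarrow> \<gamma> x = 0)"
  shows "\<exists>\<gamma>. lin E lg rg \<gamma> \<and> (\<forall>i. \<forall>x\<in>Pc i. \<gamma> x \<in> X (i + m - 1)) \<and>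
    (\<forall>x. \<phi> x = Dg (\<gamma> x) + sg m (\<gamma> (d x))) \<and> (\<forall>i\<ge>i0. \<forall>x\<in>Pc i. \<gamma> x = \<gamma>0 x)"
proof -
  \<comment> \<open>A component in degree \<open>i0 - k\<close> is kept together with the fact that
    the defect one degree lower is a boundary, which is what the next step lifts. \<open>Qr\<close>
    is the homotopy equation linking two consecutive components.\<close>
  define Pr where "Pr k \<gamma> \<longleftrightarrow> lin E lg rg \<gamma> \<and> (\<forall>x\<in>Pc (i0 - int k). \<gamma> x \<in> X (i0 - int k + m - 1)) \<and>
      (\<forall>i x. i \<noteq> i0 - int k \<longrightarrow> x \<in> Pc i \<longrightarrow> \<gamma> x = 0) \<and>
      (\<forall>x\<in>Pc (i0 - int k - 1). \<phi> x - sg m (\<gamma> (d x)) \<in> Dg ` X (i0 - int k + m - 2))" for k \<gamma>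
  define Qr where "Qr k \<gamma> \<gamma>' \<longleftrightarrow> (\<forall>x\<in>Pc (i0 - int k - 1). \<phi> x = Dg (\<gamma>' x) + sg m (\<gamma> (d x)))"
    for k :: nat and \<gamma> \<gamma>' :: "'p \<Rightarrow> 'g"
  have "\<exists>\<gamma>' . Pr (Suc k) \<gamma>' \<and> Qr k \<gamma> \<gamma>'" if \<gamma>: "Pr k \<gamma>" for k \<gamma>
  proof -
    let ?i = "i0 - int k - 1"
    let ?psi = "\<lambda>x. \<phi> x - sg m (\<gamma> (d x))"
    have "lin E lg rg (\<lambda>x. \<gamma> (d x))"
      using \<gamma> d(1,4,5) unfolding Pr_def lin_def by (auto intro!: additiveI simp: additive.add)
    then have "lin E lg rg ?psi" by (intro lin_diff lin_sg phi(1) lg rg)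
    moreover have "\<And>x. x \<in> Pc ?i \<Longrightarrow> ?psi x \<in> Dg ` X (i0 - int k + m - 2)"
      using \<gamma> unfolding Pr_def by blast
    ultimately obtain \<gamma>' where \<gamma>': "lin E lg rg \<gamma>'" "\<And>x. \<gamma>' x \<in> X (i0 - int k + m - 2)"
        "\<And>x. x \<in> Pc ?i \<Longrightarrow> Dg (\<gamma>' x) = ?psi x" "\<And>j x. j \<noteq> ?i \<Longrightarrow> x \<in> Pc j \<Longrightarrow> \<gamma>' x = 0"
      using lift [of ?psi ?i "i0 - int k + m - 2"] by blast
    have eq: "i0 - int (Suc k) = ?i" by simp
    have Q: "Qr k \<gamma> \<gamma>'" unfolding Qr_def using \<gamma>'(3) by simp
    have "\<phi> x - sg m (\<gamma>' (d x)) \<in> Dg ` X (?i + m - 1 - 1)" if x: "x \<in> Pc (?i - 1)" for x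
    proof (rule exact)
      have dx: "d x \<in> Pc ?i" using d(2) [OF x] by simp
      have a: "additive \<gamma>" using \<gamma> unfolding Pr_def lin_def by blast
      have "\<phi> (d x) = Dg (\<gamma>' (d x))"
        using \<gamma>'(3) [OF dx] by (simp add: d(3) additive.zero [OF a])
      then show "Dg (\<phi> x - sg m (\<gamma>' (d x))) = 0"
        by (simp add: additive.diff [OF Dg(1)] phi(3) sg_additive [OF Dg(1)])
      have "i0 - int k + m - 2 = ?i - 1 + m" by simp
      then show "\<phi> x - sg m (\<gamma>' (d x)) \<in> X (?i + m - 1)"
        using subgrp_diff [OF X phi(2) [OF x] sg_mem [OF X], of "\<gamma>' (d x)" m] \<gamma>'(2) [of "d x"]
        by (simp add: algebra_simps)
    qed simp
    moreover have "X (?i + m - 1) = X (i0 - int k + m - 2)" by (rule arg_cong [of _ _ X]) simp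
    moreover have "X (?i + m - 2) = X (?i + m - 1 - 1)" by (rule arg_cong [of _ _ X]) simp
    ultimately have "Pr (Suc k) \<gamma>'"
      unfolding Pr_def eq using \<gamma>' by simp
    with Q show ?thesis by blast
  qed
  moreover have "Pr 0 \<gamma>0" unfolding Pr_def using g0 start by auto
  ultimately obtain \<Gamma> where \<Gamma>: "\<Gamma> 0 = \<gamma>0" "\<And>k. Pr k (\<Gamma> k)" "\<And>k. Qr k (\<Gamma> k) (\<Gamma> (Suc k))"
    using dependent_nat_choice [of "\<lambda>k \<gamma>. Pr k \<gamma> \<and> (k = 0 \<longrightarrow> \<gamma> = \<gamma>0)" Qr] by (metis nat.distinct(1))
  define g where "g i = (if i \<le> i0 then \<Gamma> (nat (i0 - i)) else (\<lambda>x. 0))" for i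
  have g: "lin E lg rg (g i)" for i
  proof -
    have "lin E lg rg (\<lambda>x. 0)"
      by (auto simp: lin_def additive.zero [OF lg] additive.zero [OF rg] intro: additiveI)
    then show ?thesis using \<Gamma>(2) unfolding Pr_def g_def by auto
  qed
  have gP: "Padd i (g i)" for i using g [of i] unfolding lin_def Padd_def by (auto simp: additive.add)
  note gl = glue_hom [of g, OF gP]
  have aglue: "additive (glue g)" by (rule additive_glue [OF gP])
  show ?thesis
  proof (intro exI [of _ "glue g"] conjI allI ballI impI)
    show "lin E lg rg (glue g)" by (rule lin_glue [OF g lg rg])
    show "glue g x \<in> X (i + m - 1)" if "x \<in> Pc i" for i x
      using \<Gamma>(2) [of "nat (i0 - i)"] that by (auto simp: gl g_def Pr_def subgrp_0 [OF X])
    show "glue g x = \<gamma>0 x" if "i \<ge> i0" "x \<in> Pc i" for i x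
      using that g0(3) [of i x] by (auto simp: gl g_def \<Gamma>(1))
    have "\<phi> x = Dg (glue g x) + sg m (glue g (d x))" if x: "x \<in> Pc i" for i x
    proof (cases "i \<ge> i0")
      case True
      have "glue g x = \<gamma>0 x" using True x g0(3) [of i x] by (auto simp: gl g_def \<Gamma>(1))
      moreover have "glue g (d x) = \<gamma>0 (d x)"
        using True g0(3) [OF _ d(2) [OF x]] gl [OF d(2) [OF x]] by (auto simp: g_def)
      ultimately show ?thesis using top [OF True x] by simp
    next
      case False
      then obtain k where k: "i = i0 - int k - 1" "i + 1 = i0 - int k"
        using zle_iff_zadd [of "i + 1" i0] by (auto simp: algebra_simps)
      then have "nat (i0 - i) = Suc k" "nat (i0 - (i + 1)) = k" "i \<le> i0" "i + 1 \<le> i0" by auto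
      then have "g i = \<Gamma> (Suc k)" "g (i + 1) = \<Gamma> k" by (simp_all only: g_def if_True)
      then show ?thesis
        using \<Gamma>(3) [of k] x k(1) gl [OF x] gl [OF d(2) [OF x]] unfolding Qr_def by simp
    qed
    moreover have "additive \<phi>" using phi(1) unfolding lin_def by blast
    moreover have "additive (\<lambda>x. Dg (glue g x) + sg m (glue g (d x)))"
      by (rule additiveI) (simp add: additive.add [OF d(1)] additive.add [OF aglue] additive.add [OF Dg(1)] sg_add)
    ultimately show "\<phi> x = Dg (glue g x) + sg m (glue g (d x))" for x
      using P_additive_eq [of \<phi> "\<lambda>x. Dg (glue g x) + sg m (glue g (d x))"] by blast
  qed
qed

text \<open>The tensor powers of \<mu> in all exponents at once, without Koszul signs: this makes it
  multiplicative (\<open>nu_tm\<close>). The signs are restored in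
  \<open>map_power_cls\<close>.\<close>

definition nu :: "('p \<Rightarrow> 'a) \<Rightarrow> ('k, 'a, 'p) tv \<Rightarrow> 'a" where
  "nu \<mu> = ext (\<lambda>a xs. a * prod_list (map \<mu> xs))"

text \<open>The leading scalar is absorbed into the first letter, so products starting with a letter
  suffice as generators.\<close>

lemma TN_Suc_eq:
  assumes "additive f" "additive g" "\<And>x Y. Y \<in> TN n \<Longrightarrow> f (emP x \<odot> Y) = g (emP x \<odot> Y)" "v \<in> TN (Suc n)"
  shows "f v = g v"
proof (rule additive_TN_eq [OF assms(1,2) _ assms(4)])
  fix a and xs :: "'p list" assume "length xs = Suc n"
  then obtain x ys where xs: "xs = x # ys" "length ys = n" by (cases xs) auto
  have "wd a xs = emP (la a x) \<odot> wd 1 ys" by (simp add: xs tm_wd mw_def act wd_rel(3) [of 1 a, simplified, symmetric])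
  then show "f (wd a xs) = g (wd a xs)" using assms(3) wd_TN [OF xs(2)] by simp
qed

lemma TN_0_eq:
  assumes "additive f" "additive g" "\<And>a. f (emA a) = g (emA a)" "v \<in> TN 0"
  shows "f v = g v"
  by (rule additive_TN_eq [OF assms(1,2) _ assms(4)]) (simp add: assms(3))

lemma TH_Suc_mem:
  assumes "additive f" "subgrp H" "\<And>x Y i. x \<in> Pc i \<Longrightarrow> Y \<in> TH n (j - i) \<Longrightarrow> f (emP x \<odot> Y) \<in> H" "v \<in> TH (Suc n) j"
  shows "f v \<in> H"
proof (rule additive_TH_mem [OF assms(1,2) _ assms(4)])
  fix a and xs :: "'p list" assume "length xs = Suc n" "hl xs j"
  then obtain x ys i where xs: "xs = x # ys" "length ys = n" "x \<in> Pc i" "hl ys (j - i)"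
    by (cases xs) (auto simp: hl_Cons)
  have "wd a xs = emP (la a x) \<odot> wd 1 ys" by (simp add: xs tm_wd mw_def act wd_rel(3) [of 1 a, simplified, symmetric])
  then show "f (wd a xs) \<in> H" using assms(3) [OF Pc_la [OF xs(3)] wd_TH [OF xs(2,4)]] by simp
qed

lemma emA_central:
  assumes "Y \<in> TT" shows "emA (s k 1) \<odot> Y = Y \<odot> emA (s k 1)"
proof (rule TT_additive_eq [where f = "\<lambda>Y. emA (s k 1) \<odot> Y" and g = "\<lambda>Y. Y \<odot> emA (s k 1)",
      OF additive_tm_right additive_tm_left _ _ assms])
  show "emA (s k 1) \<odot> emA a = emA a \<odot> emA (s k 1)" for a
    using s_left [of k 1 a] s_right [of k a 1] by (simp add: emA_mult [symmetric])
  fix a x Z assume IH: "emA (s k 1) \<odot> Z = Z \<odot> emA (s k 1)"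
  have "emA (s k 1) \<odot> emA a = emA a \<odot> emA (s k 1)"
    using s_left [of k 1 a] s_right [of k a 1] by (simp add: emA_mult [symmetric])
  then have "emA (s k 1) \<odot> (emA a \<odot> (emP x \<odot> Z)) = emA a \<odot> ((emA (s k 1) \<odot> emP x) \<odot> Z)"
    by (simp only: tm_assoc [symmetric])
  also have "emA (s k 1) \<odot> emP x = emP x \<odot> emA (s k 1)"
    using emP_act(1) [of "s k 1" x] emP_act(2) [of x "s k 1"] central [of k x] by simp
  finally show "emA (s k 1) \<odot> (emA a \<odot> (emP x \<odot> Z)) = emA a \<odot> (emP x \<odot> Z) \<odot> emA (s k 1)"
    by (simp only: tm_assoc IH)
qed

text \<open>The case \<open>E = UNIV\<close> of \<open>projective_lift\<close>: one preimage per
  generator is enough, on which the left factor then acts. Balancing over the ground field is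
  \<open>emA_central\<close>.\<close>

lemma bimod_lift:
  fixes G :: "('k, 'a, 'p) tv \<Rightarrow> 'h::ab_group_add"
  assumes proj: "projective_bimod s (P\<lparr>carrier := Pc i\<rparr>)"
    and phi: "additive \<phi>" "\<And>x c. \<phi> (ra x c) = rh c (\<phi> x)" "\<And>x c. \<phi> (la c x) = lh c (\<phi> x)"
    and G: "additive G" "\<And>c y. y \<in> Y \<Longrightarrow> G (y \<odot> emA c) = rh c (G y)" "\<And>c y. y \<in> Y \<Longrightarrow> G (emA c \<odot> y) = lh c (G y)"
    and Y: "subgrp Y" "\<And>c y. y \<in> Y \<Longrightarrow> y \<odot> emA c \<in> Y" "\<And>c y. y \<in> Y \<Longrightarrow> emA c \<odot> y \<in> Y" "Y \<subseteq> TT"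
    and onto: "\<And>x. x \<in> Pc i \<Longrightarrow> \<phi> x \<in> G ` Y"
  shows "\<exists>\<gamma>. lin UNIV (\<lambda>e y. emA e \<odot> y) (\<lambda>c y. y \<odot> emA c) \<gamma> \<and> (\<forall>x. \<gamma> x \<in> Y) \<and> (\<forall>x\<in>Pc i. G (\<gamma> x) = \<phi> x) \<and>
    (\<forall>j x. j \<noteq> i \<longrightarrow> x \<in> Pc j \<longrightarrow> \<gamma> x = 0)"
proof (rule projective_lift [where lg = "\<lambda>e y. emA e \<odot> y" and rg = "\<lambda>c y. y \<odot> emA c" and rh = rh and E = UNIV,
      OF proj phi(1,2) G(1,2)])
  fix p :: "'p \<Rightarrow> 'p" assume p: "\<And>b. p b \<in> Pc i"
  have "\<exists>y. y \<in> Y \<and> G y = \<phi> (p b)" for b using onto [OF p [of b]] by auto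
  then obtain y where y: "\<And>b. y b \<in> Y" "\<And>b. G (y b) = \<phi> (p b)" by metis
  have cen: "emA (s k a) \<odot> y b \<odot> emA c = emA a \<odot> y b \<odot> emA (s k c)" for k a b c
  proof -
    have "s k a = a * s k 1" "s k c = s k 1 * c" using s_right [of k a 1] s_left [of k 1 c] by simp_all
    then show ?thesis using emA_central [of "y b" k] y Y(4) by (auto simp: emA_mult tm_assoc) (metis subsetD tm_assoc)
  qed
  show "\<exists>\<Lambda>. \<forall>b. (\<forall>a. \<Lambda> b a \<in> Y \<and> G (\<Lambda> b a) = \<phi> (la a (p b))) \<and>
       (\<forall>a a'. \<Lambda> b (a + a') = \<Lambda> b a + \<Lambda> b a') \<and> (\<forall>k a c. \<Lambda> b (s k a) \<odot> emA c = \<Lambda> b a \<odot> emA (s k c)) \<and>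
       (\<forall>e\<in>UNIV. \<forall>a. \<Lambda> b (e * a) = emA e \<odot> \<Lambda> b a)"
    by (rule exI [of _ "\<lambda>b a. emA a \<odot> y b"])
       (simp add: Y y G phi cen [unfolded tm_assoc] tm_add additive.add [OF additive_emA] emA_mult tm_assoc)
qed (use Y in \<open>auto simp: tm_add additive.add [OF additive_emA] emA_mult tm_assoc additive_tm_left additive_tm_right\<close>)

end

section \<open>The augmentation and the resolution\<close>

locale augmentation = tensor_powers s P
  for s :: "'k::field \<Rightarrow> 'a::{ring,monoid_mult} \<Rightarrow> 'a" and P :: "('a, 'p::ab_group_add) gbimod" +
  fixes \<mu> :: "'p \<Rightarrow> 'a"
  assumes mu_add: "additive \<mu>" and mu_la: "\<mu> (la a x) = a * \<mu> x" and mu_ra: "\<mu> (ra x a) = \<mu> x * a"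
begin

abbreviation "n\<mu> \<equiv> nu \<mu>"

lemma balanced_nu: "balanced (\<lambda>a xs. a * prod_list (map \<mu> xs))"
  unfolding balanced_def
  by (simp add: distrib_left distrib_right additive.add [OF mu_add] mu_la mu_ra mult.assoc)

lemma nu_wd: "n\<mu> (wd a xs) = a * prod_list (map \<mu> xs)"
  unfolding nu_def by (rule ext_wd [OF balanced_nu])
lemma additive_nu: "additive n\<mu>" unfolding nu_def by (rule additive_ext [OF balanced_nu])
lemmas nu_simps = additive.add [OF additive_nu] additive.diff [OF additive_nu] additive.minus [OF additive_nu]
  sg_additive [OF additive_nu]
lemma nu_0 [simp]: "n\<mu> 0 = 0" by (rule additive.zero [OF additive_nu])

lemma nu_emA [simp]: "n\<mu> (emA a) = a" and nu_emP [simp]: "n\<mu> (emP x) = \<mu> x" by (simp_all add: nu_wd)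

lemma nu_tm: assumes "X \<in> TT" "Y \<in> TT" shows "n\<mu> (X \<odot> Y) = n\<mu> X * n\<mu> Y"
proof (rule additive_spn_eq [OF _ _ _ assms(1)])
  fix a xs
  show "n\<mu> (wd a xs \<odot> Y) = n\<mu> (wd a xs) * n\<mu> Y"
  proof (rule additive_spn_eq [OF _ _ _ assms(2)])
    fix b ys
    show "n\<mu> (wd a xs \<odot> wd b ys) = n\<mu> (wd a xs) * n\<mu> (wd b ys)"
    proof (cases "xs = []")
      case False
      have "prod_list (map \<mu> (butlast xs @ [last xs])) = prod_list (map \<mu> (butlast xs)) * \<mu> (last xs)"
        unfolding map_append prod_list.append by simp
      then have "prod_list (map \<mu> xs) = prod_list (map \<mu> (butlast xs)) * \<mu> (last xs)"
        using False by simp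
      with False show ?thesis by (simp add: tm_wd mw_def nu_wd mu_ra mult.assoc)
    qed (simp add: tm_wd nu_wd mult.assoc)
  qed (auto intro!: additiveI simp: tm_add nu_simps distrib_left)
qed (auto intro!: additiveI simp: tm_add nu_simps distrib_right)

end

text \<open>After the shift the complex ends in degree 1, the only degree where \<mu> is nonzero.
  The minus in \<open>counit_2\<close> is the Koszul sign of \<mu> \<otimes> \<mu>, which
  \<open>nu\<close> omits.\<close>

locale resolution = codifferential s P D + augmentation s P \<mu>
  for s :: "'k::field \<Rightarrow> 'a::{ring,monoid_mult} \<Rightarrow> 'a" and P :: "('a, 'p::ab_group_add) gbimod"
    and D :: "nat \<Rightarrow> 'p \<Rightarrow> ('k, 'a, 'p) tv" and \<mu> :: "'p \<Rightarrow> 'a" +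
  fixes d :: "'p \<Rightarrow> 'p"
  assumes D_1: "D 1 x = emP (d x)"
    and d_add: "additive d" and d_la: "d (la a x) = la a (d x)" and d_ra: "d (ra x a) = ra (d x) a"
    and d_deg: "x \<in> Pc i \<Longrightarrow> d x \<in> Pc (i + 1)" and d_d: "d (d x) = 0"
    and mu_deg: "x \<in> Pc i \<Longrightarrow> i \<noteq> 1 \<Longrightarrow> \<mu> x = 0" and mu_d: "\<mu> (d x) = 0"
    and top: "i > 1 \<Longrightarrow> Pc i = {0}"
    and exact: "i < 1 \<Longrightarrow> x \<in> Pc i \<Longrightarrow> d x = 0 \<Longrightarrow> x \<in> d ` Pc (i - 1)"
    and exact_aug: "x \<in> Pc 1 \<Longrightarrow> \<mu> x = 0 \<Longrightarrow> x \<in> d ` Pc 0"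
    and mu_onto: "\<exists>p\<in>Pc 1. \<mu> p = 1"
    and projective: "projective_bimod s (P\<lparr>carrier := Pc i\<rparr>)"
    and counit_2: "nu \<mu> (D 2 x) = - \<mu> x" and counit: "n > 2 \<Longrightarrow> nu \<mu> (D n x) = 0"
begin

lemma mu_tau: "\<mu> (tau l x) = sg l (\<mu> x)"
proof (rule P_additive_eq [where x = x])
  show "\<mu> (tau l x) = sg l (\<mu> x)" if "x \<in> Pc i" for i x
    using mu_deg [OF that] by (cases "i = 1") (simp_all add: tau_hom [OF that] sg_additive [OF mu_add])
qed (auto intro!: additiveI simp: additive.add [OF mu_add] additive.add [OF additive_tau] sg_add)

text \<open>As \<mu> lives in degree 1, a word of \<open>n\<close> letters survives only in total
  degree \<open>n\<close>.\<close>

lemma nu_TH: assumes "v \<in> TH n j" "j \<noteq> int n" shows "n\<mu> v = 0"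
proof -
  have "n\<mu> v \<in> {0}"
  proof (rule additive_TH_mem [OF additive_nu _ _ assms(1)])
    fix a and xs :: "'p list" assume "length xs = n" "hl xs j"
    then have "prod_list (map \<mu> xs) = 0" using assms(2)
    proof (induction xs arbitrary: n j)
      case (Cons x xs)
      then obtain i where i: "x \<in> Pc i" "hl xs (j - i)" by (auto simp: hl_Cons)
      show ?case
      proof (cases "i = 1")
        case True
        have "prod_list (map \<mu> xs) = 0" by (rule Cons.IH [OF refl i(2)]) (use Cons.prems True in auto)
        then show ?thesis by simp
      qed (simp add: mu_deg [OF i(1)])
    qed simp
    then show "n\<mu> (wd a xs) \<in> {0}" by (simp add: nu_wd)
  qed simp
  then show ?thesis by simp
qed

text \<open>\<open>P\<close> vanishes above degree 1, so exponent \<open>n\<close> has top degree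
  \<open>n\<close>, exactly the degree that \<open>nu\<close> sees.\<close>

lemma TH_top: assumes "v \<in> TH n j" "j > int n" shows "v = 0"
proof -
  have "v \<in> {0}"
  proof (rule additive_TH_mem [where f = "\<lambda>v. v", OF _ _ _ assms(1)])
    fix a and xs :: "'p list" assume "length xs = n" "hl xs j"
    then show "wd a xs \<in> {0}" using assms(2)
    proof (induction xs arbitrary: a n j)
      case (Cons x xs)
      then obtain i where i: "x \<in> Pc i" "hl xs (j - i)" by (auto simp: hl_Cons)
      show ?case
      proof (cases "i > 1")
        case True
        then have "x = 0" using top i(1) by auto
        then show ?thesis by (subst wd_Cons) (simp add: additive.zero [OF additive_emP])
      next
        case False
        have "wd 1 xs \<in> {0}" by (rule Cons.IH [OF refl i(2)]) (use Cons.prems False in auto)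
        then show ?thesis by (subst wd_Cons) simp
      qed
    qed simp
  qed (auto intro: additiveI)
  then show ?thesis by simp
qed

lemma nu_tt: assumes "v \<in> TN n" shows "n\<mu> (tt l v) = sg (l * int n) (n\<mu> v)"
proof (rule additive_TN_eq [OF _ _ _ assms])
  fix a and xs :: "'p list"
  have "prod_list (map (\<mu> \<circ> tau l) xs) = sg (l * int (length xs)) (prod_list (map \<mu> xs))" for xs
    by (induction xs) (auto simp: mu_tau sg_def)
  then show "n\<mu> (tt l (wd a xs)) = sg (l * int n) (n\<mu> (wd a xs))" if "length xs = n"
    using that by (simp add: tt_wd nu_wd) (simp add: sg_def)
qed (auto intro!: additiveI simp: nu_simps additive.add [OF additive_tt] sg_add)

text \<open>Under \<open>nu\<close> only \<open>\<delta>\<^sub>2\<close> survives: \<mu> kills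
  boundaries, and the weak counit kills the components above 2.\<close>

lemma nu_dD:
  assumes "i \<noteq> 2" "v \<in> TT" shows "n\<mu> (dD i v) = 0"
proof (rule TT_additive_eq [OF _ _ _ _ assms(2)])
  have D0: "n\<mu> (D i x) = 0" for x
  proof -
    consider "i = 0" | "i = 1" | "i > 2" using assms(1) by linarith
    then show ?thesis by cases (auto simp: D_0 D_1 [simplified] mu_d counit)
  qed
  fix a x Y assume "Y \<in> TT" "n\<mu> (dD i Y) = 0"
  then show "n\<mu> (dD i (emA a \<odot> (emP x \<odot> Y))) = 0"
    by (simp add: is_der_emA_emP [OF is_der_dD] dD_emP nu_tm nu_simps D0 GH_TT [OF D] subgrp_add [OF subgrp_spn])
qed (auto intro!: additiveI simp: nu_simps dD_add)

text \<open>Inserting \<open>\<delta>\<^sub>2\<close> at each of the \<open>n\<close> factors gives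
  the same value with alternating signs, since it is odd and only letters of degree 1
  matter.\<close>

lemma nu_dD_2:
  assumes "v \<in> TN n" shows "n\<mu> (dD 2 v) = (if odd n then - n\<mu> v else 0)"
  using assms
proof (induction n arbitrary: v)
  case 0
  show ?case
    by (rule TN_0_eq [where f = "\<lambda>v. n\<mu> (dD 2 v)", OF _ _ _ 0]) (auto intro!: additiveI simp: nu_simps dD_add)
next
  case (Suc n)
  show ?case
  proof (rule TN_Suc_eq [OF _ _ _ Suc.prems])
    fix x Y assume Y: "Y \<in> TN n"
    show "n\<mu> (dD 2 (emP x \<odot> Y)) = (if odd (Suc n) then - n\<mu> (emP x \<odot> Y) else 0)"
      using TN_TT [OF Y] Suc.IH [OF Y]
      by (simp add: der_emP_tm [OF D] nu_simps nu_tm GH_TT [OF D] counit_2 mu_tau)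
  qed (auto intro!: additiveI simp: nu_simps dD_add)
qed

lemma dD_1: "dD 1 (emP x) = emP (d x)" by (simp only: dD_emP D_1)

lemma dD_1_tm: "Y \<in> TT \<Longrightarrow> dD 1 (emP x \<odot> Y) = emP (d x) \<odot> Y + emP (tau 1 x) \<odot> dD 1 Y"
  using der_emP_tm [OF D [of 1]] D_1 by simp

lemma dD_1_dD_1: "v \<in> TT \<Longrightarrow> dD 1 (dD 1 v) = 0"
proof -
  assume v: "v \<in> TT"
  have "{..2::nat} = {0, 1, 2}" by auto
  then show ?thesis using dD_dD [OF v, of 2] v by (simp add: dD_0)
qed

lemma dD_1_D_2: "dD 1 (D 2 x) = - D 2 (d x)"
proof -
  have "{..3::nat} = {0, 1, 2, 3}" by auto
  then have "dD 1 (D 2 x) + dD 2 (emP (d x)) = 0"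
    using D_D [of 3 x] D_1 [of x] GH_TT [OF D] by (simp add: dD_0 D_0)
  then show ?thesis by (simp only: dD_emP eq_neg_iff_add_eq_0)
qed

subsection \<open>Exactness of the tensor powers\<close>

text \<open>A lift of the unit; \<open>a \<mapsto> ra p0 a\<close> is then a right linear section of
  \<mu>, onto whose image \<open>P\<close> contracts.\<close>

definition p0 where "p0 = (SOME p. p \<in> Pc 1 \<and> \<mu> p = 1)"
lemma p0: "p0 \<in> Pc 1" "\<mu> p0 = 1"
  using someI_ex [of "\<lambda>p. p \<in> Pc 1 \<and> \<mu> p = 1"] mu_onto unfolding p0_def by blast+

text \<open>Over a field every linear map has a linear section over its image. The scalars act here
  from the right, through \<open>s k 1\<close>.\<close>

lemma linear_section:
  "\<exists>\<kappa>. additive \<kappa> \<and> (\<forall>z k. \<kappa> (ra z (s k 1)) = ra (\<kappa> z) (s k 1)) \<and> (\<forall>z. \<kappa> z \<in> Pc i) \<and> (\<forall>z\<in>d ` Pc i. d (\<kappa> z) = z)"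
proof -
  let ?sc = "\<lambda>k x. ra x (s k 1)"
  interpret v: vector_space ?sc
  proof
    show "ra (x + y) (s a 1) = ra x (s a 1) + ra y (s a 1)" for a x y by (rule act)
    show "ra x (s (a + b) 1) = ra x (s a 1) + ra x (s b 1)" for a b x by (simp add: s_add act)
    show "ra (ra x (s b 1)) (s a 1) = ra x (s (a * b) 1)" for a b x
    proof -
      have "s b 1 * s a 1 = s (a * b) 1" using s_right [of a "s b 1" 1] by (simp add: s_mult)
      then show ?thesis by (simp add: act(7) [symmetric])
    qed
    show "ra x (s 1 1) = x" for x by (simp add: s_one act)
  qed
  interpret vp: vector_space_pair ?sc ?sc ..
  have lin: "Vector_Spaces.linear ?sc ?sc d"
    unfolding linear_iff using v.vector_space_axioms by (auto simp: additive.add [OF d_add] d_ra)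
  have sub: "v.subspace (Pc i)"
    by (rule v.subspaceI) (auto intro: subgrp_0 [OF Pc_subgrp] subgrp_add [OF Pc_subgrp] Pc_ra)
  obtain \<kappa> where \<kappa>: "\<kappa> ` UNIV \<subseteq> Pc i" "Vector_Spaces.linear ?sc ?sc \<kappa>" "\<forall>z\<in>d ` Pc i. d (\<kappa> z) = z"
    using vp.linear_exists_right_inverse_on [OF lin sub] by blast
  then show ?thesis
    using vp.linear_add [OF \<kappa>(2)] vp.linear_scale [OF \<kappa>(2)]
    by (intro exI [of _ \<kappa>]) (auto intro!: additiveI)
qed

text \<open>The case \<open>E = {}\<close> of \<open>projective_lift\<close>: nothing ties the
  preimages of \<open>\<psi> (la a (p b))\<close> for different \<open>a\<close> together except
  linearity over the ground field, which the splitting \<kappa> provides.\<close>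

lemma right_lift:
  assumes \<psi>: "lin {} (\<lambda>e y. y) (\<lambda>c y. ra y c) \<psi>" and onto: "\<And>x. x \<in> Pc i \<Longrightarrow> \<psi> x \<in> d ` Pc j"
  shows "\<exists>\<gamma>. lin {} (\<lambda>e y. y) (\<lambda>c y. ra y c) \<gamma> \<and> (\<forall>x. \<gamma> x \<in> Pc j) \<and> (\<forall>x\<in>Pc i. d (\<gamma> x) = \<psi> x) \<and>
    (\<forall>j x. j \<noteq> i \<longrightarrow> x \<in> Pc j \<longrightarrow> \<gamma> x = 0)"
proof (rule projective_lift [OF projective, where rh = "\<lambda>c y. ra y c"])
  fix p :: "'p \<Rightarrow> 'p" assume p: "\<And>b. p b \<in> Pc i"
  obtain \<kappa> where \<kappa>: "additive \<kappa>" "\<And>z k. \<kappa> (ra z (s k 1)) = ra (\<kappa> z) (s k 1)" "\<And>z. \<kappa> z \<in> Pc j"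
    "\<And>z. z \<in> d ` Pc j \<Longrightarrow> d (\<kappa> z) = z" using linear_section [of j] by blast
  have psi: "additive \<psi>" "\<And>x c. \<psi> (ra x c) = ra (\<psi> x) c" using \<psi> unfolding lin_def by auto
  have "ra (\<kappa> (\<psi> (la (s k a) (p b)))) c = ra (\<kappa> (\<psi> (la a (p b)))) (s k c)" for k a b c
  proof -
    have "s k a = s k 1 * a" "s k c = s k 1 * c" using s_left [of k 1 a] s_left [of k 1 c] by simp_all
    then show ?thesis by (simp add: act(3,7) central psi \<kappa>)
  qed
  then show "\<exists>\<Lambda>. \<forall>b. (\<forall>a. \<Lambda> b a \<in> Pc j \<and> d (\<Lambda> b a) = \<psi> (la a (p b))) \<and>
       (\<forall>a a'. \<Lambda> b (a + a') = \<Lambda> b a + \<Lambda> b a') \<and> (\<forall>k a c. ra (\<Lambda> b (s k a)) c = ra (\<Lambda> b a) (s k c)) \<and>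
       (\<forall>e\<in>{}. \<forall>a. \<Lambda> b (e * a) = \<Lambda> b a)"
    by (intro exI [of _ "\<lambda>b a. \<kappa> (\<psi> (la a (p b)))"])
       (simp add: \<kappa> onto [OF Pc_la [OF p]] act additive.add [OF psi(1)] additive.add [OF \<kappa>(1)])
qed (use \<psi> in \<open>auto simp: lin_def d_add d_ra act additive_ra Pc_subgrp Pc_ra intro: additiveI\<close>)

text \<open>Subtracting the section through \<open>p0\<close> gives a chain map over zero, hence
  null homotopic. The section is linear on the right only, and so is the homotopy.\<close>

lemma contraction:
  "\<exists>h. additive h \<and> (\<forall>x c. h (ra x c) = ra (h x) c) \<and> (\<forall>i. \<forall>x\<in>Pc i. h x \<in> Pc (i - 1)) \<and>
    (\<forall>x. x - ra p0 (\<mu> x) = d (h x) + h (d x))"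
proof -
  let ?phi = "\<lambda>x. x - ra p0 (\<mu> x)"
  have mem: "?phi x \<in> Pc i" if "x \<in> Pc i" for x i
  proof (cases "i = 1")
    case True
    then show ?thesis using that p0 by (auto intro: subgrp_diff [OF Pc_subgrp] Pc_ra)
  next
    case False
    have "ra p0 0 = 0" using act(6) [of p0 0 0] by simp
    then show ?thesis using that mu_deg [OF that False] by simp
  qed
  have ra0: "ra p0 0 = 0" using act(6) [of p0 0 0] by simp
  have dp0: "d p0 = 0" using d_deg [OF p0(1)] top by auto
  have ra00: "ra 0 c = 0" for c using act(5) [of 0 0 c] by simp
  have "\<exists>\<gamma>. lin {} (\<lambda>e y. y) (\<lambda>c y. ra y c) \<gamma> \<and> (\<forall>i. \<forall>x\<in>Pc i. \<gamma> x \<in> Pc (i + 0 - 1)) \<and>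
    (\<forall>x. ?phi x = d (\<gamma> x) + sg 0 (\<gamma> (d x))) \<and> (\<forall>i\<ge>2. \<forall>x\<in>Pc i. \<gamma> x = 0)"
  \<comment> \<open>Starting in degree 2, where the complex is already zero, makes exactness at the
    augmentation the first step of the descent.\<close>
  proof (rule homotopy [OF d_add d_deg d_d d_la d_ra])
    show "lin {} (\<lambda>e y. y) (\<lambda>c y. ra y c) ?phi"
      by (auto simp: lin_def act additive.add [OF mu_add] additive.diff [OF additive_ra] mu_ra algebra_simps intro!: additiveI)
    show "?phi x \<in> Pc (i + 0)" if "x \<in> Pc i" for x i using mem [OF that] by simp
    show "d (?phi x) = sg 0 (?phi (d x))" for x
      by (simp add: additive.diff [OF d_add] d_ra dp0 mu_d ra0 ra00)
    show "lin {} (\<lambda>e y. y) (\<lambda>c y. ra y c) (\<lambda>x. 0)" by (auto simp: lin_def ra00 intro: additiveI)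
    show "?phi x - sg 0 0 \<in> d ` Pc (2 + 0 - 2)" if "x \<in> Pc (2 - 1)" for x
      using exact_aug [of "?phi x"] mem [of x 1] that
      by (simp add: additive.diff [OF mu_add] mu_ra p0)
    show "?phi x = d 0 + sg 0 0" if "2 \<le> i" "x \<in> Pc i" for i x
      using that top [of i] by (simp add: additive.zero [OF d_add] additive.zero [OF mu_add] ra0)
    show "z \<in> d ` Pc (j - 1)" if "j \<le> 2 + 0 - 2" "z \<in> Pc j" "d z = 0" for j z
      using exact that by simp
    show "\<exists>\<gamma>. lin {} (\<lambda>e y. y) (\<lambda>c y. ra y c) \<gamma> \<and> (\<forall>x. \<gamma> x \<in> Pc j) \<and> (\<forall>x\<in>Pc i. d (\<gamma> x) = \<psi> x) \<and>
        (\<forall>j x. j \<noteq> i \<longrightarrow> x \<in> Pc j \<longrightarrow> \<gamma> x = 0)"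
      if "lin {} (\<lambda>e y. y) (\<lambda>c y. ra y c) \<psi>" "\<And>x. x \<in> Pc i \<Longrightarrow> \<psi> x \<in> d ` Pc j" for i j \<psi>
      using right_lift [OF that] .
  qed (auto simp: d_d d_add Pc_subgrp additive_ra subgrp_0 [OF Pc_subgrp] intro: additiveI)
  then obtain h where "lin {} (\<lambda>e y. y) (\<lambda>c y. ra y c) h" "\<forall>i. \<forall>x\<in>Pc i. h x \<in> Pc (i + 0 - 1)"
    "\<forall>x. ?phi x = d (h x) + sg 0 (h (d x))" by blast
  then show ?thesis by (intro exI [of _ h]) (simp add: lin_def)
qed

end

section \<open>Maps to \<open>A\<close> and maps acting on the first tensor factor\<close>

context tensor_powers
begin

text \<open>Bimodule maps from \<open>P\<close> to \<open>A\<close> of degree \<open>l\<close>. As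
  \<open>A\<close> sits in degree 0, homogeneity amounts to vanishing in all degrees but
  one.\<close>

definition AH :: "int \<Rightarrow> ('p \<Rightarrow> 'a) \<Rightarrow> bool" where
  "AH l b \<longleftrightarrow> additive b \<and> (\<forall>a x. b (la a x) = a * b x \<and> b (ra x a) = b x * a) \<and>
     (\<forall>i. \<forall>x\<in>Pc i. i + l \<noteq> 0 \<longrightarrow> b x = 0)"

lemma AHD:
  assumes "AH l b"
  shows "additive b" "b (la a x) = a * b x" "b (ra x a) = b x * a" "x \<in> Pc i \<Longrightarrow> i + l \<noteq> 0 \<Longrightarrow> b x = 0"
  using assms unfolding AH_def by blast+

lemma AH_plus: assumes b: "AH l b" and c: "AH l c" shows "AH l (\<lambda>x. b x + c x)"
  unfolding AH_def
  by (auto simp: additive.add [OF AHD(1) [OF b]] additive.add [OF AHD(1) [OF c]] AHD(2-4) [OF b] AHD(2-4) [OF c]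
      algebra_simps intro!: additiveI)

lemma sg_mult: "sg k (a * b) = a * sg k b" "sg k (a * b) = sg k a * b" for a b :: 'a
  by (auto simp: sg_def)

lemma AH_sg: assumes b: "AH l b" shows "AH l (\<lambda>x. sg k (b x))"
  unfolding AH_def
  by (auto simp: additive.add [OF AHD(1) [OF b]] AHD(2-4) [OF b] sg_add sg_mult(1) intro!: additiveI)
     (auto simp: sg_def)

lemma AH_0: "AH l (\<lambda>x. 0)"
  unfolding AH_def by (auto intro!: additiveI)

lemma GH_lin: "GH n l g \<longleftrightarrow> lin UNIV (\<lambda>e y. emA e \<odot> y) (\<lambda>c y. y \<odot> emA c) g \<and> (\<forall>i. \<forall>x\<in>Pc i. g x \<in> TH n (i + l))"
  unfolding GH_def lin_def by auto

lemma GH_der_comp: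
  assumes g: "GH n r g" and h: "GH 1 l h"
  shows "GH n (l + r) (\<lambda>x. der r g (h x))"
  unfolding GH_def
proof (intro conjI allI ballI)
  note K = is_der_der [OF g]
  show "additive (\<lambda>x. der r g (h x))"
    by (auto intro!: additiveI simp: additive.add [OF GHD(1) [OF h]] additive.add [OF is_derD(1) [OF K]])
  show "der r g (h (la a x)) = emA a \<odot> der r g (h x)" "der r g (h (ra x a)) = der r g (h x) \<odot> emA a" for a x
    by (simp_all add: GHD [OF h] is_der_emA [OF K] GH_TT [OF h])
  show "der r g (h x) \<in> TH n (i + (l + r))" if "x \<in> Pc i" for i x
    using der_TH [OF g GHD(4) [OF h that], of n] by (simp add: algebra_simps)
qed

text \<open>This is \<open>f \<otimes> 1\<close> for a right linear \<open>f\<close>. The leading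
  scalar is moved into the first letter before \<open>f\<close> is applied, because the contraction
  \<open>h0\<close> need not commute with left scalars.\<close>

definition hd_map :: "('p \<Rightarrow> ('k, 'a, 'p) tv) \<Rightarrow> ('k, 'a, 'p) tv \<Rightarrow> ('k, 'a, 'p) tv" where
  "hd_map f = ext (\<lambda>a xs. case xs of [] \<Rightarrow> 0 | x # ys \<Rightarrow> f (la a x) \<odot> wd 1 ys)"

lemma hd_map_TT: "hd_map f v \<in> TT"
  unfolding hd_map_def by (rule ext_mem) (auto split: list.split simp: subgrp_spn subgrp_0 [OF subgrp_spn])

context
  fixes f assumes f: "additive f" "\<And>x b. f (ra x b) = f x \<odot> emA b"
begin

lemma balanced_hd_map: "balanced (\<lambda>a xs. case xs of [] \<Rightarrow> 0 | x # ys \<Rightarrow> f (la a x) \<odot> wd 1 ys)" (is "balanced ?F")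
proof -
  have "?F a (xs @ (x + y) # zs) = ?F a (xs @ x # zs) + ?F a (xs @ y # zs)" for a xs x y zs
    by (cases xs) (simp_all add: act additive.add [OF f(1)] tm_add wd_rel)
  moreover have "?F a (xs @ ra x b # y # zs) = ?F a (xs @ x # la b y # zs)" for a xs x b y zs
    using wd_rel(3) [of 1 b y zs]
    by (cases xs) (simp_all add: act(9) [symmetric] f(2) tm_assoc emA_wd wd_rel)
  ultimately show ?thesis
    unfolding balanced_def by (auto simp: act additive.add [OF f(1)] tm_add split: list.split)
qed

lemma additive_hd_map: "additive (hd_map f)"
  and hd_map_wd: "hd_map f (wd a xs) = (case xs of [] \<Rightarrow> 0 | x # ys \<Rightarrow> f (la a x) \<odot> wd 1 ys)"
  unfolding hd_map_def by (rule additive_ext [OF balanced_hd_map], rule ext_wd [OF balanced_hd_map])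

lemma hd_map_tm: assumes "Y \<in> TT" shows "hd_map f (emP x \<odot> Y) = f x \<odot> Y"
proof (rule additive_spn_eq [OF _ _ _ assms])
  show "hd_map f (emP x \<odot> wd a xs) = f x \<odot> wd a xs" for a xs
    by (simp add: tm_wd [of 1 "[x]"] mw_def hd_map_wd act f(2) tm_assoc emA_wd)
qed (auto intro!: additiveI simp: tm_add additive.add [OF additive_hd_map])

lemma hd_map_TH:
  assumes "\<And>x i. x \<in> Pc i \<Longrightarrow> f x \<in> TH k (i + l)" "v \<in> TH (Suc n) j"
  shows "hd_map f v \<in> TH (k + n) (j + l)"
proof (rule TH_Suc_mem [OF additive_hd_map subgrp_TH _ assms(2)])
  fix x Y i assume "x \<in> Pc i" "Y \<in> TH n (j - i)"
  then show "hd_map f (emP x \<odot> Y) \<in> TH (k + n) (j + l)"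
    using tm_TH [OF assms(1)] by (force simp: hd_map_tm TH_TT algebra_simps)
qed

end

end

context resolution
begin

lemma GH_nu:
  assumes g: "GH n l g" shows "AH (l - int n) (\<lambda>x. n\<mu> (g x))"
  unfolding AH_def
proof (intro conjI allI ballI impI)
  show "additive (\<lambda>x. n\<mu> (g x))" using GHD(1) [OF g] by (auto intro!: additiveI simp: additive.add nu_simps)
  show "n\<mu> (g (la a x)) = a * n\<mu> (g x)" "n\<mu> (g (ra x a)) = n\<mu> (g x) * a" for a x
    by (simp_all add: GHD [OF g] nu_tm GH_TT [OF g])
  show "n\<mu> (g x) = 0" if "x \<in> Pc i" "i + (l - int n) \<noteq> 0" for i x
    using that by (intro nu_TH [OF GHD(4) [OF g that(1)]]) linarith
qed

definition M1 where "M1 = hd_map (\<lambda>x. emA (\<mu> x))"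

lemma emA_mu: "additive (\<lambda>x. emA (\<mu> x))" "emA (\<mu> (ra x b)) = emA (\<mu> x) \<odot> emA b"
  by (auto intro!: additiveI simp: additive.add [OF mu_add] additive.add [OF additive_emA] mu_ra emA_mult)

lemmas additive_M1 = additive_hd_map [OF emA_mu, folded M1_def]
  and M1_wd = hd_map_wd [OF emA_mu, folded M1_def]
  and M1_tm = hd_map_tm [OF emA_mu, folded M1_def]

lemma M1_TT [simp]: "M1 v \<in> TT" unfolding M1_def by (rule hd_map_TT)

lemma M1_TH: assumes "v \<in> TH (Suc n) j" shows "M1 v \<in> TH n (j - 1)"
proof -
  have "emA (\<mu> x) \<in> TH 0 (i + -1)" if "x \<in> Pc i" for x i
    using mu_deg [OF that] emA_TH by (cases "i = 1") (auto simp: TH_0 additive.zero [OF additive_emA])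
  from hd_map_TH [OF emA_mu this assms] show ?thesis by (simp add: M1_def)
qed

lemma nu_M1: assumes "v \<in> TN (Suc n)" shows "n\<mu> (M1 v) = n\<mu> v"
proof (rule TN_Suc_eq [OF _ _ _ assms])
  show "n\<mu> (M1 (emP x \<odot> Y)) = n\<mu> (emP x \<odot> Y)" if "Y \<in> TN n" for x Y
    using TN_TT [OF that] by (simp add: M1_tm nu_tm)
qed (auto intro!: additiveI simp: nu_simps additive.add [OF additive_M1])

lemma M1_dD: assumes "v \<in> TN (Suc n)" shows "M1 (dD 1 v) = - dD 1 (M1 v)"
proof (rule TN_Suc_eq [OF _ _ _ assms])
  fix x Y assume "Y \<in> TN n"
  then have Y: "Y \<in> TT" by (rule TN_TT)
  show "M1 (dD 1 (emP x \<odot> Y)) = - dD 1 (M1 (emP x \<odot> Y))"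
    by (simp add: dD_1_tm [OF Y, simplified] M1_tm Y additive.add [OF additive_M1] mu_d mu_tau is_der_emA [OF is_der_dD]
        additive.zero [OF additive_emA] additive.minus [OF additive_emA])
qed (auto intro!: additiveI simp: dD_add additive.add [OF additive_M1])

definition h0 where "h0 = (SOME h. additive h \<and> (\<forall>x c. h (ra x c) = ra (h x) c) \<and> (\<forall>i. \<forall>x\<in>Pc i. h x \<in> Pc (i - 1)) \<and>
    (\<forall>x. x - ra p0 (\<mu> x) = d (h x) + h (d x)))"

lemma h0: "additive h0" "h0 (ra x c) = ra (h0 x) c" "x \<in> Pc i \<Longrightarrow> h0 x \<in> Pc (i - 1)"
    "x - ra p0 (\<mu> x) = d (h0 x) + h0 (d x)"
  using someI_ex [OF contraction, folded h0_def] by blast+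

lemma h0_tau: "h0 (tau 1 x) = - tau 1 (h0 x)"
proof (rule P_additive_eq [where x = x])
  show "h0 (tau 1 x) = - tau 1 (h0 x)" if "x \<in> Pc i" for i x
    using tau_hom [OF h0(3) [OF that]] by (simp add: tau_hom [OF that] sg_additive [OF h0(1)]) (simp add: sg_def)
qed (auto intro!: additiveI simp: additive.add [OF h0(1)] additive.add [OF additive_tau])

definition H1 where "H1 = hd_map (\<lambda>x. emP (h0 x))"

lemma emP_h0: "additive (\<lambda>x. emP (h0 x))" "emP (h0 (ra x b)) = emP (h0 x) \<odot> emA b"
  by (auto intro!: additiveI simp: additive.add [OF h0(1)] additive.add [OF additive_emP] h0(2) emP_act)

lemmas additive_H1 = additive_hd_map [OF emP_h0, folded H1_def]
  and H1_tm = hd_map_tm [OF emP_h0, folded H1_def]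

lemma H1_TH: assumes "v \<in> TH (Suc n) j" shows "H1 v \<in> TH (Suc n) (j - 1)"
proof -
  have "emP (h0 x) \<in> TH 1 (i + -1)" if "x \<in> Pc i" for x i using emP_TH [OF h0(3) [OF that]] by simp
  from hd_map_TH [OF emP_h0 this assms] show ?thesis by (simp add: H1_def)
qed

text \<open>The contraction acts on the first factor. The terms where the differential meets the
  remaining factors cancel because \<open>h0\<close> is odd (\<open>h0_tau\<close>).\<close>

lemma H1_homotopy:
  assumes "v \<in> TN (Suc n)" shows "dD 1 (H1 v) + H1 (dD 1 v) = v - emP p0 \<odot> M1 v"
proof (rule TN_Suc_eq [OF _ _ _ assms])
  fix x Y assume "Y \<in> TN n"
  then have Y: "Y \<in> TT" by (rule TN_TT)
  have "dD 1 (H1 (emP x \<odot> Y)) + H1 (dD 1 (emP x \<odot> Y)) = (emP (d (h0 x)) + emP (h0 (d x))) \<odot> Y"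
    by (simp add: dD_1_tm [OF Y, simplified] H1_tm Y additive.add [OF additive_H1] h0_tau
        additive.minus [OF additive_emP] tm_add)
  also have "emP (d (h0 x)) + emP (h0 (d x)) = emP (x - ra p0 (\<mu> x))"
    unfolding h0(4) by (simp add: additive.add [OF additive_emP])
  also have "\<dots> \<odot> Y = emP x \<odot> Y - emP p0 \<odot> M1 (emP x \<odot> Y)"
    by (simp add: additive.diff [OF additive_emP] tm_diff M1_tm Y emP_act tm_assoc)
  finally show "dD 1 (H1 (emP x \<odot> Y)) + H1 (dD 1 (emP x \<odot> Y)) = emP x \<odot> Y - emP p0 \<odot> M1 (emP x \<odot> Y)" .
qed (auto intro!: additiveI simp: dD_add additive.add [OF additive_M1] additive.add [OF additive_H1] tm_add)

lemma d_p0: "d p0 = 0"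
  using d_deg [OF p0(1)] top by auto

text \<open>By \<open>H1_homotopy\<close> a cycle \<open>z\<close> is homologous to
  \<open>emP p0 \<odot> M1 z\<close>, and \<open>M1 z\<close> is again a cycle with the same
  augmentation, one exponent lower. In exponent 1 it lies in \<open>A\<close>, where
  \<open>nu\<close> is the identity, so it is zero.\<close>

lemma exact_TH:
  assumes "z \<in> TH (Suc n) j" "dD 1 z = 0" "n\<mu> z = 0"
  shows "z \<in> dD 1 ` TH (Suc n) (j - 1)"
  using assms
proof (induction n arbitrary: z j)
  case 0
  note zN = TH_TN [OF 0(1)]
  have "M1 z \<in> TN 0" using M1_TH [OF 0(1)] by (rule TH_TN)
  then have "M1 z = emA (n\<mu> (M1 z))"
    by (rule TN_0_eq [where f = "\<lambda>v. v" and g = "\<lambda>v. emA (n\<mu> v)", rotated 3])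
       (auto intro!: additiveI simp: nu_simps additive.add [OF additive_emA])
  then have "M1 z = 0" using nu_M1 [OF zN] 0(3) by (simp add: additive.zero [OF additive_emA])
  then have "z = dD 1 (H1 z)"
    using H1_homotopy [OF zN] 0(2) by (simp add: additive.zero [OF additive_H1])
  then show ?case using H1_TH [OF 0(1)] by blast
next
  case (Suc n)
  note zN = TH_TN [OF Suc.prems(1)]
  have "M1 z \<in> dD 1 ` TH (Suc n) (j - 1 - 1)"
  proof (rule Suc.IH)
    show "M1 z \<in> TH (Suc n) (j - 1)" by (rule M1_TH [OF Suc.prems(1)])
    show "dD 1 (M1 z) = 0"
      using M1_dD [OF zN] Suc.prems(2) by (simp add: additive.zero [OF additive_M1])
    show "n\<mu> (M1 z) = 0" using nu_M1 [OF zN] Suc.prems(3) by simp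
  qed
  then obtain w where w: "w \<in> TH (Suc n) (j - 2)" "M1 z = dD 1 w" by auto
  \<comment> \<open>Prefixing \<open>p0\<close>, a cycle of odd degree, anticommutes with the
    differential.\<close>
  have "dD 1 (emP p0 \<odot> w) = - (emP p0 \<odot> M1 z)"
    using dD_1_tm [OF TH_TT [OF w(1)], of p0] d_p0 tau_hom [OF p0(1), of 1] w(2)
    by (simp add: additive.zero [OF additive_emP] additive.minus [OF additive_emP])
  then have "z = dD 1 (H1 z - emP p0 \<odot> w)"
    using H1_homotopy [OF zN] Suc.prems(2) by (simp add: additive.zero [OF additive_H1] dD_diff)
  moreover have "H1 z - emP p0 \<odot> w \<in> TH (Suc (Suc n)) (j - 1)"
    using emP_tm_TH [OF p0(1) w(1)] H1_TH [OF Suc.prems(1)] by (auto intro: TH_diff)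
  ultimately show ?case by blast
qed

section \<open>Comparison with maps to \<open>A\<close>, and the counit up to homotopy\<close>

lemma dD_1_TH: "v \<in> TH n j \<Longrightarrow> dD 1 v \<in> TH n (j + 1)"
  using der_TH [OF D [of 1], of v n j n] by simp

text \<open>This is how the columns are compared with \<open>Hom(P, A)\<close>: a cocycle whose
  augmentation is a coboundary is itself one, with a prescribed lift of the primitive. With
  \<open>b = 0\<close> it gives homotopies between maps of equal augmentation; with \<phi> = 0 it
  gives cocycles of prescribed augmentation.\<close>

lemma chain_lift:
  assumes phi: "GH (Suc n) m \<phi>" "\<And>x. dD 1 (\<phi> x) = sg m (\<phi> (d x))"
    and b: "AH (m - 1 - int (Suc n)) b" and eq: "\<And>x. n\<mu> (\<phi> x) = sg m (b (d x))"
  obtains \<gamma> where "GH (Suc n) (m - 1) \<gamma>" "\<And>x. \<phi> x = dD 1 (\<gamma> x) + sg m (\<gamma> (d x))" "\<And>x. n\<mu> (\<gamma> x) = b x"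
proof -
  let ?N = "Suc n"
  \<comment> \<open>The degree which \<gamma>, of degree \<open>m - 1\<close>, sends to
    \<open>?N\<close>: the top degree of this exponent and the only one where \<open>nu\<close> is
    nonzero.\<close>
  define i0 where "i0 = int ?N + 1 - m"
  let ?lin = "lin UNIV (\<lambda>e y. emA e \<odot> y) (\<lambda>c y. y \<odot> emA c)"
  \<comment> \<open>Tensor powers of \<open>p0\<close> show that \<open>nu\<close> maps the top
    degree onto \<open>A\<close>.\<close>
  have rep: "wd a (replicate k p0) \<in> TH k (int k)" for a k
  proof (rule wd_TH)
    show "hl (replicate k p0) (int k)" by (induction k) (auto simp: hl_Cons intro!: exI [of _ 1] p0)
  qed simp
  have nrep: "n\<mu> (wd a (replicate k p0)) = a" for a k
  proof -
    have "prod_list (map \<mu> (replicate k p0)) = 1" by (induction k) (simp_all add: p0)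
    then show ?thesis by (simp add: nu_wd del: map_replicate)
  qed
  have "\<exists>\<gamma>. ?lin \<gamma> \<and> (\<forall>x. \<gamma> x \<in> TH ?N (int ?N)) \<and> (\<forall>x\<in>Pc i0. n\<mu> (\<gamma> x) = b x) \<and>
    (\<forall>j x. j \<noteq> i0 \<longrightarrow> x \<in> Pc j \<longrightarrow> \<gamma> x = 0)"
  proof (rule bimod_lift [OF projective AHD(1) [OF b], where rh = "\<lambda>c y. y * c" and lh = "\<lambda>c y. c * y"])
    show "b x \<in> n\<mu> ` TH ?N (int ?N)" for x
      using rep [of "b x" ?N] nrep [of "b x" ?N] by (metis image_eqI)
  qed (auto simp: AHD [OF b] additive_nu nu_tm TH_TT subgrp_TH tm_emA_TH emA_tm_TH)
  then obtain \<gamma>0 where g0: "?lin \<gamma>0" "\<And>x. \<gamma>0 x \<in> TH ?N (int ?N)" "\<And>x. x \<in> Pc i0 \<Longrightarrow> n\<mu> (\<gamma>0 x) = b x"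
    "\<And>j x. j \<noteq> i0 \<Longrightarrow> x \<in> Pc j \<Longrightarrow> \<gamma>0 x = 0" by blast
  have "\<exists>\<gamma>. ?lin \<gamma> \<and> (\<forall>i. \<forall>x\<in>Pc i. \<gamma> x \<in> TH ?N (i + m - 1)) \<and>
    (\<forall>x. \<phi> x = dD 1 (\<gamma> x) + sg m (\<gamma> (d x))) \<and> (\<forall>i\<ge>i0. \<forall>x\<in>Pc i. \<gamma> x = \<gamma>0 x)"
  proof (rule homotopy [where lg = "\<lambda>e y. emA e \<odot> y" and rg = "\<lambda>c y. y \<odot> emA c" and X = "TH ?N" and Dg = "dD 1"
        and ?i0.0 = i0, OF d_add d_deg d_d d_la d_ra])
    show "dD 1 (dD 1 z) = 0" if "z \<in> TH ?N j" for j z by (rule dD_1_dD_1 [OF TH_TT [OF that]])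
    show "?lin \<phi>" using phi(1) unfolding GH_lin by blast
    show "dD 1 (\<phi> x) = sg m (\<phi> (d x))" for x by (rule phi(2))
    show "?lin \<gamma>0" by (rule g0(1))
    show "additive (dD 1)" by (rule is_derD(1) [OF is_der_dD])
    show "\<phi> x \<in> TH ?N (i + m)" if "x \<in> Pc i" for x i using GHD(4) [OF phi(1) that] .
    show "\<gamma>0 x \<in> TH ?N (i0 + m - 1)" for x using g0(2) by (simp add: i0_def)
    show "\<gamma>0 x = 0" if "i \<noteq> i0" "x \<in> Pc i" for i x using g0(4) that .
    show "\<phi> x - sg m (\<gamma>0 (d x)) \<in> dD 1 ` TH ?N (i0 + m - 2)" if x: "x \<in> Pc (i0 - 1)" for x
    proof -
      have dx: "d x \<in> Pc i0" using d_deg [OF x] by simp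
      have z: "\<phi> x - sg m (\<gamma>0 (d x)) \<in> TH ?N (int ?N)"
        using GHD(4) [OF phi(1) x] g0(2) by (intro TH_diff TH_sg) (simp_all add: i0_def)
      have "dD 1 (\<phi> x - sg m (\<gamma>0 (d x))) = 0"
        using dD_1_TH [OF z] by (intro TH_top) auto
      moreover have "n\<mu> (\<phi> x - sg m (\<gamma>0 (d x))) = 0"
        by (simp add: nu_simps eq g0(3) [OF dx])
      ultimately show ?thesis using exact_TH [OF z] by (simp add: i0_def)
    qed
    show "\<phi> x = dD 1 (\<gamma>0 x) + sg m (\<gamma>0 (d x))" if i: "i0 \<le> i" and x: "x \<in> Pc i" for i x
    proof -
      have "\<phi> x = 0" by (rule TH_top [OF GHD(4) [OF phi(1) x]]) (use i in \<open>simp add: i0_def\<close>)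
      moreover have "dD 1 (\<gamma>0 x) = 0" by (rule TH_top [OF dD_1_TH [OF g0(2)]]) simp
      moreover have "\<gamma>0 (d x) = 0" by (rule g0(4) [OF _ d_deg [OF x]]) (use i in simp)
      ultimately show ?thesis by simp
    qed
    \<comment> \<open>Below the top degree the condition on \<open>nu\<close> in
      \<open>exact_TH\<close> holds for degree reasons.\<close>
    show "z \<in> dD 1 ` TH ?N (j - 1)" if "j \<le> i0 + m - 2" "z \<in> TH ?N j" "dD 1 z = 0" for j z
      by (rule exact_TH [OF that(2,3)]) (rule nu_TH [OF that(2)], use that(1) in \<open>simp add: i0_def\<close>)
    show "\<exists>\<gamma>. ?lin \<gamma> \<and> (\<forall>x. \<gamma> x \<in> TH ?N j) \<and> (\<forall>x\<in>Pc i. dD 1 (\<gamma> x) = \<psi> x) \<and> (\<forall>j x. j \<noteq> i \<longrightarrow> x \<in> Pc j \<longrightarrow> \<gamma> x = 0)"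
      if psi: "?lin \<psi>" "\<And>x. x \<in> Pc i \<Longrightarrow> \<psi> x \<in> dD 1 ` TH ?N j" for i j \<psi>
    proof (rule bimod_lift [OF projective, where rh = "\<lambda>c y. y \<odot> emA c" and lh = "\<lambda>c y. emA c \<odot> y"])
      show "additive \<psi>" using psi(1) unfolding lin_def by blast
      show "\<psi> (ra x c) = \<psi> x \<odot> emA c" "\<psi> (la c x) = emA c \<odot> \<psi> x" for x c using psi(1) unfolding lin_def by blast+
      show "\<psi> x \<in> dD 1 ` TH ?N j" if x: "x \<in> Pc i" for x by (rule psi(2) [OF x])
    qed (auto simp: is_derD(1) [OF is_der_dD] is_der_emA [OF is_der_dD] TH_TT subgrp_TH tm_emA_TH emA_tm_TH)
  qed (simp_all add: additive_tm_right additive_tm_left subgrp_TH)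
  then obtain \<gamma> where \<gamma>: "?lin \<gamma>" "\<And>i x. x \<in> Pc i \<Longrightarrow> \<gamma> x \<in> TH ?N (i + m - 1)"
    "\<And>x. \<phi> x = dD 1 (\<gamma> x) + sg m (\<gamma> (d x))" "\<And>i x. i \<ge> i0 \<Longrightarrow> x \<in> Pc i \<Longrightarrow> \<gamma> x = \<gamma>0 x" by blast
  have GH: "GH ?N (m - 1) \<gamma>" unfolding GH_lin using \<gamma>(1,2) by (simp add: add_diff_eq)
  show thesis
  proof (rule that [OF GH \<gamma>(3)])
    show "n\<mu> (\<gamma> x) = b x" for x
    proof (rule P_additive_eq [where f = "\<lambda>x. n\<mu> (\<gamma> x)" and g = b])
      show "additive (\<lambda>x. n\<mu> (\<gamma> x))" by (rule AHD(1) [OF GH_nu [OF GH]])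
      show "additive b" by (rule AHD(1) [OF b])
      show "n\<mu> (\<gamma> x) = b x" if x: "x \<in> Pc i" for i x
      proof (cases "i = i0")
        case True
        then show ?thesis using g0(3) [of x] \<gamma>(4) [of i x] x by simp
      next
        case False
        then have "i + (m - 1 - int ?N) \<noteq> 0" by (simp add: i0_def)
        then show ?thesis using AHD(4) [OF GH_nu [OF GH] x] AHD(4) [OF b x] by simp
      qed
    qed
  qed
qed

text \<open>
  Both \<open>(1 \<otimes> \<mu>) \<delta>\<^sub>2\<close> and \<open>- (\<mu> \<otimes> 1) \<delta>\<^sub>2\<close> are homotopic to the identity, up to the sign
  automorphism; \<open>M1\<close> and \<open>M2\<close> contract the first and the last tensor factor with \<open>\<mu>\<close>.
\<close>

definition M2 where "M2 = ext (\<lambda>a xs. if xs = [] then 0 else wd a (butlast xs) \<odot> emA (\<mu> (last xs)))"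

lemma balanced_M2: "balanced (\<lambda>a xs. if xs = [] then 0 else wd a (butlast xs) \<odot> emA (\<mu> (last xs)))"
proof -
  let ?F = "\<lambda>a xs. if xs = [] then 0 else wd a (butlast xs) \<odot> emA (\<mu> (last xs))"
  have "?F a (xs @ (x + y) # zs) = ?F a (xs @ x # zs) + ?F a (xs @ y # zs)" for a xs x y zs
    by (cases "zs = []")
       (simp_all add: butlast_append additive.add [OF mu_add] additive.add [OF additive_emA] tm_add wd_rel)
  moreover have "?F (a + b) xs = ?F a xs + ?F b xs" for a b xs
    by (simp add: wd_rel tm_add)
  moreover have "?F (a * b) (x # xs) = ?F a (la b x # xs)" for a b x xs
    by (cases "xs = []") (simp_all add: emA_mult mu_la wd_rel(3) tm_assoc)
  moreover have "?F a (xs @ ra x b # y # zs) = ?F a (xs @ x # la b y # zs)" for a xs x b y zs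
  proof (cases "zs = []")
    case True
    have "wd a (xs @ [ra x b]) = wd a (xs @ [x]) \<odot> emA b" by (simp add: wd_emA)
    then show ?thesis using True by (simp add: butlast_append mu_la emA_mult tm_assoc)
  qed (simp add: butlast_append wd_rel)
  ultimately show ?thesis unfolding balanced_def by blast
qed

lemma additive_M2: "additive M2" unfolding M2_def by (rule additive_ext [OF balanced_M2])
lemma M2_wd: "M2 (wd a xs) = (if xs = [] then 0 else wd a (butlast xs) \<odot> emA (\<mu> (last xs)))"
  unfolding M2_def by (rule ext_wd [OF balanced_M2])
lemma M2_TT [simp]: "M2 v \<in> TT"
  unfolding M2_def by (rule ext_mem) (simp_all add: subgrp_spn subgrp_0 [OF subgrp_spn])

lemma M2_emP: "M2 (emP x \<odot> emP y) = emP x \<odot> emA (\<mu> y)"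
  by (simp add: tm_wd mw_def M2_wd act)

lemma M2_emA:
  assumes "v \<in> TT"
  shows "M2 (emA a \<odot> v) = emA a \<odot> M2 v" "v \<in> TN (Suc n) \<Longrightarrow> M2 (v \<odot> emA a) = M2 v \<odot> emA a"
proof -
  show "M2 (emA a \<odot> v) = emA a \<odot> M2 v"
    by (rule additive_spn_eq [OF _ _ _ assms])
       (auto intro!: additiveI simp: tm_add additive.add [OF additive_M2] emA_wd M2_wd tm_assoc [symmetric])
  assume "v \<in> TN (Suc n)"
  then show "M2 (v \<odot> emA a) = M2 v \<odot> emA a"
  proof (rule additive_TN_eq [where f = "\<lambda>v. M2 (v \<odot> emA a)" and g = "\<lambda>v. M2 v \<odot> emA a", rotated 3])
    fix b and xs :: "'p list" assume "length xs = Suc n"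
    then show "M2 (wd b xs \<odot> emA a) = M2 (wd b xs) \<odot> emA a"
      by (auto simp: wd_emA M2_wd mu_ra emA_mult tm_assoc)
  qed (auto intro!: additiveI simp: tm_add additive.add [OF additive_M2])
qed

lemma M1_emA_tm:
  assumes "v \<in> TT"
  shows "M1 (emA a \<odot> v) = emA a \<odot> M1 v" "v \<in> TN (Suc n) \<Longrightarrow> M1 (v \<odot> emA a) = M1 v \<odot> emA a"
proof -
  show "M1 (emA a \<odot> v) = emA a \<odot> M1 v"
  proof (rule additive_spn_eq [OF _ _ _ assms])
    show "M1 (emA a \<odot> wd b xs) = emA a \<odot> M1 (wd b xs)" for b xs
      by (cases xs) (simp_all add: emA_wd M1_wd mu_la mult.assoc)
  qed (auto intro!: additiveI simp: tm_add additive.add [OF additive_M1])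
  assume "v \<in> TN (Suc n)"
  then show "M1 (v \<odot> emA a) = M1 v \<odot> emA a"
    by (rule TN_Suc_eq [where f = "\<lambda>v. M1 (v \<odot> emA a)" and g = "\<lambda>v. M1 v \<odot> emA a", rotated 3])
       (auto intro!: additiveI simp: tm_add additive.add [OF additive_M1] tm_assoc M1_tm TN_TT)
qed

lemma TN_2_eq:
  assumes "additive f" "additive g" "\<And>x y. f (emP x \<odot> emP y) = g (emP x \<odot> emP y)" "v \<in> TN 2"
  shows "f v = g v"
proof (rule additive_TN_eq [OF assms(1,2) _ assms(4)])
  fix a and xs :: "'p list" assume "length xs = 2"
  then obtain x y where xs: "xs = [x, y]"
    by (cases xs; cases "tl xs") auto
  have "wd a xs = emP (la a x) \<odot> emP y"
    using wd_rel(3) [of 1 a x "[y]"] by (simp add: xs tm_wd mw_def act)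
  then show "f (wd a xs) = g (wd a xs)" using assms(3) by simp
qed

lemma M2_TH: assumes "v \<in> TH 2 j" shows "M2 v \<in> TH 1 (j - 1)"
proof (rule additive_TH_mem [OF additive_M2 subgrp_TH _ assms])
  fix a and xs :: "'p list" assume "length xs = 2" "hl xs j"
  then obtain x y i where xs: "xs = [x, y]" "x \<in> Pc i" "y \<in> Pc (j - i)"
    by (cases xs; cases "tl xs") (auto simp: hl_Cons)
  show "M2 (wd a xs) \<in> TH 1 (j - 1)"
  proof (cases "j - i = 1")
    case True
    then have "i = j - 1" by simp
    then show ?thesis using xs(2) by (simp add: xs(1) M2_wd tm_emA_TH wd_TH hl_Cons)
  next
    case False
    then show ?thesis using mu_deg [OF xs(3)] by (simp add: xs(1) M2_wd additive.zero [OF additive_emA] TH_0)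
  qed
qed

lemma M2_dD: assumes "v \<in> TN 2" shows "M2 (dD 1 v) = dD 1 (M2 v)"
proof (rule TN_2_eq [OF _ _ _ assms])
  show "M2 (dD 1 (emP x \<odot> emP y)) = dD 1 (M2 (emP x \<odot> emP y))" for x y
    using dD_1_tm [of "emP y" x] dD_1_tm [of "emA (\<mu> y)" x] dD_1 [of y]
    by (simp add: M2_emP additive.add [OF additive_M2] mu_d additive.zero [OF additive_emA])
qed (auto intro!: additiveI simp: dD_add additive.add [OF additive_M2])

lemma nu_M2: assumes "v \<in> TN 2" shows "n\<mu> (M2 v) = n\<mu> v"
  by (rule TN_2_eq [OF _ _ _ assms])
     (auto intro!: additiveI simp: nu_simps additive.add [OF additive_M2] M2_emP nu_tm)

lemma GH_emP: "GH 1 0 emP"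
  unfolding GH_def using emP_TH by (simp add: additive_emP emP_act)

text \<open>By the counit equation \<open>M1 \<circ> D 2\<close> is a chain map over - \<mu>, and so
  is the negative of the inclusion. Lifts with equal augmentation are homotopic, by
  \<open>chain_lift\<close> with \<open>b = 0\<close>.\<close>

lemma left_homotopy:
  obtains h where "GH 1 (-1) h" "\<And>x. M1 (D 2 x) = - emP x + (dD 1 (h x) + h (d x))"
proof -
  let ?phi = "\<lambda>x. M1 (D 2 x) + emP x"
  have D2N: "D 2 x \<in> TN (Suc 1)" for x using GH_TN [OF D, of 2 x] by (simp add: numeral_2_eq_2)
  have "GH 1 0 (\<lambda>x. M1 (D 2 x))"
    unfolding GH_def
  proof (intro conjI allI ballI)
    show "additive (\<lambda>x. M1 (D 2 x))"
      by (auto intro!: additiveI simp: additive.add [OF GHD(1) [OF D]] additive.add [OF additive_M1])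
    show "M1 (D 2 (la a x)) = emA a \<odot> M1 (D 2 x)" "M1 (D 2 (ra x a)) = M1 (D 2 x) \<odot> emA a" for a x
      by (simp_all add: GHD(2,3) [OF D] M1_emA_tm [OF GH_TT [OF D]] M1_emA_tm(2) [OF GH_TT [OF D] D2N])
    show "M1 (D 2 x) \<in> TH 1 (i + 0)" if "x \<in> Pc i" for i x
      using M1_TH [of "D 2 x" 1 "i + 1"] GHD(4) [OF D that, of 2] by (simp add: numeral_2_eq_2)
  qed
  then have phi: "GH (Suc 0) 0 ?phi" using GH_plus GH_emP by fastforce
  have chain: "dD 1 (?phi x) = sg 0 (?phi (d x))" for x
  proof -
    have "dD 1 (M1 (D 2 x)) = - M1 (dD 1 (D 2 x))" using M1_dD [OF D2N] by simp
    also have "\<dots> = M1 (D 2 (d x))" by (simp only: dD_1_D_2 additive.minus [OF additive_M1] minus_minus)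
    finally show ?thesis by (simp add: dD_add dD_1 [simplified])
  qed
  have nu: "n\<mu> (?phi x) = sg 0 0" for x by (simp add: nu_simps nu_M1 [OF D2N] counit_2)
  obtain h where h: "GH (Suc 0) (0 - 1) h" "\<And>x. ?phi x = dD 1 (h x) + sg 0 (h (d x))"
    using chain_lift [OF phi chain AH_0 nu] by metis
  show thesis
  proof (rule that [of h])
    show "GH 1 (-1) h" using h(1) by simp
    show "M1 (D 2 x) = - emP x + (dD 1 (h x) + h (d x))" for x
      using h(2) [of x] by (simp add: algebra_simps)
  qed
qed

text \<open>\<open>M2\<close> commutes with the differential while \<open>D 2\<close> anticommutes,
  so the composite is not a chain map. The sign automorphism \<open>tt 1\<close> repairs this and
  also turns the augmentation from - \<mu> into \<mu>.\<close>

lemma right_homotopy: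
  obtains h where "GH 1 (-1) h" "\<And>x. M2 (D 2 x) = tt 1 (emP x + (dD 1 (h x) + h (d x)))"
proof -
  let ?phi = "\<lambda>x. tt 1 (M2 (D 2 x)) - emP x"
  have D2N: "D 2 x \<in> TN 2" for x using GH_TN [OF D] .
  have D2N': "D 2 x \<in> TN (Suc 1)" for x using D2N by (simp add: numeral_2_eq_2)
  have M2N: "M2 (D 2 x) \<in> TN 1" for x
  proof (rule additive_mem [of "\<lambda>x. M2 (D 2 x)"])
    show "additive (\<lambda>x. M2 (D 2 x))"
      by (auto intro!: additiveI simp: additive.add [OF GHD(1) [OF D]] additive.add [OF additive_M2])
    show "M2 (D 2 x) \<in> TN 1" if "x \<in> Pc i" for i x
      by (rule TH_TN [OF M2_TH [OF GHD(4) [OF D that]]])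
  qed (rule subgrp_TN)
  have "GH 1 0 (\<lambda>x. tt 1 (M2 (D 2 x)))"
    unfolding GH_def
  proof (intro conjI allI ballI)
    show "additive (\<lambda>x. tt 1 (M2 (D 2 x)))"
      by (auto intro!: additiveI simp: additive.add [OF GHD(1) [OF D]] additive.add [OF additive_M2] additive.add [OF additive_tt])
    show "tt 1 (M2 (D 2 (la a x))) = emA a \<odot> tt 1 (M2 (D 2 x))" "tt 1 (M2 (D 2 (ra x a))) = tt 1 (M2 (D 2 x)) \<odot> emA a" for a x
      by (simp_all add: GHD(2,3) [OF D] M2_emA [OF GH_TT [OF D]] M2_emA(2) [OF GH_TT [OF D] D2N'] tt_tm)
    show "tt 1 (M2 (D 2 x)) \<in> TH 1 (i + 0)" if "x \<in> Pc i" for i x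
      using M2_TH [OF GHD(4) [OF D that]] tt_hom [OF M2_TH [OF GHD(4) [OF D that]], of 1] by (simp add: TH_sg)
  qed
  then have phi: "GH (Suc 0) 0 ?phi"
    using GH_plus [of 1 0 _ "\<lambda>x. sg 1 (emP x)"] GH_sg [OF GH_emP, of 1] by fastforce
  have chain: "dD 1 (?phi x) = sg 0 (?phi (d x))" for x
  proof -
    have "dD 1 (tt 1 (M2 (D 2 x))) = - tt 1 (dD 1 (M2 (D 2 x)))"
      using is_derD(5) [OF is_der_dD, of "M2 (D 2 x)" 1 1] by simp
    also have "\<dots> = tt 1 (M2 (D 2 (d x)))"
      by (simp only: M2_dD [OF D2N, symmetric] dD_1_D_2 additive.minus [OF additive_M2] additive.minus [OF additive_tt] minus_minus)
    finally show ?thesis by (simp add: dD_diff dD_1 [simplified])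
  qed
  have nu: "n\<mu> (?phi x) = sg 0 0" for x
    by (simp add: nu_simps nu_tt [OF M2N] nu_M2 [OF D2N] counit_2)
  obtain h where h: "GH (Suc 0) (0 - 1) h" "\<And>x. ?phi x = dD 1 (h x) + sg 0 (h (d x))"
    using chain_lift [OF phi chain AH_0 nu] by metis
  show thesis
  proof (rule that [of h])
    show "GH 1 (-1) h" using h(1) by simp
    show "M2 (D 2 x) = tt 1 (emP x + (dD 1 (h x) + h (d x)))" for x
    proof -
      have "emP x + (dD 1 (h x) + h (d x)) = tt 1 (M2 (D 2 x))"
        using h(2) [of x] by (simp add: algebra_simps)
      moreover have "tt 1 (tt 1 (M2 (D 2 x))) = M2 (D 2 x)"
      proof (rule additive_TN_eq [OF _ _ _ M2N])
        fix a and xs :: "'p list"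
        have "tau 2 x = x" for x
          by (rule P_additive_eq [OF additive_tau, of "\<lambda>x. x"]) (auto intro: additiveI simp: tau_hom sg_def)
        then show "tt 1 (tt 1 (wd a xs)) = wd a xs"
          by (simp add: tt_wd comp_def tau_tau)
      qed (auto intro!: additiveI simp: additive.add [OF additive_tt])
      ultimately show ?thesis by simp
    qed
  qed
qed

text \<open>The alternating count for odd \<open>n\<close>: the inner insertions add up to minus the
  augmentation of \<open>g\<close>, the two outer terms to twice it, up to the coboundary
  contributed by the homotopies.\<close>

lemma counit_defect:
  assumes g: "GH n r g" and "odd n" and cyc: "\<And>x. n\<mu> (g (d x)) = 0"
  obtains b where "AH (r - 1 - int n) b"
    "\<And>x. n\<mu> (dD 2 (g x)) - sg r (n\<mu> (der r g (D 2 x))) = n\<mu> (g x) + b (d x)"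
proof -
  obtain h1 where h1: "GH 1 (-1) h1" "\<And>x. M1 (D 2 x) = - emP x + (dD 1 (h1 x) + h1 (d x))"
    using left_homotopy by blast
  obtain h2 where h2: "GH 1 (-1) h2" "\<And>x. M2 (D 2 x) = tt 1 (emP x + (dD 1 (h2 x) + h2 (d x)))"
    using right_homotopy by blast
  let ?G = "der r g"
  note G = is_der_der [OF g]
  note Gadd = additive.add [OF is_derD(1) [OF G]] additive.diff [OF is_derD(1) [OF G]] additive.minus [OF is_derD(1) [OF G]]
  \<comment> \<open>The derivation hits one of the two letters, and \<open>nu\<close> contracts the
    other one with \<mu>.\<close>
  have split: "n\<mu> (?G v) = n\<mu> (?G (M2 v)) + sg r (n\<mu> (?G (M1 v)))" if "v \<in> TN 2" for v
  proof (rule TN_2_eq [OF _ _ _ that])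
    show "n\<mu> (?G (emP x \<odot> emP y)) = n\<mu> (?G (M2 (emP x \<odot> emP y))) + sg r (n\<mu> (?G (M1 (emP x \<odot> emP y))))" for x y
      by (simp add: M2_emP M1_tm der_emP_tm [OF g] der_emP [OF g] is_der_emA [OF G] nu_simps nu_tm GH_TT [OF g] mu_tau
          is_derD(2,3) [OF G] sg_mult(2))
  qed (auto intro!: additiveI simp: Gadd nu_simps additive.add [OF additive_M1] additive.add [OF additive_M2] sg_add)
  \<comment> \<open>In the homotopies, the part which is a boundary in \<open>P\<close> is invisible
    because \<open>g\<close> augments to a cocycle.\<close>
  have bound: "n\<mu> (?G (dD 1 v)) = 0" if "v \<in> TN 1" for v
  proof (rule TN_Suc_eq [where f = "\<lambda>v. n\<mu> (?G (dD 1 v))" and g = "\<lambda>v. 0" and n = 0])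
    show "v \<in> TN (Suc 0)" using that by simp
    show "n\<mu> (?G (dD 1 (emP x \<odot> Y))) = 0" if "Y \<in> TN 0" for x Y
    proof (rule TN_0_eq [OF _ _ _ that])
      show "n\<mu> (?G (dD 1 (emP x \<odot> emA a))) = 0" for a
        using dD_1_tm [of "emA a" x] by (simp add: is_der_emA [OF G] der_emP [OF g] nu_tm GH_TT [OF g] cyc)
    qed (auto intro!: additiveI simp: Gadd nu_simps dD_add tm_add)
  qed (auto intro!: additiveI simp: Gadd nu_simps dD_add)
  have GTN: "?G v \<in> TN n" if "v \<in> TN 1" for v
  proof (rule additive_TN_mem [OF is_derD(1) [OF G] subgrp_TN _ that])
    fix a and xs :: "'p list" assume "length xs = 1"
    then obtain x where "xs = [x]" by (cases xs) auto
    then have "wd a xs = emP (la a x)" using wd_rel(3) [of 1 a x "[]"] by simp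
    then show "?G (wd a xs) \<in> TN n" using GH_TN [OF g] by (simp add: der_emP [OF g])
  qed
  \<comment> \<open>Oddness of \<open>n\<close> enters here and makes the two outer terms reinforce
    each other instead of cancelling.\<close>
  have flip: "n\<mu> (?G (tt 1 v)) = - sg r (n\<mu> (?G v))" if "v \<in> TN 1" for v
    using is_derD(5) [OF G TN_TT [OF that], of 1] nu_tt [OF GTN [OF that], of 1] \<open>odd n\<close>
    by (simp add: nu_simps) (simp add: sg_def)
  let ?b = "\<lambda>x. n\<mu> (?G (h2 x)) - n\<mu> (?G (h1 x))"
  have b: "AH (r - 1 - int n) ?b"
    using AH_plus [OF GH_nu [OF GH_der_comp [OF g h2(1)]] AH_sg [OF GH_nu [OF GH_der_comp [OF g h1(1)]], of 1]]
    by (simp add: algebra_simps)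
  show thesis
  proof (rule that [of ?b, OF b])
    fix x
    have dh: "dD 1 (h x) + h (d x) \<in> TN 1" if "GH 1 (-1) h" for h
    proof (rule subgrp_add [OF subgrp_TN _ GH_TN [OF that]])
      show "dD 1 (h x) \<in> TN 1"
        by (rule additive_mem [of "\<lambda>x. dD 1 (h x)"])
           (auto intro!: additiveI subgrp_TN TH_TN [OF dD_1_TH [OF GHD(4) [OF that], simplified]] simp: dD_add additive.add [OF GHD(1) [OF that]])
    qed
    have emN: "emP x \<in> TN 1" by (rule wd_TN) simp
    have "n\<mu> (?G (D 2 x)) = - sg r (n\<mu> (g x) + n\<mu> (?G (h2 (d x)))) + sg r (- n\<mu> (g x) + n\<mu> (?G (h1 (d x))))"
      using split [OF GH_TN [OF D]] bound [OF GH_TN [OF h1(1)]] bound [OF GH_TN [OF h2(1)]]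
        flip [OF subgrp_add [OF subgrp_TN emN dh [OF h2(1)]]]
      by (simp add: h1(2) h2(2) Gadd nu_simps der_emP [OF g])
    then have "sg r (n\<mu> (?G (D 2 x))) = - (n\<mu> (g x) + n\<mu> (?G (h2 (d x)))) + (- n\<mu> (g x) + n\<mu> (?G (h1 (d x))))"
      by (simp add: sg_add sg_diff)
    moreover have "n\<mu> (dD 2 (g x)) = - n\<mu> (g x)"
      using nu_dD_2 [OF GH_TN [OF g]] \<open>odd n\<close> by simp
    ultimately show "n\<mu> (dD 2 (g x)) - sg r (n\<mu> (?G (D 2 x))) = n\<mu> (g x) + ?b (d x)"
      by (simp add: algebra_simps)
  qed
qed

subsection \<open>Extending a coderivation by two components\<close>

text \<open>The instances \<open>n + 2\<close> and \<open>n + 3\<close> of \<open>bianchi\<close>.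
  Vanishing of the lower errors leaves only the summands with \<open>dD 1\<close>, and then those
  with \<open>dD 1\<close> and \<open>dD 2\<close>: the first remaining error is a cocycle, and its
  commutator with \<open>\<delta>\<^sub>2\<close> is the coboundary of the next error.\<close>

lemma Err_chain:
  assumes \<alpha>: "\<And>j. GH j l (\<alpha> j)" and E: "\<And>j x. j \<le> n \<Longrightarrow> Err l \<alpha> j x = 0"
  shows "dD 1 (Err l \<alpha> (Suc n) x) = sg (1 + l) (Err l \<alpha> (Suc n) (d x))"
    and "dD 1 (Err l \<alpha> (Suc (Suc n)) x) + dD 2 (Err l \<alpha> (Suc n) x)
      + sg l (Err l \<alpha> (Suc (Suc n)) (d x) + der (1 + l) (Err l \<alpha> (Suc n)) (D 2 x)) = 0"
proof -
  have z: "Ecal l \<alpha> j v = 0" if "j \<le> n" "v \<in> TT" for j v using Ecal_0 [OF \<alpha> E] that by blast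
  have D1: "D (Suc 0) x = emP (d x)" using D_1 by simp
  have f0: "dD 0 (Ecal l \<alpha> M (emP x)) + sg l (Ecal l \<alpha> M (dD 0 (emP x))) = 0" for M
    by (simp add: dD_0 is_derD [OF is_der_Ecal [OF \<alpha>]] additive.zero [OF is_derD(1) [OF is_der_Ecal [OF \<alpha>]]])
  let ?f = "\<lambda>M i. dD i (Ecal l \<alpha> (M - i) (emP x)) + sg l (Ecal l \<alpha> (M - i) (dD i (emP x)))"
  have "0 = (\<Sum>i\<le>Suc (Suc n). ?f (Suc (Suc n)) i)" by (rule bianchi [OF \<alpha>, symmetric]) simp
  also have "\<dots> = (\<Sum>i\<in>{1}. ?f (Suc (Suc n)) i)"
  proof (rule sum.mono_neutral_right)
    show "\<forall>i\<in>{..Suc (Suc n)} - {1}. ?f (Suc (Suc n)) i = 0"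
    proof
      fix i assume "i \<in> {..Suc (Suc n)} - {1}"
      then show "?f (Suc (Suc n)) i = 0" using f0 by (cases "i = 0") (auto simp: z)
    qed
  qed auto
  finally show "dD 1 (Err l \<alpha> (Suc n) x) = sg (1 + l) (Err l \<alpha> (Suc n) (d x))"
    by (simp add: Ecal_emP [OF \<alpha>] dD_emP D1 sg_sg [symmetric] eq_neg_iff_add_eq_0)
  have "0 = (\<Sum>i\<le>Suc (Suc (Suc n)). ?f (Suc (Suc (Suc n))) i)" by (rule bianchi [OF \<alpha>, symmetric]) simp
  also have "\<dots> = (\<Sum>i\<in>{1, 2}. ?f (Suc (Suc (Suc n))) i)"
  proof (rule sum.mono_neutral_right)
    show "\<forall>i\<in>{..Suc (Suc (Suc n))} - {1, 2}. ?f (Suc (Suc (Suc n))) i = 0"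
    proof
      fix i assume "i \<in> {..Suc (Suc (Suc n))} - {1, 2}"
      then show "?f (Suc (Suc (Suc n))) i = 0" using f0 by (cases "i = 0") (auto simp: z)
    qed
  qed auto
  finally show "dD 1 (Err l \<alpha> (Suc (Suc n)) x) + dD 2 (Err l \<alpha> (Suc n) x)
      + sg l (Err l \<alpha> (Suc (Suc n)) (d x) + der (1 + l) (Err l \<alpha> (Suc n)) (D 2 x)) = 0"
    by (simp add: Ecal_emP [OF \<alpha>] dD_emP D1 Ecal_eq_der [OF \<alpha>] GH_TT [OF D] sg_add add_ac numeral_2_eq_2)
qed

lemma Err_add_single:
  assumes \<alpha>: "\<And>j. GH j l (\<alpha> j)" and \<gamma>: "GH n l \<gamma>"
  defines "\<beta> \<equiv> \<lambda>j x. \<alpha> j x + (if j = n then \<gamma> x else 0)"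
  shows "GH j l (\<beta> j)"
    and "M \<le> n \<Longrightarrow> Err l \<beta> M x = Err l \<alpha> M x"
    and "Err l \<beta> (Suc n) x = Err l \<alpha> (Suc n) x + (dD 1 (\<gamma> x) - sg l (\<gamma> (d x)))"
    and "Err l \<beta> (Suc (Suc n)) x = Err l \<alpha> (Suc (Suc n)) x + (dD 2 (\<gamma> x) - sg l (der l \<gamma> (D 2 x)))"
proof -
  note e = Err_plus [OF \<alpha> GH_single [OF \<gamma>], folded \<beta>_def]
  show "GH j l (\<beta> j)" unfolding \<beta>_def by (rule GH_plus [OF \<alpha> GH_single [OF \<gamma>]])
  have z: "der l \<gamma> 0 = 0" by (rule additive.zero [OF is_derD(1) [OF is_der_der [OF \<gamma>]]])
  show "M \<le> n \<Longrightarrow> Err l \<beta> M x = Err l \<alpha> M x"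
    by (auto simp: e Err_single [OF \<gamma>] dD_0 GH_TT [OF \<gamma>] D_0 z)
  have D1: "D (Suc 0) x = emP (d x)" using D_1 by simp
  show "Err l \<beta> (Suc n) x = Err l \<alpha> (Suc n) x + (dD 1 (\<gamma> x) - sg l (\<gamma> (d x)))"
    by (simp add: e Err_single [OF \<gamma>] D1 der_emP [OF \<gamma>])
  show "Err l \<beta> (Suc (Suc n)) x = Err l \<alpha> (Suc (Suc n)) x + (dD 2 (\<gamma> x) - sg l (der l \<gamma> (D 2 x)))"
    by (simp add: e Err_single [OF \<gamma>] numeral_2_eq_2)
qed

lemma sg_Suc: "sg (1 + l) x = - sg l x" by (simp add: sg_def)

text \<open>The error in exponent \<open>Suc n\<close> is a cocycle by \<open>Err_chain\<close>. Its
  class is detected in \<open>Hom(P, A)\<close>, where \<open>eq\<close> makes it trivial, so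
  \<open>chain_lift\<close> supplies a component that cancels it.\<close>

lemma extend_by_component:
  assumes \<alpha>: "\<And>j. GH j l (\<alpha> j)" and E: "\<And>j x. j \<le> Suc n \<Longrightarrow> Err l \<alpha> j x = 0"
    and b: "AH (l - int (Suc n)) b" and eq: "\<And>x. n\<mu> (Err l \<alpha> (Suc (Suc n)) x) = b (d x)"
  obtains \<beta> where "\<And>j. GH j l (\<beta> j)" "\<And>j x. j \<le> Suc (Suc n) \<Longrightarrow> Err l \<beta> j x = 0" "\<And>j. j \<le> n \<Longrightarrow> \<beta> j = \<alpha> j"
proof -
  let ?m = "1 + l" and ?phi = "\<lambda>x. - Err l \<alpha> (Suc (Suc n)) x"
  have phi: "GH (Suc n) ?m ?phi" using GH_sg [OF GH_Err [OF \<alpha>], of "Suc n" 1] by simp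
  have chain: "dD 1 (?phi x) = sg ?m (?phi (d x))" for x
    using Err_chain(1) [OF \<alpha> E, of "Suc n"] by (simp add: additive.minus [OF is_derD(1) [OF is_der_dD]])
  have b': "AH (?m - 1 - int (Suc n)) (\<lambda>x. sg l (b x))" using AH_sg [OF b] by simp
  have nu: "n\<mu> (?phi x) = sg ?m (sg l (b (d x)))" for x by (simp add: nu_simps eq sg_Suc)
  obtain \<gamma> where \<gamma>: "GH (Suc n) (?m - 1) \<gamma>" "\<And>x. ?phi x = dD 1 (\<gamma> x) + sg ?m (\<gamma> (d x))"
    using chain_lift [OF phi chain b' nu] by metis
  have \<gamma>': "GH (Suc n) l \<gamma>" using \<gamma>(1) by simp
  note A = Err_add_single [OF \<alpha> \<gamma>']
  show thesis
  proof (rule that [of "\<lambda>j x. \<alpha> j x + (if j = Suc n then \<gamma> x else 0)"])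
    show "GH j l (\<lambda>x. \<alpha> j x + (if j = Suc n then \<gamma> x else 0))" for j by (rule A(1))
    fix j x assume "j \<le> Suc (Suc n)"
    then consider "j \<le> Suc n" | "j = Suc (Suc n)" by linarith
    then show "Err l (\<lambda>j x. \<alpha> j x + (if j = Suc n then \<gamma> x else 0)) j x = 0"
    proof cases
      case 1
      then show ?thesis using A(2) [OF 1] E by simp
    next
      case 2
      have "Err l \<alpha> (Suc (Suc n)) x = - (dD 1 (\<gamma> x) + sg ?m (\<gamma> (d x)))" using \<gamma>(2) [of x] by (metis minus_minus)
      then show ?thesis using A(3) [of x] by (simp add: 2 sg_Suc)
    qed
  qed auto
qed

text \<open>Errors up to index \<open>Suc n\<close> concern the tensor exponents up to
  \<open>n\<close>. The components up to \<open>n\<close> stay fixed, so that the iteration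
  stabilises.\<close>

lemma extend_by_two_components:
  assumes \<alpha>: "\<And>j. GH j l (\<alpha> j)" and E: "\<And>j x. j \<le> Suc n \<Longrightarrow> Err l \<alpha> j x = 0" and "even n"
  obtains \<beta> where "\<And>j. GH j l (\<beta> j)" "\<And>j x. j \<le> Suc (Suc (Suc n)) \<Longrightarrow> Err l \<beta> j x = 0" "\<And>j. j \<le> n \<Longrightarrow> \<beta> j = \<alpha> j"
proof -
  let ?N = "Suc n"
  let ?E = "Err l \<alpha> (Suc ?N)" and ?E' = "Err l \<alpha> (Suc (Suc ?N))"
  have oN: "odd ?N" using \<open>even n\<close> by simp
  note c = Err_chain [OF \<alpha> E]
  have GE: "GH ?N (1 + l) ?E" by (rule GH_Err [OF \<alpha>])
  have cyc: "n\<mu> (?E (d x)) = 0" for x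
  proof -
    have "n\<mu> (dD 1 (?E x)) = 0" by (rule nu_dD) (simp_all add: GH_TT [OF GE])
    then have "sg (1 + l) (n\<mu> (?E (d x))) = 0" using c(1) [of ?N x] by (simp add: nu_simps)
    then show ?thesis by (simp add: sg_def split: if_splits)
  qed
  obtain b1 where b1: "AH (1 + l - 1 - int ?N) b1"
    "\<And>x. n\<mu> (dD 2 (?E x)) - sg (1 + l) (n\<mu> (der (1 + l) ?E (D 2 x))) = n\<mu> (?E x) + b1 (d x)"
    using counit_defect [OF GE oN cyc] by metis
  let ?b = "\<lambda>x. sg 1 (b1 x + sg l (n\<mu> (?E' x)))"
  have GE': "GH (Suc ?N) (1 + l) ?E'" by (rule GH_Err [OF \<alpha>])
  have deg: "1 + l - int (Suc ?N) = l - int ?N" "1 + l - 1 - int ?N = l - int ?N" "l - 1 - int ?N = l - int (Suc ?N)"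
    by simp_all
  have b: "AH (l - int ?N) ?b"
    using b1(1) GH_nu [OF GE'] by (intro AH_sg AH_plus) (simp_all only: deg)
  \<comment> \<open>Under \<open>nu\<close> the second identity of \<open>Err_chain\<close> loses
    its term with \<open>dD 1\<close>; by \<open>counit_defect\<close> the terms with
    \<open>\<delta>\<^sub>2\<close> return the augmentation of the obstruction itself, up to a
    coboundary.\<close>
  have eq: "n\<mu> (?E x) = ?b (d x)" for x
  proof -
    have "n\<mu> (dD 1 (?E' x)) = 0" by (rule nu_dD) (simp_all add: GH_TT [OF GE'])
    then have "n\<mu> (dD 2 (?E x)) + sg l (n\<mu> (?E' (d x)) + n\<mu> (der (1 + l) ?E (D 2 x))) = 0"
      using arg_cong [OF c(2) [of ?N x], of "n\<mu>"] by (simp add: nu_simps)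
    then have "n\<mu> (?E x) + b1 (d x) + sg l (n\<mu> (?E' (d x))) = 0"
      using b1(2) [of x] by (simp add: sg_Suc sg_add algebra_simps)
    then have "n\<mu> (?E x) = - (b1 (d x) + sg l (n\<mu> (?E' (d x))))"
      by (simp only: add.assoc eq_neg_iff_add_eq_0)
    then show ?thesis by simp
  qed
  obtain \<alpha>1 where a1: "\<And>j. GH j l (\<alpha>1 j)" "\<And>j x. j \<le> Suc ?N \<Longrightarrow> Err l \<alpha>1 j x = 0" "\<And>j. j \<le> n \<Longrightarrow> \<alpha>1 j = \<alpha> j"
    using extend_by_component [OF \<alpha> E b eq] by metis
  let ?F = "Err l \<alpha>1 (Suc (Suc ?N))"
  have GF: "GH (Suc ?N) (1 + l) ?F" by (rule GH_Err [OF a1(1)])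
  have cF: "AH (l - int ?N) (\<lambda>x. n\<mu> (?F x))" using GH_nu [OF GF] by (simp only: deg)
  have cycF: "n\<mu> (?F (d x)) = 0" for x
  proof -
    have "n\<mu> (dD 1 (?F x)) = 0" by (rule nu_dD) (simp_all add: GH_TT [OF GF])
    then have "sg (1 + l) (n\<mu> (?F (d x))) = 0" using Err_chain(1) [OF a1(1,2), of "Suc ?N" x] by (simp add: nu_simps)
    then show ?thesis by (simp add: sg_def split: if_splits)
  qed
  \<comment> \<open>Preparation for \<open>chain_lift\<close> with \<phi> = 0: it yields a cocycle
    \<open>e\<close> whose augmentation is the negative of that of the next obstruction
    \<open>?F\<close>, which is a cocycle by \<open>cycF\<close>.\<close>
  have "AH (1 + l - 1 - int ?N) (\<lambda>x. sg 1 (n\<mu> (?F x)))" unfolding deg by (rule AH_sg [OF cF])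
  moreover have "dD 1 0 = sg (1 + l) 0" by simp
  moreover have "n\<mu> 0 = sg (1 + l) (sg 1 (n\<mu> (?F (d x))))" for x by (simp add: cycF)
  ultimately obtain e where e: "GH ?N (1 + l - 1) e" "\<And>x. 0 = dD 1 (e x) + sg (1 + l) (e (d x))"
    "\<And>x. n\<mu> (e x) = sg 1 (n\<mu> (?F x))"
    using chain_lift [OF GH_0, of "1 + l" n "\<lambda>x. sg 1 (n\<mu> (?F x))"] by metis
  have e': "GH ?N l e" using e(1) by simp
  note A = Err_add_single [OF a1(1) e']
  let ?\<alpha>2 = "\<lambda>j x. \<alpha>1 j x + (if j = ?N then e x else 0)"
  have E2: "Err l ?\<alpha>2 j x = 0" if "j \<le> Suc ?N" for j x
  proof (cases "j = Suc ?N")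
    case True
    then show ?thesis using A(3) [of x] e(2) [of x] a1(2) [of "Suc ?N" x] by (simp add: sg_Suc)
  next
    case False
    then show ?thesis using A(2) [of j x] a1(2) [of j x] that by simp
  qed
  obtain b2 where b2: "AH (l - 1 - int ?N) b2"
    "\<And>x. n\<mu> (dD 2 (e x)) - sg l (n\<mu> (der l e (D 2 x))) = n\<mu> (e x) + b2 (d x)"
    using counit_defect [OF e' oN] e(3) cycF by (metis sg_simps(1))
  have b2': "AH (l - int (Suc ?N)) b2" using b2(1) by (simp only: deg)
  \<comment> \<open>The augmentation of \<open>e\<close>, returned by \<open>counit_defect\<close>,
    cancels that of \<open>?F\<close>; a coboundary is left.\<close>
  have eq2: "n\<mu> (Err l ?\<alpha>2 (Suc (Suc ?N)) x) = b2 (d x)" for x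
    unfolding A(4) using b2(2) [of x] e(3) [of x] by (simp add: nu_simps)
  show thesis
  proof (rule extend_by_component [OF A(1) E2 b2' eq2])
    fix \<beta> assume "\<And>j. GH j l (\<beta> j)" "\<And>j x. j \<le> Suc (Suc ?N) \<Longrightarrow> Err l \<beta> j x = 0" "\<And>j. j \<le> ?N \<Longrightarrow> \<beta> j = ?\<alpha>2 j"
    then show thesis using a1(3) by (intro that [of \<beta>]) auto
  qed
qed

lemma coderivation_exists:
  assumes f: "GH 0 l f" and fd: "\<And>x. f (d x) = 0"
  obtains \<alpha> where "\<And>j. GH j l (\<alpha> j)" "\<And>j x. Err l \<alpha> j x = 0" "\<alpha> 0 = f"
proof -
  define Pr where "Pr k \<alpha> \<longleftrightarrow> (\<forall>j. GH j l (\<alpha> j)) \<and> (\<forall>j\<le>Suc (2 * k). \<forall>x. Err l \<alpha> j x = 0) \<and> \<alpha> 0 = f" for k \<alpha>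
  define Qr where "Qr k \<alpha> \<beta> \<longleftrightarrow> (\<forall>j\<le>2 * k. \<beta> j = \<alpha> j)" for k :: nat and \<alpha> \<beta> :: "nat \<Rightarrow> 'p \<Rightarrow> ('k, 'a, 'p) tv"
  \<comment> \<open>Only the error indices 0 and 1 are concerned; the latter is the chain map
    condition \<open>fd\<close>.\<close>
  have "Pr 0 (\<lambda>j x. if j = 0 then f x else 0)"
  proof -
    have D1: "D (Suc 0) x = emP (d x)" for x using D_1 by simp
    have "dD (Suc 0) (f x) = 0" for x
      by (rule TN_0_eq [OF is_derD(1) [OF is_der_dD], of "\<lambda>v. 0"]) (auto intro: additiveI GH_TN [OF f])
    then show ?thesis
      unfolding Pr_def using GH_single [OF f] additive.zero [OF is_derD(1) [OF is_der_der [OF f]]]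
      by (auto simp: Err_single [OF f] le_Suc_eq D_0 dD_0 GH_TT [OF f] D1 der_emP [OF f] fd)
  qed
  moreover have "\<exists>\<beta>. Pr (Suc k) \<beta> \<and> Qr k \<alpha> \<beta>" if \<alpha>: "Pr k \<alpha>" for k \<alpha>
  proof -
    have "GH j l (\<alpha> j)" "j \<le> Suc (2 * k) \<Longrightarrow> Err l \<alpha> j x = 0" "\<alpha> 0 = f" for j x
      using \<alpha> unfolding Pr_def by blast+
    then obtain \<beta> where "\<And>j. GH j l (\<beta> j)" "\<And>j x. j \<le> Suc (Suc (Suc (2 * k))) \<Longrightarrow> Err l \<beta> j x = 0"
      "\<And>j. j \<le> 2 * k \<Longrightarrow> \<beta> j = \<alpha> j"
      using extend_by_two_components [of l \<alpha> "2 * k"] by (metis even_mult_iff even_numeral)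
    then show ?thesis using \<open>\<alpha> 0 = f\<close> unfolding Pr_def Qr_def by (intro exI [of _ \<beta>]) simp
  qed
  ultimately obtain A where A: "\<And>k. Pr k (A k)" "\<And>k. Qr k (A k) (A (Suc k))"
    using dependent_nat_choice [of Pr Qr] by metis
  \<comment> \<open>Stage \<open>k\<close> freezes the components up to \<open>2 * k\<close>, so the
    component \<open>j\<close> no longer changes from stage \<open>j\<close> on, and the diagonal is
    a limit.\<close>
  have stable: "A (j + i) j = A j j" for i j
    by (induction i) (use A(2) in \<open>auto simp: Qr_def\<close>)
  show thesis
  proof (rule that [of "\<lambda>j. A j j"])
    show "GH j l (A j j)" for j using A(1) unfolding Pr_def by blast
    show "A 0 0 = f" using A(1) unfolding Pr_def by blast
    fix j x
    have "Err l (\<lambda>j. A j j) j x = Err l (A j) j x"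
      by (rule Err_cong) (metis stable le_add_diff_inverse)
    also have "\<dots> = 0" using A(1) [of j] unfolding Pr_def by simp
    finally show "Err l (\<lambda>j. A j j) j x = 0" .
  qed
qed

end

context tensor_powers
begin

subsection \<open>Comparison with the cosets\<close>

lemma subgrp_NN: "subgrp NN"
  unfolding tens_null_def by (rule subgrp_group_closure)

text \<open>The translation between vectors and cosets; \<open>cls\<close> and \<open>rep\<close>
  are mutually inverse between \<open>TT\<close> and the cosets of \<open>NN\<close>.\<close>

definition cls :: "('k, 'a, 'p) tv \<Rightarrow> ('a, 'p) tens" where "cls v = lower v +o NN"
definition rep :: "('a, 'p) tens \<Rightarrow> ('k, 'a, 'p) tv" where "rep X = vec (SOME u. u \<in> X)"

lemma mem_cls: "u \<in> cls v \<longleftrightarrow> vec u = rho v"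
  unfolding cls_def coset_mem [OF subgrp_NN] rho_def vec_eq_iff cong_def by (rule refl)

lemma lower_mem_cls: "lower v \<in> cls v" by (simp add: mem_cls rho_def)

lemma cls_eqI: "rho v = rho w \<Longrightarrow> cls v = cls w" by (rule set_eqI) (simp add: mem_cls)

lemma cls_vec: "cls (vec u) = u +o NN"
  unfolding cls_def coset_eq_iff [OF subgrp_NN] using lower_vec unfolding cong_def .

lemma rep_cls: "rep (cls v) = rho v"
  unfolding rep_def using someI [of "\<lambda>u. u \<in> cls v", OF lower_mem_cls] mem_cls by simp

lemma rep_cls_TT [simp]: "v \<in> TT \<Longrightarrow> rep (cls v) = v" by (simp add: rep_cls rho_id)

lemma cls_inj: "v \<in> TT \<Longrightarrow> w \<in> TT \<Longrightarrow> cls v = cls w \<Longrightarrow> v = w"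
  using rep_cls_TT by metis

lemma cls_add: "cls v + cls w = cls (v + w)"
proof -
  have "(lower v + lower w) +o NN = lower (v + w) +o NN"
    unfolding coset_eq_iff [OF subgrp_NN] using cong_sym [OF lower_add] unfolding cong_def .
  then show ?thesis by (simp add: cls_def coset_add [OF subgrp_NN])
qed

lemma cls_0: "cls 0 = NN"
  by (simp add: cls_def lower_0)

lemma sgn_tens_cls: "sgn_tens l (cls v) = cls (sg l v)"
proof -
  have "uminus ` cls v = cls (- v)"
  proof (intro set_eqI iffI)
    fix u assume "u \<in> uminus ` cls v"
    then show "u \<in> cls (- v)" by (auto simp: mem_cls vec.minus additive.minus [OF additive_rho])
  next
    fix u assume "u \<in> cls (- v)"
    then have "- u \<in> cls v" by (simp add: mem_cls vec.minus additive.minus [OF additive_rho])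
    then show "u \<in> uminus ` cls v" by force
  qed
  then show ?thesis by (simp add: sgn_tens_def sg_def)
qed

text \<open>An empty sum of sets is \<open>{0}\<close>, in general not the zero coset
  \<open>NN\<close>; hence the index set must be nonempty.\<close>

lemma cls_sum:
  assumes "finite I" "I \<noteq> {}" shows "(\<Sum>i\<in>I. cls (f i)) = cls (\<Sum>i\<in>I. f i)"
  using assms by (induction I rule: finite_ne_induct) (simp_all add: cls_add)

lemma pure_cls: "pure P a xs = cls (wd a xs)" by (simp add: pure_def wd_def cls_vec)
lemma emb0_cls: "emb0 P a = cls (emA a)" and emb1_cls: "emb1 P x = cls (emP x)"
  by (simp_all add: emb0_def emb1_def pure_cls)

lemma coset_image: "{u +o NN | u. \<forall>w\<in>Poly_Mapping.keys u. w \<in> W} = cls ` spn W"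
  unfolding spn_def image_image by (auto simp: cls_vec subset_iff)

lemma carrier_tens: "carrier (tens_power P n) = cls ` TN n"
  using coset_image [of "{(a, xs). length xs = n}"] by (simp add: tens_power_def TN_def)

lemma hcomp_tens: "hcomp (tens_power P n) i = cls ` TH n i"
  using coset_image [of "{(a, xs). length xs = n \<and> hl xs i}"] by (simp add: tens_power_def TH_def hl_def)

definition mulF :: "(('a \<times> 'p list) \<Rightarrow>\<^sub>0 int) \<Rightarrow> (('a \<times> 'p list) \<Rightarrow>\<^sub>0 int) \<Rightarrow> (('a \<times> 'p list) \<Rightarrow>\<^sub>0 int)" where
  "mulF u v = frag_extend (\<lambda>w. frag_extend (\<lambda>w'. frag_of (word_mult P w w')) v) u"

lemma vec_mulF: "vec (mulF u v) = vec u \<odot> vec v"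
proof -
  have 1: "vec (frag_of (word_mult P (a, xs) (b, ys))) = wd a xs \<odot> wd b ys" for a xs b ys
    unfolding tm_wd mw_def unfolding wd_def by simp
  have 2: "vec (frag_extend (\<lambda>w'. frag_of (word_mult P w w')) v) = vec (frag_of w) \<odot> vec v" for w
  proof -
    obtain a xs where w: "w = (a, xs)" by (cases w)
    have "Poly_Mapping.keys v \<subseteq> UNIV" by simp
    then show ?thesis
    proof (induction v rule: frag_induction)
      case (one w')
      then show ?case using 1 by (cases w') (simp add: w wd_def)
    qed (simp_all add: vec.zero frag_extend_diff vec.diff tm_diff)
  qed
  have "Poly_Mapping.keys u \<subseteq> UNIV" by simp
  then show ?thesis
    by (induction u rule: frag_induction)
       (simp_all add: mulF_def vec.zero frag_extend_diff vec.diff tm_diff 2)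
qed

lemma tens_mult_cls: "tens_mult P (cls X) (cls Y) = cls (X \<odot> Y)"
proof -
  have "mulF u v +o NN = cls (X \<odot> Y)" if "u \<in> cls X" "v \<in> cls Y" for u v
    using that unfolding cls_vec [symmetric] vec_mulF mem_cls
    by (intro cls_eqI) (simp add: rho_tm)
  then have "(\<Union>u\<in>cls X. \<Union>v\<in>cls Y. mulF u v +o NN) = (\<Union>u\<in>cls X. \<Union>v\<in>cls Y. cls (X \<odot> Y))" by simp
  also have "\<dots> = cls (X \<odot> Y)" using lower_mem_cls by blast
  finally show ?thesis unfolding tens_mult_def mulF_def .
qed

lemma graded_hom_cls: "GH n l g \<Longrightarrow> graded_hom P (tens_power P n) l (\<lambda>x. cls (g x))"
  unfolding graded_hom_def bimod_hom_def carrier_tens hcomp_tens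
  by (auto simp: GH_TN additive.add [OF GHD(1)] cls_add GHD(2,3) tens_power_def emb0_cls tens_mult_cls intro: GHD(4))

lemma graded_hom_rep:
  assumes g: "graded_hom P (tens_power P n) l g"
  shows "GH n l (\<lambda>x. rep (g x))" and "g x = cls (rep (g x))"
proof -
  have cls: "\<exists>v\<in>TN n. g x = cls v" for x
  proof -
    have "g x \<in> cls ` TN n" using g unfolding graded_hom_def bimod_hom_def carrier_tens by simp
    then show ?thesis by blast
  qed
  then show eq: "g x = cls (rep (g x))" for x using TN_TT rep_cls_TT by metis
  have TT: "rep (g x) \<in> TT" for x using cls [of x] TN_TT by auto
  show "GH n l (\<lambda>x. rep (g x))"
    unfolding GH_def
  proof (intro conjI allI ballI)
    show "additive (\<lambda>x. rep (g x))"
    proof (rule additiveI)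
      fix x y
      have "cls (rep (g (x + y))) = cls (rep (g x)) + cls (rep (g y))"
        using g unfolding graded_hom_def bimod_hom_def eq [symmetric] by simp
      then show "rep (g (x + y)) = rep (g x) + rep (g y)"
        unfolding cls_add by (intro cls_inj) (simp_all add: TT subgrp_add [OF subgrp_spn])
    qed
    fix a x
    have "cls (rep (g (la a x))) = tens_mult P (cls (emA a)) (cls (rep (g x)))"
      "cls (rep (g (ra x a))) = tens_mult P (cls (rep (g x))) (cls (emA a))"
      using g unfolding graded_hom_def bimod_hom_def eq [symmetric] emb0_cls [symmetric]
      by (simp_all add: tens_power_def)
    then show "rep (g (la a x)) = emA a \<odot> rep (g x)" "rep (g (ra x a)) = rep (g x) \<odot> emA a"
      unfolding tens_mult_cls by (auto intro: cls_inj TT tm_TT)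
  next
    fix i x assume "x \<in> Pc i"
    then have "g x \<in> cls ` TH n (i + l)" using g unfolding graded_hom_def hcomp_tens by simp
    then obtain v where "g x = cls v" "v \<in> TH n (i + l)" by blast
    then show "rep (g x) \<in> TH n (i + l)" by (simp add: TH_TT)
  qed
qed

lemma wd_append: "wd a (xs @ ys) = wd a xs \<odot> wd 1 ys"
proof (cases "xs = []")
  case False
  have "butlast xs @ last xs # ys = (butlast xs @ [last xs]) @ ys" by (simp only: append_assoc append_Cons append_Nil)
  also have "\<dots> = xs @ ys" using False by simp
  finally have "butlast xs @ last xs # ys = xs @ ys" .
  then show ?thesis unfolding tm_wd mw_def act(8) using False by (simp only: if_False)
qed (simp add: tm_wd)

text \<open>\<open>tens_map\<close> is a choice. The map \<open>H\<close> shows that its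
  specification is satisfiable, and the specification fixes the values on the carrier, since
  homogeneous words split into products of homogeneous words.\<close>

lemma tens_map_cls:
  assumes H: "additive H"
    and f: "\<And>X i. X \<in> TH m i \<Longrightarrow> f (cls X) = cls (f' X)"
    and g: "\<And>Y. Y \<in> TN n \<Longrightarrow> g (cls Y) = cls (g' Y)"
    and fg: "\<And>X Y i. X \<in> TH m i \<Longrightarrow> Y \<in> TN n \<Longrightarrow> H (X \<odot> Y) = sg (l * i) (f' X \<odot> g' Y)"
    and Z: "Z \<in> TN (m + n)"
  shows "tens_map P m n l f g (cls Z) = cls (H Z)"
proof -
  define spec where "spec h \<longleftrightarrow>
     (\<forall>X\<in>carrier (tens_power P (m + n)). \<forall>Y\<in>carrier (tens_power P (m + n)). h (X + Y) = h X + h Y) \<and>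
     (\<forall>i. \<forall>x\<in>hcomp (tens_power P m) i. \<forall>y\<in>carrier (tens_power P n).
        h (tens_mult P x y) = sgn_tens (l * i) (tens_mult P (f x) (g y)))" for h :: "('a, 'p) tens \<Rightarrow> ('a, 'p) tens"
  have "spec (\<lambda>X. cls (H (rep X)))"
    unfolding spec_def carrier_tens hcomp_tens
    by (auto simp: cls_add TN_TT subgrp_add [OF subgrp_spn] additive.add [OF H] tens_mult_cls f g fg sgn_tens_cls)
  then have spec: "spec (tens_map P m n l f g)"
    unfolding tens_map_def spec_def [symmetric] by (rule someI [of spec])
  define h where "h = tens_map P m n l f g"
  have add: "h (cls (v + w)) = h (cls v) + h (cls w)" if "v \<in> TN (m + n)" "w \<in> TN (m + n)" for v w
    using spec that unfolding spec_def carrier_tens h_def [symmetric] by (simp add: cls_add)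
  have tm: "h (cls (X \<odot> Y)) = cls (H (X \<odot> Y))" if "X \<in> TH m i" "Y \<in> TN n" for X Y i
    using spec that unfolding spec_def carrier_tens hcomp_tens h_def [symmetric]
    by (simp add: tens_mult_cls [symmetric] fg sgn_tens_cls f g) (simp add: tens_mult_cls sgn_tens_cls)
  have "h (cls Z) = cls (H Z)"
  proof (rule TN_hom_induct [OF _ _ _ Z])
    \<comment> \<open>Zero is treated as a product: values of \<open>h\<close> are sets, where
      additivity alone does not determine the value at zero.\<close>
    show "h (cls 0) = cls (H 0)" using tm [OF TH_0 subgrp_0 [OF subgrp_TN]] by simp
    show "h (cls (v + w)) = cls (H (v + w))"
      if "v \<in> TN (m + n)" "w \<in> TN (m + n)" "h (cls v) = cls (H v)" "h (cls w) = cls (H w)" for v w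
      using that by (simp add: add additive.add [OF H] cls_add)
    fix a xs i assume len: "length xs = m + n" and hl: "hl xs i"
    then obtain ys zs where xs: "xs = ys @ zs" "length ys = m" "length zs = n"
      by (metis append_take_drop_id add_diff_cancel_left' le_add1 length_drop length_take min.absorb2)
    then obtain j where "hl ys j" using hl by (auto simp: hl_append)
    then show "h (cls (wd a xs)) = cls (H (wd a xs))"
      unfolding xs(1) wd_append using tm [OF wd_TH [OF xs(2)] wd_TN [OF xs(3)]] by blast
  qed
  then show ?thesis by (simp add: h_def)
qed

definition unP :: "('k, 'a, 'p) tv \<Rightarrow> 'p" where
  "unP = ext (\<lambda>a xs. case xs of [x] \<Rightarrow> la a x | _ \<Rightarrow> 0)"

lemma balanced_unP: "balanced (\<lambda>a xs. case xs of [x] \<Rightarrow> la a x | _ \<Rightarrow> 0)"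
proof -
  have "(case xs @ (x + y) # zs of [x] \<Rightarrow> la a x | _ \<Rightarrow> 0) =
      (case xs @ x # zs of [x] \<Rightarrow> la a x | _ \<Rightarrow> 0) + (case xs @ y # zs of [x] \<Rightarrow> la a x | _ \<Rightarrow> 0)" for a xs x y zs
    by (cases xs; cases zs; cases "tl xs") (auto simp: act split: list.split)
  moreover have "(case xs @ x # y # zs of [x] \<Rightarrow> la a x | _ \<Rightarrow> 0) = 0" for a xs x y zs
    by (cases xs; cases "tl xs") (auto split: list.split)
  ultimately show ?thesis
    unfolding balanced_def by (auto simp: act split: list.split)
qed

lemma unP_emP [simp]: "unP (emP x) = x"
  unfolding unP_def by (simp add: ext_wd [OF balanced_unP] act)

lemma additive_unP: "additive unP" unfolding unP_def by (rule additive_ext [OF balanced_unP])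

lemma emP_unP: assumes "v \<in> TN 1" shows "emP (unP v) = v"
proof (rule additive_TN_eq [OF _ _ _ assms])
  fix a and xs :: "'p list" assume "length xs = 1"
  then obtain x where "xs = [x]" by (cases xs) auto
  then show "emP (unP (wd a xs)) = wd a xs"
    using wd_rel(3) [of 1 a x "[]"] by (simp add: unP_def ext_wd [OF balanced_unP] act)
qed (auto intro!: additiveI simp: additive.add [OF additive_unP] additive.add [OF additive_emP])

lemma unP_Pc: assumes "v \<in> TH 1 i" shows "unP v \<in> Pc i"
proof (rule additive_TH_mem [OF additive_unP Pc_subgrp _ assms])
  fix a and xs :: "'p list" assume "length xs = 1" "hl xs i"
  then obtain x where "xs = [x]" "x \<in> Pc i" by (cases xs) (auto simp: hl_Cons)
  then show "unP (wd a xs) \<in> Pc i" by (simp add: unP_def ext_wd [OF balanced_unP] Pc_la)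
qed

lemma inv_emb1: assumes "v \<in> TN 1" shows "inv (emb1 P) (cls v) = unP v"
proof (rule inv_f_eq)
  show "inj (emb1 P)"
  proof (rule injI)
    fix x y assume "emb1 P x = emb1 P y"
    then have "emP x = emP y" unfolding emb1_cls by (rule cls_inj [rotated 2]) simp_all
    then show "x = y" using unP_emP by metis
  qed
  show "emb1 P (unP v) = cls v" by (simp add: emb1_cls emP_unP [OF assms])
qed

text \<open>The signs that \<open>ins\<close> collects letter by letter combine into the single
  Koszul sign of the whole left factor, as \<open>tens_map\<close> demands.\<close>

lemma insV_tm:
  assumes g: "GH k l g" and X: "X \<in> TH r i" and Y: "Y \<in> TN (Suc t)"
  shows "insV r l g (X \<odot> Y) = sg (l * i) (X \<odot> insV 0 l g Y)"
proof -
  note add = additive.add [OF additive_insV [OF g]]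
  have step: "ins r l g a (xs @ ys) = sg (l * i) (wd a xs \<odot> ins 0 l g 1 ys)" if "length xs = r" "hl xs i" for a xs ys r i
    using that
  proof (induction xs arbitrary: a r i)
    case Nil
    then show ?case using ins_emA [of 0 l g a 1 ys] by simp
  next
    case (Cons x xs)
    then obtain j where j: "x \<in> Pc j" "hl xs (i - j)" by (auto simp: hl_Cons)
    obtain r' where r: "r = Suc r'" "length xs = r'" using Cons.prems by auto
    have "ins r l g a ((x # xs) @ ys) = emA a \<odot> (emP (sg (l * j) x) \<odot> sg (l * (i - j)) (wd 1 xs \<odot> ins 0 l g 1 ys))"
      by (simp only: r(1) append_Cons ins.simps(2) list.case Cons.IH [OF r(2) j(2)] tau_hom [OF j(1)])
    also have "\<dots> = sg (l * j + l * (i - j)) (emA a \<odot> (emP x \<odot> (wd 1 xs \<odot> ins 0 l g 1 ys)))"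
      by (simp only: sg_additive [OF additive_emP] tm_sg sg_sg add.commute)
    also have "l * j + l * (i - j) = l * i" by (simp add: right_diff_distrib)
    also have "emA a \<odot> (emP x \<odot> (wd 1 xs \<odot> ins 0 l g 1 ys)) = wd a (x # xs) \<odot> ins 0 l g 1 ys"
      by (simp only: tm_assoc wd_Cons [of a x xs])
    finally show ?case .
  qed
  show ?thesis
  proof (rule additive_TH_eq [OF _ _ _ X])
    fix a and xs :: "'p list" assume xs: "length xs = r" "hl xs i"
    show "insV r l g (wd a xs \<odot> Y) = sg (l * i) (wd a xs \<odot> insV 0 l g Y)"
    proof (rule additive_TN_eq [OF _ _ _ Y])
      fix b and ys :: "'p list" assume "length ys = Suc t"
      then obtain y zs where "ys = y # zs" by (cases ys) auto
      then have "wd b ys = wd 1 (la b y # zs)" using wd_rel(3) [of 1 b y zs] by simp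
      then show "insV r l g (wd a xs \<odot> wd b ys) = sg (l * i) (wd a xs \<odot> insV 0 l g (wd b ys))"
        by (simp only: wd_append [symmetric] insV_wd [OF g] step [OF xs])
    qed (auto intro!: additiveI simp: add tm_add sg_add)
  qed (auto intro!: additiveI simp: add tm_add sg_add)
qed

lemma insV_0_tm:
  assumes g: "GH k l g" and Y: "Y \<in> TT" shows "insV 0 l g (emP x \<odot> Y) = g x \<odot> Y"
proof (rule additive_spn_eq [OF _ _ _ Y])
  show "insV 0 l g (emP x \<odot> wd a xs) = g x \<odot> wd a xs" for a xs
    using emA_wd [of a 1 xs] by (simp add: tm_wd mw_def insV_wd [OF g] GHD(3) [OF g] tm_assoc)
qed (auto intro!: additiveI simp: additive.add [OF additive_insV [OF g]] tm_add)

lemma insert_map_cls: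
  assumes g: "GH k l g" and Z: "Z \<in> TN (r + (1 + t))"
  shows "insert_map P r t l (\<lambda>x. cls (g x)) (cls Z) = cls (insV r l g Z)"
proof -
  have inner: "tens_map P 1 t 0 ((\<lambda>x. cls (g x)) \<circ> inv (emb1 P)) id (cls Y) = cls (insV 0 l g Y)" if "Y \<in> TN (1 + t)" for Y
  proof (rule tens_map_cls [OF additive_insV [OF g], where f' = "\<lambda>X. g (unP X)" and g' = "\<lambda>Y. Y", OF _ _ _ that])
    show "((\<lambda>x. cls (g x)) \<circ> inv (emb1 P)) (cls X) = cls (g (unP X))" if "X \<in> TH 1 i" for X i
      by (simp add: inv_emb1 [OF TH_TN [OF that]])
    show "insV 0 l g (X \<odot> Y) = sg (0 * i) (g (unP X) \<odot> Y)" if "X \<in> TH 1 i" "Y \<in> TN t" for X Y i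
      using insV_0_tm [OF g TN_TT [OF that(2)], of "unP X"] emP_unP [OF TH_TN [OF that(1)]] by simp
  qed simp
  show ?thesis
    unfolding insert_map_def
  proof (rule tens_map_cls [OF additive_insV [OF g], where f' = "\<lambda>X. X" and g' = "insV 0 l g", OF _ inner _ Z])
    show "insV r l g (X \<odot> Y) = sg (l * i) (X \<odot> insV 0 l g Y)" if "X \<in> TH r i" "Y \<in> TN (1 + t)" for X Y i
      using insV_tm [OF g that(1), of Y t] that(2) by simp
  qed simp_all
qed

text \<open>For fixed \<open>i\<close> the index \<open>r\<close> runs through all
  \<open>Suc N - i\<close> positions of the tensor power where the values of \<open>b\<close> lie,
  so the sum over \<open>r\<close> is the derivation extending \<open>g i\<close>.\<close>

lemma sum_insert_map:
  assumes g: "\<And>j. GH j l (g j)" and b: "\<And>j. b j \<in> TN j"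
  shows "(\<Sum>(r, i, t)\<in>{(r, i, t). r + i + t = N}. insert_map P r t l (\<lambda>x. cls (g i x)) (cls (b (N - i + 1)))) =
    cls (\<Sum>i\<le>N. der l (g i) (b (Suc N - i)))"
proof -
  let ?I = "{(r, i, t). r + i + t = N}"
  have I: "finite ?I" by (rule finite_subset [of _ "{..N} \<times> {..N} \<times> {..N}"]) auto
  have "(0, 0, N) \<in> ?I" by simp
  then have ne: "?I \<noteq> {}" by blast
  have "(\<Sum>(r, i, t)\<in>?I. insert_map P r t l (\<lambda>x. cls (g i x)) (cls (b (N - i + 1)))) =
     (\<Sum>(r, i, t)\<in>?I. cls (insV r l (g i) (b (N - i + 1))))"
  proof (rule sum.cong [OF refl], clarify)
    fix r i t assume "N = r + i + t"
    then have "b (r + i + t - i + 1) \<in> TN (r + (1 + t))" using b [of "r + (1 + t)"] by simp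
    then show "insert_map P r t l (\<lambda>x. cls (g i x)) (cls (b (r + i + t - i + 1))) = cls (insV r l (g i) (b (r + i + t - i + 1)))"
      by (rule insert_map_cls [OF g])
  qed
  also have "\<dots> = cls (\<Sum>(r, i, t)\<in>?I. insV r l (g i) (b (N - i + 1)))"
    using cls_sum [OF I ne, of "\<lambda>(r, i, t). insV r l (g i) (b (N - i + 1))"] by (simp add: case_prod_unfold)
  also have "(\<Sum>(r, i, t)\<in>?I. insV r l (g i) (b (N - i + 1))) =
     (\<Sum>(i, r)\<in>Sigma {..N} (\<lambda>i. {..<Suc N - i}). insV r l (g i) (b (Suc N - i)))"
    by (rule sum.reindex_bij_witness [where i = "\<lambda>(i, r). (r, i, N - i - r)" and j = "\<lambda>(r, i, t). (i, r)"])
       (auto simp: Suc_diff_le)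
  also have "\<dots> = (\<Sum>i\<le>N. \<Sum>r<Suc N - i. insV r l (g i) (b (Suc N - i)))"
    by (rule sum.Sigma [symmetric]) auto
  also have "\<dots> = (\<Sum>i\<le>N. der l (g i) (b (Suc N - i)))"
    by (simp add: der_insV [OF g b])
  finally show ?thesis .
qed

end

section \<open>The tensor powers of the counit with their signs\<close>

context augmentation
begin

text \<open>
  As \<open>\<mu>\<close> is odd, its tensor powers differ from the multiplicative map \<open>nu \<mu>\<close> by the sign
  \<open>(-1)\<^bsup>n(n-1)/2\<^esup>\<close>.
\<close>

primrec sn :: "nat \<Rightarrow> int" where "sn 0 = 0" | "sn (Suc n) = sn n + int n"

lemma map_power_cls:
  assumes deg: "\<And>x i. x \<in> Pc i \<Longrightarrow> i \<noteq> 1 \<Longrightarrow> \<mu> x = 0"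
  shows "Z \<in> TN n \<Longrightarrow> map_power P (-1) \<mu> n (cls Z) = cls (emA (sg (sn n) (n\<mu> Z)))"
proof (induction n arbitrary: Z)
  case 0
  have "Z = emA (n\<mu> Z)"
    by (rule additive_TN_eq [OF _ _ _ 0])
       (auto intro!: additiveI simp: nu_simps additive.add [OF additive_emA])
  then show ?case by simp
next
  case (Suc n)
  have Z: "Z \<in> TN (1 + n)" using Suc.prems by simp
  have "tens_map P 1 n (int n * -1) (emb0 P \<circ> \<mu> \<circ> inv (emb1 P)) (map_power P (-1) \<mu> n) (cls Z) =
      cls (emA (sg (sn (Suc n)) (n\<mu> Z)))"
  proof (rule tens_map_cls [where H = "\<lambda>Z. emA (sg (sn (Suc n)) (n\<mu> Z))" and f' = "\<lambda>X. emA (\<mu> (unP X))"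
        and g' = "\<lambda>Y. emA (sg (sn n) (n\<mu> Y))", OF _ _ Suc.IH _ Z])
    show "additive (\<lambda>Z. emA (sg (sn (Suc n)) (n\<mu> Z)))"
      by (auto intro!: additiveI simp: nu_simps sg_add additive.add [OF additive_emA])
    show "(emb0 P \<circ> \<mu> \<circ> inv (emb1 P)) (cls X) = cls (emA (\<mu> (unP X)))" if "X \<in> TH 1 i" for X i
      by (simp add: inv_emb1 [OF TH_TN [OF that]] emb0_cls)
    show "emA (sg (sn (Suc n)) (n\<mu> (X \<odot> Y))) = sg (int n * -1 * i) (emA (\<mu> (unP X)) \<odot> emA (sg (sn n) (n\<mu> Y)))"
      if X: "X \<in> TH 1 i" and Y: "Y \<in> TN n" for X Y i
    proof -
      have "n\<mu> X = \<mu> (unP X)" using emP_unP [OF TH_TN [OF X]] nu_emP by metis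
      then have nu: "n\<mu> (X \<odot> Y) = \<mu> (unP X) * n\<mu> Y" by (simp add: nu_tm TH_TT [OF X] TN_TT [OF Y])
      show ?thesis
      \<comment> \<open>Only degree 1 contributes, and there moving \<open>n\<close> copies of \<mu>
        past one letter costs \<open>(-1)^n\<close>, the increment of \<open>sn\<close>.\<close>
      proof (cases "i = 1")
        case True
        then show ?thesis
          by (simp add: nu emA_mult [symmetric] sg_additive [OF additive_emA, symmetric] sg_mult(1) [symmetric] sg_sg)
             (simp add: sg_def)
      next
        case False
        then have "\<mu> (unP X) = 0" using deg unP_Pc [OF X] by blast
        then show ?thesis by (simp add: nu additive.zero [OF additive_emA])
      qed
    qed
  qed
  then show ?case by simp
qed

end

section \<open>Transfer from and to the given coalgebra\<close>

context codifferential
begin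

lemma ainf_coderivation_cls:
  assumes \<alpha>: "\<And>j. GH j l (\<alpha> j)" and E: "\<And>j x. Err l \<alpha> j x = 0" and \<delta>: "\<And>j x. \<delta> j x = cls (D j x)"
  shows "ainf_coderivation P \<delta> l (\<lambda>j x. cls (\<alpha> j x))"
  unfolding ainf_coderivation_def
proof (intro conjI allI)
  show "graded_hom P (tens_power P j) l (\<lambda>x. cls (\<alpha> j x))" for j by (rule graded_hom_cls [OF \<alpha>])
  have \<delta>': "\<delta> j = (\<lambda>x. cls (D j x))" for j using \<delta> by blast
  fix N x
  have z: "der l (\<alpha> j) 0 = 0" for j by (rule additive.zero [OF is_derD(1) [OF is_der_der [OF \<alpha>]]])
  \<comment> \<open>The summand of \<open>Err\<close> with \<open>i = Suc N\<close> has no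
    counterpart in the coderivation equation; it vanishes because derivations kill \<open>A\<close>,
    where the component 0 takes its values.\<close>
  have "dD (Suc N) (\<alpha> 0 x) = 0"
    by (rule TN_0_eq [OF is_derD(1) [OF is_der_dD], of "\<lambda>v. 0"]) (auto intro: additiveI GH_TN [OF \<alpha>])
  then have 1: "(\<Sum>i\<le>Suc N. dD i (\<alpha> (Suc N - i) x)) = (\<Sum>i\<le>N. dD i (\<alpha> (Suc N - i) x))"
    by simp
  have "(\<Sum>i\<le>Suc N. der l (\<alpha> (Suc N - i)) (D i x)) = (\<Sum>i\<le>Suc N. der l (\<alpha> i) (D (Suc N - i) x))"
    by (rule sum_reverse [symmetric, of "\<lambda>i j. der l (\<alpha> i) (D j x)"])
  also have "\<dots> = (\<Sum>i\<le>N. der l (\<alpha> i) (D (Suc N - i) x))" by (simp add: D_0 z)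
  finally have "(\<Sum>i\<le>N. dD i (\<alpha> (Suc N - i) x)) = sg l (\<Sum>i\<le>N. der l (\<alpha> i) (D (Suc N - i) x))"
    using E [of "Suc N" x] 1 by (simp add: Err_def sum_subtractf sg_sum [symmetric] del: sum.atMost_Suc)
  then show "(\<Sum>(r, s, t)\<in>{(r, s, t). r + s + t = N}. insert_map P r t 1 (\<delta> s) (cls (\<alpha> (N - s + 1) x))) =
    sgn_tens l (\<Sum>(r, s, t)\<in>{(r, s, t). r + s + t = N}. insert_map P r t l (\<lambda>x. cls (\<alpha> s x)) (\<delta> (N - s + 1) x))"
    unfolding \<delta>' using sum_insert_map [OF D, of "\<lambda>j. \<alpha> j x" N, OF GH_TN [OF \<alpha>]]
      sum_insert_map [OF \<alpha>, of "\<lambda>j. D j x" N, OF GH_TN [OF D]]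
    by (simp only: sgn_tens_cls)
qed

end

lemma codifferentialI:
  fixes s :: "'k::field \<Rightarrow> 'a::{ring,monoid_mult} \<Rightarrow> 'a" and P :: "('a, 'p::ab_group_add) gbimod"
  assumes alg: "unital_algebra s" and coalg: "ainf_coalgebra s P \<delta>"
  defines "D \<equiv> \<lambda>j x. tensor_powers.rep s P (\<delta> j x)"
  shows "codifferential s P D" and "\<delta> j x = tensor_powers.cls s P (D j x)"
proof -
  interpret tensor_powers s P
    using alg coalg by unfold_locales (auto simp: ainf_coalgebra_def)
  have eq: "\<delta> j x = cls (D j x)" and GH: "GH j 1 (D j)" for j x
  proof -
    show "\<delta> j x = cls (D j x)"
    proof (cases "j = 0")
      case True
      then have "\<delta> j x = cls 0" using coalg by (simp add: ainf_coalgebra_def cls_0)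
      then show ?thesis by (simp add: D_def rep_cls rho_id subgrp_0 [OF subgrp_spn])
    next
      case False
      then have "graded_hom P (tens_power P j) 1 (\<delta> j)" using coalg by (simp add: ainf_coalgebra_def)
      then show ?thesis unfolding D_def by (rule graded_hom_rep(2))
    qed
    show "GH j 1 (D j)"
    proof (cases "j = 0")
      case True
      then have "D j = (\<lambda>x. 0)"
        using coalg by (intro ext) (simp add: D_def ainf_coalgebra_def cls_0 [symmetric] rep_cls rho_id subgrp_0 [OF subgrp_spn])
      then show ?thesis by (simp add: GH_0)
    next
      case False
      then have "graded_hom P (tens_power P j) 1 (\<delta> j)" using coalg by (simp add: ainf_coalgebra_def)
      then show ?thesis unfolding D_def by (rule graded_hom_rep(1))
    qed
  qed
  show "\<delta> j x = cls (D j x)" by (rule eq)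
  have D0: "D 0 x = 0" for x
    using coalg by (simp add: D_def ainf_coalgebra_def cls_0 [symmetric] rep_cls rho_id subgrp_0 [OF subgrp_spn])
  show "codifferential s P D"
  proof
    show "GH n 1 (D n)" for n by (rule GH)
    show "D 0 x = 0" for x by (rule D0)
    have z: "der 1 (D j) 0 = 0" for j by (rule additive.zero [OF is_derD(1) [OF is_der_der [OF GH]]])
    show "(\<Sum>i\<le>M. der 1 (D i) (D (M - i) x)) = 0" for M x
    \<comment> \<open>Index 0 corresponds to no relation of the coalgebra; there the claim holds
      because \<open>D 0 = 0\<close>.\<close>
    proof (cases M)
      case 0
      then show ?thesis by (simp add: D0 z)
    next
      case (Suc N)
      have \<delta>: "\<delta> j = (\<lambda>x. cls (D j x))" for j using eq by blast
      have "(\<Sum>(r, s, t)\<in>{(r, s, t). r + s + t = N}. insert_map P r t 1 (\<delta> s) (\<delta> (N - s + 1) x)) = NN"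
        using coalg by (simp add: ainf_coalgebra_def)
      then have "cls (\<Sum>i\<le>N. der 1 (D i) (D (Suc N - i) x)) = cls 0"
        unfolding \<delta> sum_insert_map [OF GH, of "\<lambda>j. D j x" N, OF GH_TN [OF GH]] cls_0 .
      then have "(\<Sum>i\<le>N. der 1 (D i) (D (Suc N - i) x)) = 0"
        by (rule cls_inj [rotated 2])
           (auto intro!: subgrp_sum [OF subgrp_spn] subgrp_0 [OF subgrp_spn] is_derD(2) [OF is_der_der [OF GH]])
      then show ?thesis by (simp add: Suc D0 z)
    qed
  qed
qed

theorem theorem4p4p6:
  fixes s :: "'k::field \<Rightarrow> 'a::{ring,monoid_mult} \<Rightarrow> 'a"
    and P :: "('a, 'p::ab_group_add) gbimod"
    and d :: "'p \<Rightarrow> 'p"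
    and \<mu> :: "'p \<Rightarrow> 'a"
    and \<delta> :: "nat \<Rightarrow> 'p \<Rightarrow> ('a, 'p) tens"
    and f :: "'p \<Rightarrow> 'a"
    and n :: int
  assumes "unital_algebra s"
    and "shifted_resolution s P d \<mu>"
    and "ainf_coalgebra s P \<delta>"
    and "weakly_counital P \<delta> \<mu>"
    and "\<forall>x. \<delta> 1 x = emb1 P (d x)"
    and "graded_hom P alg_bimod n f"
    and "\<forall>x. f (d x) = 0"
  shows "\<exists>\<alpha>. ainf_coderivation P \<delta> n \<alpha> \<and> (\<forall>x. \<alpha> 0 x = emb0 P (f x))"
proof -
  define D where "D j x = tensor_powers.rep s P (\<delta> j x)" for j x
  interpret codifferential s P D
    using codifferentialI(1) [OF assms(1,3)] by (simp add: D_def [abs_def])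
  have \<delta>: "\<delta> j x = cls (D j x)" for j x
    using codifferentialI(2) [OF assms(1,3)] by (simp add: D_def [abs_def])
  let ?Q = "P\<lparr>hcomp := (\<lambda>i. hcomp P (i + 1))\<rparr>"
  note res = assms(2) [unfolded shifted_resolution_def projective_resolution_def]
  have d: "graded_hom ?Q ?Q 1 d" and \<mu>: "graded_hom ?Q alg_bimod 0 \<mu>" using res by blast+
  have dB: "d (x + y) = d x + d y" "d (lact P a x) = lact P a (d x)" "d (ract P x a) = ract P (d x) a" for x y a
    using d by (simp_all add: graded_hom_def bimod_hom_def)
  have \<mu>B: "\<mu> (x + y) = \<mu> x + \<mu> y" "\<mu> (lact P a x) = a * \<mu> x" "\<mu> (ract P x a) = \<mu> x * a" for x y a
    using \<mu> by (simp_all add: graded_hom_def bimod_hom_def alg_bimod_def)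
  have \<mu>_deg: "\<mu> x = 0" if "x \<in> hcomp P i" "i \<noteq> 1" for x i
  proof -
    have "\<forall>i. \<forall>x\<in>hcomp P (i + 1). \<mu> x \<in> (if i = 0 then UNIV else {0})"
      using \<mu> by (simp add: graded_hom_def alg_bimod_def)
    from this [rule_format, of x "i - 1"] that show ?thesis by simp
  qed
  interpret augmentation s P \<mu>
    by unfold_locales (simp_all add: \<mu>B additiveI)
  have cu2: "map_power P (-1) \<mu> 2 (\<delta> 2 x) = emb0 P (\<mu> x)"
    and cun: "2 < j \<Longrightarrow> map_power P (-1) \<mu> j (\<delta> j x) = NN" for j x
    using assms(4) unfolding weakly_counital_def by blast+
  have emA_inj: "a = b" if "cls (emA a) = cls (emA b)" for a b
    using cls_inj [OF _ _ that] nu_emA by (metis wd_TT)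
  have D1: "D 1 x = emP (d x)" for x
    by (rule cls_inj) (simp_all only: GH_TT [OF D] wd_TT \<delta> [symmetric] assms(5) [rule_format] emb1_cls)
  interpret resolution s P D \<mu> d
  proof
    show "D 1 x = emP (d x)" for x by (rule D1)
    show "d (x + y) = d x + d y" for x y by (rule dB)
    show "d (la a x) = la a (d x)" "d (ra x a) = ra (d x) a" for a x by (rule dB)+
    show "d x \<in> Pc (i + 1)" if "x \<in> Pc i" for x i
    proof -
      have "\<forall>i. \<forall>x\<in>hcomp P (i + 1). d x \<in> hcomp P (i + 1 + 1)"
        using d by (simp add: graded_hom_def)
      from this [rule_format, of x "i - 1"] that show ?thesis by simp
    qed
    show "d (d x) = 0" "\<mu> (d x) = 0" for x using res by blast+
    show "\<mu> x = 0" if "x \<in> Pc i" "i \<noteq> 1" for x i using \<mu>_deg that .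
    show "Pc i = {0}" if "1 < i" for i
    proof -
      have "\<forall>i>0. hcomp P (i + 1) = {0}" using res by simp
      from this [rule_format, of "i - 1"] that show ?thesis by simp
    qed
    show "x \<in> d ` Pc (i - 1)" if "i < 1" "x \<in> Pc i" "d x = 0" for i x
    proof -
      have "\<forall>i<0. \<forall>x\<in>hcomp P (i + 1). d x = 0 \<longrightarrow> x \<in> d ` hcomp P (i - 1 + 1)" using res by simp
      from this [rule_format, of "i - 1" x] that show ?thesis by simp
    qed
    show "x \<in> d ` Pc 0" if "x \<in> Pc 1" "\<mu> x = 0" for x using res that by simp
    show "\<exists>p\<in>Pc 1. \<mu> p = 1"
    proof -
      have "\<mu> ` hcomp P 1 = UNIV" using res by simp
      then show ?thesis by (metis UNIV_I imageE)
    qed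
    show "projective_bimod s (P\<lparr>carrier := Pc i\<rparr>)" for i
    proof -
      have "\<forall>i. projective_bimod s (?Q\<lparr>carrier := hcomp P (i + 1)\<rparr>)" using res by simp
      from this [rule_format, of "i - 1"] show ?thesis
        by (simp add: projective_bimod_def bimod_hom_def)
    qed
    \<comment> \<open>The minus appears because \<open>sn 2 = 1\<close>.\<close>
    show "n\<mu> (D 2 x) = - \<mu> x" for x
    proof -
      have "cls (emA (sg (sn 2) (n\<mu> (D 2 x)))) = cls (emA (\<mu> x))"
        using cu2 [of x] map_power_cls [OF \<mu>_deg GH_TN [OF D [of 2], of x]] by (simp add: \<delta> emb0_cls)
      from emA_inj [OF this] show ?thesis by (simp add: numeral_2_eq_2 minus_equation_iff)
    qed
    show "n\<mu> (D j x) = 0" if "2 < j" for j x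
    proof -
      have "cls (emA (sg (sn j) (n\<mu> (D j x)))) = cls (emA 0)"
        using cun [OF that, of x] map_power_cls [OF \<mu>_deg GH_TN [OF D [of j], of x]]
        by (simp add: \<delta> additive.zero [OF additive_emA] cls_0)
      from emA_inj [OF this] show ?thesis by (simp add: sg_def split: if_splits)
    qed
  qed
  have f: "f (x + y) = f x + f y" "f (la a x) = a * f x" "f (ra x a) = f x * a"
    "x \<in> Pc i \<Longrightarrow> f x \<in> (if i + n = 0 then UNIV else {0})" for x y a i
    using assms(6) by (simp_all add: graded_hom_def bimod_hom_def alg_bimod_def)
  have "GH 0 n (\<lambda>x. emA (f x))"
    unfolding GH_def
  proof (intro conjI allI ballI)
    show "additive (\<lambda>x. emA (f x))" by (auto intro!: additiveI simp: f additive.add [OF additive_emA])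
    show "emA (f x) \<in> TH 0 (i + n)" if "x \<in> Pc i" for x i
      using f(4) [OF that] emA_TH TH_0 by (auto simp: additive.zero [OF additive_emA] split: if_splits)
  qed (simp_all add: f emA_mult)
  then obtain \<alpha> where \<alpha>: "\<And>j. GH j n (\<alpha> j)" "\<And>j x. Err n \<alpha> j x = 0" "\<alpha> 0 = (\<lambda>x. emA (f x))"
    using coderivation_exists [of n "\<lambda>x. emA (f x)"] assms(7) by (auto simp: additive.zero [OF additive_emA])
  show ?thesis
  proof (intro exI conjI allI)
    show "ainf_coderivation P \<delta> n (\<lambda>j x. cls (\<alpha> j x))" by (rule ainf_coderivation_cls [OF \<alpha>(1,2) \<delta>])
    show "cls (\<alpha> 0 x) = emb0 P (f x)" for x by (simp add: \<alpha>(3) emb0_cls)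
  qed
qed

end
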